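(* Let $\Gamma=(X,\sim)$ be a $\mathbb{Z}^n$-periodic discrete graph with $N$ orbits, $v\in SO(X)$, and $\mathcal{H}_\Gamma=\Delta_\Gamma+vI$ on $l^p(X)$, $p\in(1,\infty)$. Then $\mathrm{sp}_{ess}\mathcal{H}_\Gamma=\bigcup_{\mathcal{H}^g_\Gamma\in\mathrm{op}(\mathcal{H}_\Gamma)}\bigcup_{j=1}^N\mathcal{C}_j(\mathcal{H}^g_\Gamma)$.
   Context: A discrete infinite graph is a countable set $X$ with an anti-reflexive symmetric relation $\sim$ such that each $x$ has finitely many $y$ with $x\sim y$; $m(x)$ is the number of such $y$. It is assumed connected, and $\rho$ is the graph distance. $\Gamma$ is a $\mathbb{Z}^n$-periodic discrete graph if it is a connected discrete infinite graph on which $\mathbb{Z}^n$ acts freely, $(\alpha,x)\mapsto\alpha\cdot x$, with $x\sim y\iff\alpha\cdot x\sim\alpha\cdot y$, and with finitely many orbits, with fixed representatives $x_1,\dots,x_N$. $(\Delta_\Gamma u)(x)=\frac{1}{m(x)}\sum_{y\sim x}u(y)$; $vI$ is multiplication by $v$. $SO(X)$ is the set of $a\in l^\infty(X)$ with $\lim_{\alpha\to\infty}(a(\alpha\cdot x)-a(\alpha\cdot y))=0$ for all $x,y\in X$. $(T_\alpha u)(x)=u((-\alpha)\cdot x)$. For $h:\mathbb{N}\to\mathbb{Z}^n$ tending to infinity, $A_h$ is the limit operator of $A$ if $T_{h(m)}^{-1}AT_{h(m)}\to A_h$ and $T_{h(m)}^{-1}A^*T_{h(m)}\to A_h^*$ strongly;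 $\mathrm{op}(\mathcal{H}_\Gamma)$ is the set of limit operators, which are the operators $\mathcal{H}_\Gamma^g=\Delta_\Gamma+v^gI$ with $v^g(x)=\lim_m v(g(m)\cdot x)$, $v^g$ being $\mathbb{Z}^n$-periodic. For a $\mathbb{Z}^n$-periodic operator $B$ with generating function $k_B$ ($(Bu)(x)=\sum_yk_B(x,y)u(y)$) of finite band width, its symbol is $\sigma_B(t)=\sum_{\beta\in\mathbb{Z}^n}(k_B(\beta\cdot x_i,x_j))_{i,j=1}^Nt^\beta$, $t\in\mathbb{T}^n$, and $\mathcal{C}_j(B)=\{\lambda_B^j(t):t\in\mathbb{T}^n\}$ where $\lambda^1_B(t),\dots,\lambda^N_B(t)$ are the eigenvalues of $\sigma_B(t)$ enumerated continuously in $t$. *)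

theory Defs
  imports "HOL-Analysis.Analysis" "HOL-Library.Function_Algebras" "Jordan_Normal_Form.Char_Poly"
begin

text \<open>Z^n is represented as the type 'n \<Rightarrow> int for a finite type 'n (n = CARD('n)).
  The vertex set X is a countable type 'x; adj is the relation \<sim>; act is the action.\<close>

definition nbrs :: "('x \<Rightarrow> 'x \<Rightarrow> bool) \<Rightarrow> 'x \<Rightarrow> 'x set" where
  "nbrs adj x = {y. adj x y}"

definition deg :: "('x \<Rightarrow> 'x \<Rightarrow> bool) \<Rightarrow> 'x \<Rightarrow> nat" where
  "deg adj x = card (nbrs adj x)"

definition discrete_infinite_graph :: "('x::countable \<Rightarrow> 'x \<Rightarrow> bool) \<Rightarrow> bool" where
  "discrete_infinite_graph adj \<longleftrightarrow>
     infinite (UNIV :: 'x set) \<and>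
     (\<forall>x. \<not> adj x x) \<and> (\<forall>x y. adj x y \<longrightarrow> adj y x) \<and>
     (\<forall>x. finite (nbrs adj x)) \<and>
     (\<forall>x y. adj\<^sup>*\<^sup>* x y)"

definition periodic_graph ::
  "('x::countable \<Rightarrow> 'x \<Rightarrow> bool) \<Rightarrow> (('n::finite \<Rightarrow> int) \<Rightarrow> 'x \<Rightarrow> 'x) \<Rightarrow> nat \<Rightarrow> (nat \<Rightarrow> 'x) \<Rightarrow> bool" where
  "periodic_graph adj act N reps \<longleftrightarrow>
     discrete_infinite_graph adj \<and>
     (\<forall>x. act 0 x = x) \<and>
     (\<forall>\<alpha> \<beta> x. act (\<alpha> + \<beta>) x = act \<alpha> (act \<beta> x)) \<and>
     (\<forall>\<alpha> x. act \<alpha> x = x \<longrightarrow> \<alpha> = 0) \<and>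
     (\<forall>\<alpha> x y. adj x y \<longleftrightarrow> adj (act \<alpha> x) (act \<alpha> y)) \<and>
     (\<forall>x. \<exists>!i. i < N \<and> (\<exists>\<alpha>. x = act \<alpha> (reps i)))"

text \<open>\<alpha> \<rightarrow> \<infinity> in Z^n is the cofinite filter.\<close>
definition SO :: "(('n::finite \<Rightarrow> int) \<Rightarrow> 'x \<Rightarrow> 'x) \<Rightarrow> ('x \<Rightarrow> complex) set" where
  "SO act = {a. bounded (range a) \<and>
     (\<forall>x y. ((\<lambda>\<alpha>. a (act \<alpha> x) - a (act \<alpha> y)) \<longlongrightarrow> 0) cofinite)}"

definition schroedinger :: "('x \<Rightarrow> 'x \<Rightarrow> bool) \<Rightarrow> ('x \<Rightarrow> complex) \<Rightarrow> ('x \<Rightarrow> complex) \<Rightarrow> ('x \<Rightarrow> complex)" where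
  "schroedinger adj v u = (\<lambda>x. (\<Sum>y\<in>nbrs adj x. u y) / of_nat (deg adj x) + v x * u x)"

definition lp :: "real \<Rightarrow> ('x \<Rightarrow> complex) set" where
  "lp p = {u. (\<lambda>x. norm (u x) powr p) summable_on UNIV}"

definition lp_norm :: "real \<Rightarrow> ('x \<Rightarrow> complex) \<Rightarrow> real" where
  "lp_norm p u = (\<Sum>\<^sub>\<infinity>x. norm (u x) powr p) powr (1 / p)"

definition lin_comb :: "('x \<Rightarrow> complex) set \<Rightarrow> ('x \<Rightarrow> complex) set" where
  "lin_comb F = {(\<lambda>x. \<Sum>f\<in>F. c f * f x) | c. True}"

definition fredholm_lp :: "real \<Rightarrow> (('x \<Rightarrow> complex) \<Rightarrow> ('x \<Rightarrow> complex)) \<Rightarrow> bool" where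
  "fredholm_lp p A \<longleftrightarrow>
     (\<exists>F. finite F \<and> F \<subseteq> lp p \<and> {u \<in> lp p. A u = (\<lambda>_. 0)} \<subseteq> lin_comb F) \<and>
     (\<forall>w s. w \<in> lp p \<and> (\<forall>k. s k \<in> A ` lp p) \<and> (\<lambda>k. lp_norm p (\<lambda>x. s k x - w x)) \<longlonglongrightarrow> 0
            \<longrightarrow> w \<in> A ` lp p) \<and>
     (\<exists>F. finite F \<and> F \<subseteq> lp p \<and> lp p \<subseteq> {(\<lambda>x. r x + c x) | r c. r \<in> A ` lp p \<and> c \<in> lin_comb F})"

definition ess_spectrum_lp :: "real \<Rightarrow> (('x \<Rightarrow> complex) \<Rightarrow> ('x \<Rightarrow> complex)) \<Rightarrow> complex set" where
  "ess_spectrum_lp p A = {z. \<not> fredholm_lp p (\<lambda>u x. A u x - z * u x)}"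

text \<open>Potentials v^g of the limit operators H^g = \<Delta> + v^g I of \<Delta> + vI:
  g : nat \<Rightarrow> Z^n tends to infinity and v^g(x) = lim v(g(m)\<cdot>x).\<close>
definition limit_potentials :: "(('n::finite \<Rightarrow> int) \<Rightarrow> 'x \<Rightarrow> 'x) \<Rightarrow> ('x \<Rightarrow> complex) \<Rightarrow> ('x \<Rightarrow> complex) set" where
  "limit_potentials act v = {w. \<exists>g :: nat \<Rightarrow> ('n \<Rightarrow> int). filterlim g cofinite sequentially \<and>
      (\<forall>x. (\<lambda>m. v (act (g m) x)) \<longlonglongrightarrow> w x)}"

definition kernel_fn :: "('x \<Rightarrow> 'x \<Rightarrow> bool) \<Rightarrow> ('x \<Rightarrow> complex) \<Rightarrow> 'x \<Rightarrow> 'x \<Rightarrow> complex" where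
  "kernel_fn adj w x y = (if adj x y then 1 / of_nat (deg adj x) else 0) + (if x = y then w x else 0)"

definition tpow :: "('n::finite \<Rightarrow> complex) \<Rightarrow> ('n \<Rightarrow> int) \<Rightarrow> complex" where
  "tpow t \<beta> = (\<Prod>k\<in>UNIV. t k powi \<beta> k)"

definition torus :: "('n::finite \<Rightarrow> complex) set" where
  "torus = {t. \<forall>k. norm (t k) = 1}"

text \<open>Symbol: the (finite, by finite band width) sum over \<beta> of k_B(\<beta>\<cdot>x_i, x_j) t^\<beta>.\<close>
definition symbol ::
  "('x \<Rightarrow> 'x \<Rightarrow> bool) \<Rightarrow> (('n::finite \<Rightarrow> int) \<Rightarrow> 'x \<Rightarrow> 'x) \<Rightarrow> nat \<Rightarrow> (nat \<Rightarrow> 'x) \<Rightarrow> ('x \<Rightarrow> complex)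
     \<Rightarrow> ('n \<Rightarrow> complex) \<Rightarrow> complex mat" where
  "symbol adj act N reps w t = mat N N (\<lambda>(i, j).
      \<Sum>\<beta>\<in>{\<beta>. kernel_fn adj w (act \<beta> (reps i)) (reps j) \<noteq> 0}.
        kernel_fn adj w (act \<beta> (reps i)) (reps j) * tpow t \<beta>)"

text \<open>\<Union>_{j=1..N} C_j(B): all eigenvalues \<lambda>_B^j(t) of \<sigma>_B(t), t \<in> T^n.\<close>
definition band_union ::
  "('x \<Rightarrow> 'x \<Rightarrow> bool) \<Rightarrow> (('n::finite \<Rightarrow> int) \<Rightarrow> 'x \<Rightarrow> 'x) \<Rightarrow> nat \<Rightarrow> (nat \<Rightarrow> 'x) \<Rightarrow> ('x \<Rightarrow> complex)
     \<Rightarrow> complex set" where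
  "band_union adj act N reps w = {z. \<exists>t\<in>torus. eigenvalue (symbol adj act N reps w t) z}"

end

theory Submission
  imports Defs
begin

text \<open>By slow oscillation every limit potential is a constant \<open>c\<close>, and Bloch waves turn the symbol at \<open>t\<close>
  into the operator \<open>\<Delta> + c\<close> acting on functions that are quasi-periodic with multiplier \<open>t\<close>.

  If \<open>z\<close> avoids all bands, put \<open>B = \<Delta> + v - z\<close>, let \<open>B*\<close> be its adjoint for the weight \<open>deg\<close>, and let
  \<open>T = I - \<epsilon> B* B\<close>. By compactness the constant-coefficient versions of \<open>T\<close> contract quasi-periodic
  functions, uniformly in \<open>t\<close> and in the limit value \<open>c\<close>; hence the matrix entries of \<open>T ^ K\<close> decay
  geometrically in \<open>K\<close>, while its band width grows only linearly. For a suitable fixed \<open>K\<close> and far away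
  from the origin, \<open>T ^ K\<close> is therefore small as an operator on \<open>l\<^sup>p\<close>, and \<open>\<epsilon> (\<Sum>k<K. T ^ k) B*\<close> inverts \<open>B\<close>
  up to a small operator and one of finite rank; exchanging \<open>B\<close> and \<open>B*\<close> in \<open>T\<close> gives the inverse on the
  other side. No infinite Wiener-type series is needed.

  If \<open>z\<close> lies in a band, truncated Bloch waves form a Weyl sequence in the dual space \<open>l\<^sup>q\<close> with disjoint
  supports, and a gliding hump argument shows that the range of \<open>B\<close> has infinite codimension.\<close>

section \<open>Coordinates on a periodic graph\<close>

text \<open>For \<open>p\<close> other than 2 there is no orthogonality in \<open>lp p\<close>, and
  \<open>v\<close> may be complex, so Hilbert space arguments are confined to the
  \<open>N\<close>-dimensional spaces of functions with a fixed multiplier \<open>t\<close>. The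
  contraction estimate obtained there is read off at single matrix entries, where \<open>p\<close>
  no longer occurs; a Schur test brings it back to \<open>lp p\<close> and loses only a power of the
  band width.

  The order of choices is forced. \<open>K\<close> is fixed with the constant-coefficient models in
  view, and only then the finite exceptional set: the entries of \<open>T ^ K\<close> approach those
  of the models far out for each fixed \<open>K\<close>, with no uniformity in \<open>K\<close>.

  On the bands the third clause of \<open>fredholm_lp\<close> is refuted, finite codimension of the
  range. This calls for approximate null functions of the transpose rather than of \<open>B\<close>.
  For the bilinear pairing with weight \<open>deg\<close> the operator \<open>B\<close> is its own
  transpose, so Bloch waves for the same \<open>z\<close> and \<open>t\<close> can be used even if
  \<open>v\<close> is complex.\<close>

locale periodic =
  fixes adj :: "'x::countable \<Rightarrow> 'x \<Rightarrow> bool"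
    and act :: "('n::finite \<Rightarrow> int) \<Rightarrow> 'x \<Rightarrow> 'x"
    and N :: nat and reps :: "nat \<Rightarrow> 'x"
  assumes periodic_graph: "periodic_graph adj act N reps"
begin

lemma
  graph: "discrete_infinite_graph adj"
  and act_0 [simp]: "act 0 x = x"
  and act_add: "act (\<alpha> + \<beta>) x = act \<alpha> (act \<beta> x)"
  and act_free: "act \<alpha> x = x \<Longrightarrow> \<alpha> = 0"
  and adj_act [simp]: "adj (act \<alpha> x) (act \<alpha> y) \<longleftrightarrow> adj x y"
  and ex1_rep: "\<exists>!i. i < N \<and> (\<exists>\<alpha>. x = act \<alpha> (reps i))"
proof -
  have *: "discrete_infinite_graph adj" "\<forall>x. act 0 x = x"
     "\<forall>\<alpha> \<beta> x. act (\<alpha> + \<beta>) x = act \<alpha> (act \<beta> x)"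
     "\<forall>\<alpha> x. act \<alpha> x = x \<longrightarrow> \<alpha> = 0"
     "\<forall>\<alpha> x y. adj x y \<longleftrightarrow> adj (act \<alpha> x) (act \<alpha> y)"
     "\<forall>x. \<exists>!i. i < N \<and> (\<exists>\<alpha>. x = act \<alpha> (reps i))"
    using periodic_graph unfolding periodic_graph_def by - (elim conjE, assumption)+
  show "discrete_infinite_graph adj" by (rule *)
  show "act 0 x = x" using *(2) by (rule spec)
  show "act (\<alpha> + \<beta>) x = act \<alpha> (act \<beta> x)" using *(3) by (elim allE)
  show "act \<alpha> x = x \<Longrightarrow> \<alpha> = 0" using *(4) by iprover
  show "adj (act \<alpha> x) (act \<alpha> y) \<longleftrightarrow> adj x y" using *(5) by iprover
  show "\<exists>!i. i < N \<and> (\<exists>\<alpha>. x = act \<alpha> (reps i))" using *(6) by (rule spec)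
qed

lemma adj_sym: "adj x y \<Longrightarrow> adj y x"
  and adj_irrefl [simp]: "\<not> adj x x"
  and finite_nbrs [simp]: "finite (nbrs adj x)"
  and adj_connected: "adj\<^sup>*\<^sup>* x y"
  and infinite_vertices: "infinite (UNIV :: 'x set)"
  using graph unfolding discrete_infinite_graph_def by auto

lemma act_uminus_act [simp]: "act (- \<alpha>) (act \<alpha> x) = x" "act \<alpha> (act (- \<alpha>) x) = x"
  by (simp_all flip: act_add)

lemma act_eq_iff: "act \<alpha> x = act \<alpha> y \<longleftrightarrow> x = y"
  by (metis act_uminus_act(1))

lemma act_left_cancel: "act \<alpha> x = act \<beta> x \<Longrightarrow> \<alpha> = \<beta>"
proof -
  assume "act \<alpha> x = act \<beta> x"
  then have "act (- \<beta> + \<alpha>) x = x" by (simp only: act_add act_uminus_act)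
  then have "- \<beta> + \<alpha> = 0" by (rule act_free)
  then show ?thesis by (metis neg_eq_iff_add_eq_0 minus_minus)
qed

definition idx :: "'x \<Rightarrow> nat" where
  "idx x = (THE i. i < N \<and> (\<exists>\<alpha>. x = act \<alpha> (reps i)))"

text \<open>Freeness makes the group element unique. Together with \<open>idx\<close> it identifies
  the vertex set with \<open>N\<close> copies of the lattice, on which the action is
  translation.\<close>

definition crd :: "'x \<Rightarrow> 'n \<Rightarrow> int" where
  "crd x = (THE \<alpha>. x = act \<alpha> (reps (idx x)))"

lemma idx_spec: "idx x < N \<and> (\<exists>\<alpha>. x = act \<alpha> (reps (idx x)))"
  unfolding idx_def by (rule theI'[OF ex1_rep])

lemma idx_less [simp]: "idx x < N"
  using idx_spec by blast

lemma idx_eqI: "i < N \<Longrightarrow> x = act \<alpha> (reps i) \<Longrightarrow> idx x = i"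
  unfolding idx_def by (rule the1_equality[OF ex1_rep]) blast

lemma act_crd [simp]: "act (crd x) (reps (idx x)) = x"
proof -
  obtain \<alpha> where "x = act \<alpha> (reps (idx x))" using idx_spec by blast
  then have "\<exists>!\<alpha>. x = act \<alpha> (reps (idx x))" by (metis act_left_cancel)
  from theI'[OF this] show ?thesis unfolding crd_def by simp
qed

lemma crd_eqI: "x = act \<alpha> (reps (idx x)) \<Longrightarrow> crd x = \<alpha>"
  by (metis act_crd act_left_cancel)

lemma idx_act [simp]: "idx (act \<alpha> x) = idx x"
  by (rule idx_eqI[of _ _ "\<alpha> + crd x"]) (simp_all add: act_add)

lemma crd_act [simp]: "crd (act \<alpha> x) = \<alpha> + crd x"
  by (rule crd_eqI) (simp add: act_add)

lemma idx_reps [simp]: "i < N \<Longrightarrow> idx (reps i) = i"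
  by (rule idx_eqI[of _ _ 0]) auto

lemma crd_reps [simp]: "i < N \<Longrightarrow> crd (reps i) = 0"
  by (rule crd_eqI) auto

lemma vertex_eqI: "idx x = idx y \<Longrightarrow> crd x = crd y \<Longrightarrow> x = y"
  by (metis act_crd)

lemma N_pos: "0 < N"
  using idx_less by (metis gr_zeroI not_less_zero)

lemma nbrs_act: "nbrs adj (act \<alpha> x) = act \<alpha> ` nbrs adj x"
proof (intro Set.set_eqI iffI)
  fix y assume "y \<in> nbrs adj (act \<alpha> x)"
  then have "adj (act \<alpha> x) (act \<alpha> (act (- \<alpha>) y))" by (simp add: nbrs_def)
  then have "act (- \<alpha>) y \<in> nbrs adj x" by (simp only: adj_act nbrs_def mem_Collect_eq)
  then show "y \<in> act \<alpha> ` nbrs adj x" by (intro image_eqI[of _ _ "act (- \<alpha>) y"]) simp_all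
qed (auto simp: nbrs_def)

lemma inj_act [simp]: "inj_on (act \<alpha>) A"
  by (simp add: inj_on_def act_eq_iff)

lemma deg_act [simp]: "deg adj (act \<alpha> x) = deg adj x"
  by (simp add: deg_def nbrs_act card_image)

lemma nbrs_nonempty: "nbrs adj x \<noteq> {}"
proof -
  obtain y where "y \<noteq> x" using infinite_vertices
    by (metis UNIV_eq_I finite.emptyI finite_insert insert_iff)
  with adj_connected[of x y] obtain z where "adj x z" by (metis converse_rtranclpE)
  then show ?thesis by (auto simp: nbrs_def)
qed

lemma deg_pos [simp]: "0 < deg adj x"
  by (simp add: deg_def card_gt_0_iff nbrs_nonempty)

lemma deg_reps_idx: "deg adj (reps (idx x)) = deg adj x"
  by (metis act_crd deg_act)

text \<open>A box in the lattice coordinate, taken over all \<open>N\<close> orbits, replaces balls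
  of the graph metric: it is translation invariant and its cardinality is known exactly.\<close>

definition near :: "nat \<Rightarrow> 'x \<Rightarrow> 'x set" where
  "near r x = {y. \<forall>k. \<bar>crd y k - crd x k\<bar> \<le> int r}"

lemma near_self [simp]: "x \<in> near r x"
  by (simp add: near_def)

lemma near_sym: "y \<in> near r x \<longleftrightarrow> x \<in> near r y"
  by (simp add: near_def abs_minus_commute)

lemma near_mono: "r \<le> s \<Longrightarrow> near r x \<subseteq> near s x"
  by (auto simp: near_def intro: order_trans)

lemma near_trans:
  assumes "y \<in> near r x" "w \<in> near s y"
  shows "w \<in> near (r + s) x"
proof -
  have "\<bar>crd w k - crd x k\<bar> \<le> int (r + s)" for k
  proof -
    have "\<bar>crd y k - crd x k\<bar> \<le> int r" "\<bar>crd w k - crd y k\<bar> \<le> int s"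
      using assms by (simp_all add: near_def)
    then show ?thesis by linarith
  qed
  then show ?thesis by (simp add: near_def)
qed

lemma act_near_iff [simp]: "act \<alpha> y \<in> near r (act \<alpha> x) \<longleftrightarrow> y \<in> near r x"
  by (simp add: near_def)

lemma near_act: "near r (act \<alpha> x) = act \<alpha> ` near r x"
proof (intro Set.set_eqI iffI)
  fix y assume "y \<in> near r (act \<alpha> x)"
  then have "act \<alpha> (act (- \<alpha>) y) \<in> near r (act \<alpha> x)" by simp
  then have "act (- \<alpha>) y \<in> near r x" by (simp only: act_near_iff)
  then show "y \<in> act \<alpha> ` near r x" by (intro image_eqI[of _ _ "act (- \<alpha>) y"]) simp_all
qed auto

definition nearorb :: "nat \<Rightarrow> ('n \<Rightarrow> int) \<Rightarrow> ('n \<Rightarrow> int) set" where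
  "nearorb r \<alpha> = {\<gamma>. \<forall>k. \<bar>\<gamma> k - \<alpha> k\<bar> \<le> int r}"

lemma nearorb_PiE: "nearorb r \<alpha> = (\<Pi>\<^sub>E k\<in>UNIV. {\<alpha> k - int r..\<alpha> k + int r})"
  by (auto simp: nearorb_def PiE_UNIV_domain abs_le_iff Pi_iff algebra_simps)

lemma finite_nearorb [simp]: "finite (nearorb r \<alpha>)"
  unfolding nearorb_PiE by (intro finite_PiE) auto

lemma card_nearorb: "card (nearorb r \<alpha>) = (2 * r + 1) ^ CARD('n)"
  unfolding nearorb_PiE by (simp add: card_PiE nat_add_distrib nat_mult_distrib)

lemma bij_near: "bij_betw (\<lambda>(i, \<gamma>). act \<gamma> (reps i)) ({..<N} \<times> nearorb r (crd x)) (near r x)"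
  by (rule bij_betwI[where g = "\<lambda>y. (idx y, crd y)"]) (auto simp: near_def nearorb_def)

lemma finite_near [simp]: "finite (near r x)"
  using bij_betw_finite[OF bij_near] by auto

lemma card_near: "card (near r x) = N * (2 * r + 1) ^ CARD('n)"
  using bij_betw_same_card[OF bij_near, of r x] by (simp add: card_cartesian_product card_nearorb)

text \<open>Modulo translation there are only finitely many edges, so coordinates change by a
  bounded amount along an edge.\<close>

lemma ex_near_nbrs: "\<exists>D. \<forall>x y. adj x y \<longrightarrow> y \<in> near D x"
proof -
  define S where "S = (\<Union>i<N. nbrs adj (reps i))"
  have finS: "finite S" by (auto simp: S_def)
  define D where "D = (\<Sum>y\<in>S. \<Sum>k\<in>UNIV. nat \<bar>crd y k\<bar>)"
  have D: "\<bar>crd y k\<bar> \<le> int D" if "y \<in> S" for y k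
  proof -
    have "nat \<bar>crd y k\<bar> \<le> (\<Sum>k\<in>UNIV. nat \<bar>crd y k\<bar>)" by (rule member_le_sum) auto
    also have "\<dots> \<le> D" unfolding D_def
      by (rule member_le_sum[OF that, where f = "\<lambda>y. \<Sum>k\<in>UNIV. nat \<bar>crd y k\<bar>"]) (auto simp: finS)
    finally show ?thesis by linarith
  qed
  have "y \<in> near D x" if "adj x y" for x y
  proof -
    have "adj (act (- crd x) x) (act (- crd x) y)" using that by simp
    moreover have "act (- crd x) x = reps (idx x)" by (metis act_crd act_uminus_act(1))
    ultimately have "act (- crd x) y \<in> S" by (auto simp: S_def nbrs_def)
    from D[OF this] show ?thesis by (simp add: near_def)
  qed
  then show ?thesis by blast
qed

definition D :: nat where
  "D = (SOME D. \<forall>x y. adj x y \<longrightarrow> y \<in> near D x)"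

lemma nbrs_near: "y \<in> nbrs adj x \<Longrightarrow> y \<in> near D x"
  using someI_ex[OF ex_near_nbrs] unfolding D_def nbrs_def by blast

end

section \<open>The spaces lp\<close>

lemma lpI:
  assumes "\<And>F. finite F \<Longrightarrow> (\<Sum>x\<in>F. norm (u x) powr p) \<le> C"
  shows "u \<in> lp p"
  unfolding lp_def mem_Collect_eq
  by (rule nonneg_bdd_above_summable_on) (auto intro!: bdd_aboveI[of _ C] assms)

text \<open>The \<open>p\<close>-th power of the norm. Estimates stay at this level, where sums over
  vertices are compared term by term and the triangle inequality is replaced by the cruder
  \<open>psum_add\<close> with its factor \<open>2 powr p\<close>.\<close>

definition psum :: "real \<Rightarrow> ('x \<Rightarrow> complex) \<Rightarrow> real" where
  "psum p u = (\<Sum>\<^sub>\<infinity>x. norm (u x) powr p)"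

lemma psum_nonneg [simp]: "0 \<le> psum p u"
  unfolding psum_def by (rule infsum_nonneg) auto

lemma psum_leI:
  assumes "\<And>F. finite F \<Longrightarrow> (\<Sum>x\<in>F. norm (u x) powr p) \<le> C"
  shows "psum p u \<le> C"
proof -
  have "u \<in> lp p" using assms by (rule lpI)
  then show ?thesis unfolding psum_def lp_def mem_Collect_eq
    by (rule infsum_le_finite_sums) (use assms in auto)
qed

lemma sum_le_psum:
  assumes "u \<in> lp p" "finite F"
  shows "(\<Sum>x\<in>F. norm (u x) powr p) \<le> psum p u"
  unfolding psum_def
  by (rule finite_sum_le_infsum) (use assms in \<open>auto simp: lp_def\<close>)

lemma norm_powr_le_psum:
  assumes "u \<in> lp p"
  shows "norm (u x) powr p \<le> psum p u"
  using sum_le_psum[OF assms, of "{x}"] by simp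

lemma norm_le_psum:
  assumes "u \<in> lp p" "0 < p"
  shows "norm (u x) \<le> psum p u powr (1 / p)"
proof -
  have "norm (u x) = (norm (u x) powr p) powr (1 / p)" using assms by (simp add: powr_powr)
  also have "\<dots> \<le> psum p u powr (1 / p)"
    by (rule powr_mono2) (use assms norm_powr_le_psum in auto)
  finally show ?thesis .
qed

lemma norm_add_powr_le:
  fixes a b :: "'a::real_normed_vector"
  assumes "0 < p"
  shows "norm (a + b) powr p \<le> 2 powr p * (norm a powr p + norm b powr p)"
proof -
  have "norm (a + b) powr p \<le> (2 * max (norm a) (norm b)) powr p"
    by (rule powr_mono2) (use assms norm_triangle_ineq[of a b] in auto)
  also have "\<dots> = 2 powr p * max (norm a) (norm b) powr p" by (simp add: powr_mult)
  also have "\<dots> \<le> 2 powr p * (norm a powr p + norm b powr p)"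
    by (intro mult_left_mono) (auto simp: max_def)
  finally show ?thesis .
qed

lemma
  assumes "u \<in> lp p" "w \<in> lp p" "0 < p"
  shows lp_add: "(\<lambda>x. u x + w x) \<in> lp p"
    and psum_add: "psum p (\<lambda>x. u x + w x) \<le> 2 powr p * (psum p u + psum p w)"
proof -
  have *: "(\<Sum>x\<in>F. norm (u x + w x) powr p) \<le> 2 powr p * (psum p u + psum p w)" if "finite F" for F
  proof -
    have "(\<Sum>x\<in>F. norm (u x + w x) powr p) \<le> (\<Sum>x\<in>F. 2 powr p * (norm (u x) powr p + norm (w x) powr p))"
      by (intro sum_mono norm_add_powr_le assms)
    also have "\<dots> = 2 powr p * ((\<Sum>x\<in>F. norm (u x) powr p) + (\<Sum>x\<in>F. norm (w x) powr p))"
      by (simp add: sum_distrib_left sum.distrib distrib_left)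
    also have "\<dots> \<le> 2 powr p * (psum p u + psum p w)"
      by (intro mult_left_mono add_mono sum_le_psum assms that) auto
    finally show ?thesis .
  qed
  show "(\<lambda>x. u x + w x) \<in> lp p" by (rule lpI[OF *])
  show "psum p (\<lambda>x. u x + w x) \<le> 2 powr p * (psum p u + psum p w)" by (rule psum_leI[OF *])
qed

lemma
  assumes "u \<in> lp p" "0 < p" "\<And>x. norm (w x) \<le> c * norm (u x)" "0 \<le> c"
  shows lp_dominated: "w \<in> lp p" and psum_dominated: "psum p w \<le> c powr p * psum p u"
proof -
  have *: "(\<Sum>x\<in>F. norm (w x) powr p) \<le> c powr p * psum p u" if "finite F" for F
  proof -
    have "(\<Sum>x\<in>F. norm (w x) powr p) \<le> (\<Sum>x\<in>F. (c * norm (u x)) powr p)"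
      using assms by (intro sum_mono powr_mono2) auto
    also have "\<dots> = c powr p * (\<Sum>x\<in>F. norm (u x) powr p)"
      using assms by (simp add: powr_mult sum_distrib_left)
    also have "\<dots> \<le> c powr p * psum p u"
      by (intro mult_left_mono sum_le_psum assms that) auto
    finally show ?thesis .
  qed
  show "w \<in> lp p" by (rule lpI[OF *])
  show "psum p w \<le> c powr p * psum p u" by (rule psum_leI[OF *])
qed

lemma lp_scale: "u \<in> lp p \<Longrightarrow> 0 < p \<Longrightarrow> (\<lambda>x. c * u x) \<in> lp p"
  by (rule lp_dominated[where c = "norm c" and u = u]) (auto simp: norm_mult)

lemma lp_diff:
  assumes "u \<in> lp p" "w \<in> lp p" "0 < p"
  shows "(\<lambda>x. u x - w x) \<in> lp p"
  using lp_add[OF assms(1) lp_scale[OF assms(2,3), of "-1"] assms(3)] by simp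

lemma lp_finite_support:
  assumes "finite S" "\<And>x. x \<notin> S \<Longrightarrow> u x = 0"
  shows "u \<in> lp p"
proof (rule lpI)
  fix F :: "'a set" assume "finite F"
  have "(\<Sum>x\<in>F. norm (u x) powr p) = (\<Sum>x\<in>F \<inter> S. norm (u x) powr p)"
    using assms \<open>finite F\<close> by (intro sum.mono_neutral_right) auto
  also have "\<dots> \<le> (\<Sum>x\<in>S. norm (u x) powr p)"
    using assms by (intro sum_mono2) auto
  finally show "(\<Sum>x\<in>F. norm (u x) powr p) \<le> (\<Sum>x\<in>S. norm (u x) powr p)" .
qed

section \<open>Finite linear combinations and their pointwise limits\<close>

lemma lp_lin_comb:
  assumes "finite Y" "\<And>b. b \<in> Y \<Longrightarrow> G b \<in> lp p" "0 < p"
  shows "(\<lambda>x. \<Sum>b\<in>Y. c b * G b x) \<in> lp p"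
  using assms(1,2)
proof (induction Y rule: finite_induct)
  case empty
  then show ?case using lp_finite_support[of "{}" "\<lambda>_. 0" p] by simp
next
  case (insert a Y)
  then show ?case using lp_add[OF lp_scale[of "G a" p "c a"]] assms(3) by simp
qed

text \<open>\<open>lin_comb\<close> is indexed by a set of functions, so the coefficients of all
  indices with the same \<open>G b\<close> have to be collected.\<close>

lemma lin_combI:
  fixes G :: "'b \<Rightarrow> 'x \<Rightarrow> complex"
  assumes "finite Y"
  shows "(\<lambda>x. \<Sum>b\<in>Y. c b * G b x) \<in> lin_comb (G ` Y)"
proof -
  have "(\<Sum>b\<in>Y. c b * G b x) = (\<Sum>f\<in>G ` Y. (\<Sum>b\<in>{b\<in>Y. G b = f}. c b) * f x)" for x
  proof -
    have "(\<Sum>f\<in>G ` Y. (\<Sum>b\<in>{b\<in>Y. G b = f}. c b) * f x) = (\<Sum>f\<in>G ` Y. \<Sum>b\<in>{b\<in>Y. G b = f}. c b * G b x)"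
      by (intro sum.cong) (auto simp: sum_distrib_right)
    also have "\<dots> = (\<Sum>b\<in>Y. c b * G b x)"
      by (rule sum.group) (use assms in auto)
    finally show ?thesis by simp
  qed
  then have "(\<lambda>x. \<Sum>b\<in>Y. c b * G b x) = (\<lambda>x. \<Sum>f\<in>G ` Y. (\<Sum>b\<in>{b\<in>Y. G b = f}. c b) * f x)"
    by (rule ext)
  then show ?thesis unfolding lin_comb_def mem_Collect_eq
    by (intro exI[of _ "\<lambda>f. \<Sum>b\<in>{b\<in>Y. G b = f}. c b"]) simp
qed

text \<open>As the \<open>G b\<close> may be linearly dependent, the coefficients of
  \<open>h k\<close> need not converge. The induction therefore eliminates one generator at a time
  by evaluating at a point where it does not vanish.\<close>

lemma span_pointwise_closed:
  fixes G :: "'b \<Rightarrow> 'x \<Rightarrow> complex" and h :: "nat \<Rightarrow> 'x \<Rightarrow> complex"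
  assumes "finite Y" "\<And>k. \<exists>c. h k = (\<lambda>x. \<Sum>b\<in>Y. c b * G b x)" "\<And>x. (\<lambda>k. h k x) \<longlonglongrightarrow> l x"
  shows "\<exists>c. l = (\<lambda>x. \<Sum>b\<in>Y. c b * G b x)"
  using assms
proof (induction Y arbitrary: G h l rule: finite_induct)
  case empty
  then have "h k = (\<lambda>_. 0)" for k by simp
  with empty(2) have "(\<lambda>k. 0) \<longlonglongrightarrow> l x" for x by simp
  then have "l = (\<lambda>_. 0)" using LIMSEQ_const_iff by (metis ext)
  then show ?case by simp
next
  case (insert a Y)
  show ?case
  proof (cases "G a = (\<lambda>_. 0)")
    case True
    have "\<exists>c. h k = (\<lambda>x. \<Sum>b\<in>Y. c b * G b x)" for k
      using insert(4)[of k] insert(1,2) True by simp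
    from insert(3)[OF this insert(5)] show ?thesis using insert(1,2) True by simp
  next
    case False
    then obtain x0 where x0: "G a x0 \<noteq> 0" by auto
    \<comment> \<open>Subtracting multiples of \<open>G a\<close> makes the other generators vanish
      at \<open>x0\<close>; the same correction applied to \<open>h k\<close> puts it into their
      span.\<close>
    define G' where "G' b x = G b x - G b x0 / G a x0 * G a x" for b x
    have ev: "\<exists>c. (\<lambda>x. h k x - h k x0 / G a x0 * G a x) = (\<lambda>x. \<Sum>b\<in>Y. c b * G' b x)" for k
    proof -
      obtain c where c: "h k = (\<lambda>x. \<Sum>b\<in>insert a Y. c b * G b x)" using insert(4) by blast
      have "h k x - h k x0 / G a x0 * G a x = (\<Sum>b\<in>Y. c b * G' b x)" for x
      proof -
        have "h k x - h k x0 / G a x0 * G a x = (\<Sum>b\<in>Y. c b * G b x) - (\<Sum>b\<in>Y. c b * G b x0) / G a x0 * G a x"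
          using insert(1,2) x0 by (simp add: c field_simps)
        also have "\<dots> = (\<Sum>b\<in>Y. c b * G' b x)"
          by (simp add: G'_def right_diff_distrib sum_subtractf sum_divide_distrib sum_distrib_right mult.assoc)
        finally show ?thesis .
      qed
      then show ?thesis by blast
    qed
    have lim: "(\<lambda>k. h k x - h k x0 / G a x0 * G a x) \<longlonglongrightarrow> l x - l x0 / G a x0 * G a x" for x
      using x0 by (intro tendsto_intros insert(5)) auto
    obtain c where c: "(\<lambda>x. l x - l x0 / G a x0 * G a x) = (\<lambda>x. \<Sum>b\<in>Y. c b * G' b x)"
      using insert(3)[of "\<lambda>k x. h k x - h k x0 / G a x0 * G a x" G' "\<lambda>x. l x - l x0 / G a x0 * G a x", OF ev lim]
      by (elim exE)
    \<comment> \<open>The coefficient of \<open>G a\<close> is dictated by the value at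
      \<open>x0\<close>.\<close>
    define d where "d = c(a := (l x0 - (\<Sum>b\<in>Y. c b * G b x0)) / G a x0)"
    have "l x = (\<Sum>b\<in>insert a Y. d b * G b x)" for x
    proof -
      have "(\<Sum>b\<in>Y. d b * G b x) = (\<Sum>b\<in>Y. c b * G b x)"
        using insert(2) by (intro sum.cong) (auto simp: d_def)
      moreover have "l x = l x0 / G a x0 * G a x + (\<Sum>b\<in>Y. c b * G' b x)"
        using fun_cong[OF c, of x] by (simp add: algebra_simps)
      moreover have "(\<Sum>b\<in>Y. c b * G' b x) = (\<Sum>b\<in>Y. c b * G b x) - (\<Sum>b\<in>Y. c b * G b x0) / G a x0 * G a x"
        by (simp add: G'_def right_diff_distrib sum_subtractf sum_divide_distrib sum_distrib_right mult.assoc)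
      ultimately show ?thesis using insert(1,2) by (simp add: d_def left_diff_distrib diff_divide_distrib)
    qed
    then show ?thesis by blast
  qed
qed

section \<open>Bounded operators, linear operators and point masses\<close>

definition lp_bounded :: "real \<Rightarrow> (('x \<Rightarrow> complex) \<Rightarrow> 'x \<Rightarrow> complex) \<Rightarrow> bool" where
  "lp_bounded p A \<longleftrightarrow> (\<exists>c\<ge>0. \<forall>u\<in>lp p. A u \<in> lp p \<and> psum p (A u) \<le> c * psum p u)"

lemma lp_boundedD: "lp_bounded p A \<Longrightarrow> u \<in> lp p \<Longrightarrow> A u \<in> lp p"
  by (auto simp: lp_bounded_def)

lemma lp_bounded_comp:
  assumes "lp_bounded p A" "lp_bounded p B"
  shows "lp_bounded p (\<lambda>u. A (B u))"
proof -
  obtain a b where a: "a \<ge> 0" "\<And>u. u \<in> lp p \<Longrightarrow> A u \<in> lp p \<and> psum p (A u) \<le> a * psum p u"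
    and b: "b \<ge> 0" "\<And>u. u \<in> lp p \<Longrightarrow> B u \<in> lp p \<and> psum p (B u) \<le> b * psum p u"
    using assms unfolding lp_bounded_def by metis
  have "psum p (A (B u)) \<le> a * b * psum p u" if "u \<in> lp p" for u
    using a(2)[of "B u"] b(2)[OF that] mult_left_mono[of "psum p (B u)" "b * psum p u" a] a(1) by simp
  then show ?thesis unfolding lp_bounded_def using a b by (intro exI[of _ "a * b"]) auto
qed

lemma lp_bounded_add:
  assumes "lp_bounded p A" "lp_bounded p B" "0 < p"
  shows "lp_bounded p (\<lambda>u x. A u x + B u x)"
proof -
  obtain a b where a: "a \<ge> 0" "\<And>u. u \<in> lp p \<Longrightarrow> A u \<in> lp p \<and> psum p (A u) \<le> a * psum p u"
    and b: "b \<ge> 0" "\<And>u. u \<in> lp p \<Longrightarrow> B u \<in> lp p \<and> psum p (B u) \<le> b * psum p u"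
    using assms unfolding lp_bounded_def by metis
  have "(\<lambda>x. A u x + B u x) \<in> lp p \<and> psum p (\<lambda>x. A u x + B u x) \<le> 2 powr p * (a + b) * psum p u"
    if "u \<in> lp p" for u
  proof
    have A: "A u \<in> lp p" and B: "B u \<in> lp p" using a b that by auto
    show "(\<lambda>x. A u x + B u x) \<in> lp p" by (rule lp_add[OF A B assms(3)])
    have "psum p (\<lambda>x. A u x + B u x) \<le> 2 powr p * (psum p (A u) + psum p (B u))"
      by (rule psum_add[OF A B assms(3)])
    also have "\<dots> \<le> 2 powr p * (a * psum p u + b * psum p u)"
      using a b that by (intro mult_left_mono add_mono) auto
    finally show "psum p (\<lambda>x. A u x + B u x) \<le> 2 powr p * (a + b) * psum p u" by (simp add: algebra_simps)
  qed
  then show ?thesis unfolding lp_bounded_def using a b by (intro exI[of _ "2 powr p * (a + b)"]) auto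
qed

lemma lp_bounded_mult:
  assumes "0 < p" "\<And>x. norm (a x) \<le> c"
  shows "lp_bounded p (\<lambda>u x. a x * u x)"
proof -
  have c: "0 \<le> c" using assms(2) norm_ge_zero order_trans by blast
  have *: "norm (a x * u x) \<le> c * norm (u x)" for u x
    using assms(2) by (simp add: norm_mult mult_right_mono)
  show ?thesis unfolding lp_bounded_def
    using lp_dominated[OF _ assms(1) * c] psum_dominated[OF _ assms(1) * c]
    by (intro exI[of _ "c powr p"]) auto
qed

lemma lp_bounded_funpow:
  assumes "lp_bounded p A"
  shows "lp_bounded p (\<lambda>u. (A ^^ k) u)"
proof (induction k)
  case 0
  then show ?case unfolding lp_bounded_def by (intro exI[of _ 1]) auto
next
  case (Suc k)
  then show ?case using lp_bounded_comp[OF assms, of "\<lambda>u. (A ^^ k) u"] by simp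
qed

definition linear_op :: "(('x \<Rightarrow> complex) \<Rightarrow> 'x \<Rightarrow> complex) \<Rightarrow> bool" where
  "linear_op A \<longleftrightarrow> (\<forall>a b u w. A (\<lambda>x. a * u x + b * w x) = (\<lambda>x. a * A u x + b * A w x))"

lemma linear_opD: "linear_op A \<Longrightarrow> A (\<lambda>x. a * u x + b * w x) = (\<lambda>x. a * A u x + b * A w x)"
  by (simp add: linear_op_def)

lemma linear_op_zero: "linear_op A \<Longrightarrow> A (\<lambda>_. 0) = (\<lambda>_. 0)"
  using linear_opD[of A 0 "\<lambda>_. 0" 0 "\<lambda>_. 0"] by simp

lemma linear_op_diff: "linear_op A \<Longrightarrow> A (\<lambda>x. u x - w x) = (\<lambda>x. A u x - A w x)"
  using linear_opD[of A 1 u "-1" w] by simp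

lemma linear_op_add: "linear_op A \<Longrightarrow> A (\<lambda>x. u x + w x) = (\<lambda>x. A u x + A w x)"
  using linear_opD[of A 1 u 1 w] by simp

lemma linear_op_scale: "linear_op A \<Longrightarrow> A (\<lambda>x. c * u x) = (\<lambda>x. c * A u x)"
  using linear_opD[of A c u 0 u] by simp

lemma linear_op_sum:
  assumes "linear_op A" "finite Y"
  shows "A (\<lambda>x. \<Sum>b\<in>Y. c b * G b x) = (\<lambda>x. \<Sum>b\<in>Y. c b * A (G b) x)"
  using assms(2)
proof (induction Y rule: finite_induct)
  case empty
  then show ?case using linear_op_zero[OF assms(1)] by simp
next
  case (insert a Y)
  then show ?case
    using linear_opD[OF assms(1), of "c a" "G a" 1 "\<lambda>x. \<Sum>b\<in>Y. c b * G b x"] by simp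
qed

definition delta :: "'x \<Rightarrow> 'x \<Rightarrow> complex" where
  "delta y = (\<lambda>x. if x = y then 1 else 0)"

lemma delta_in_lp: "delta y \<in> lp p"
  by (rule lp_finite_support[of "{y}"]) (auto simp: delta_def)

lemma restrict_delta: "finite Y \<Longrightarrow> (\<Sum>b\<in>Y. u b * delta b x) = (if x \<in> Y then u x else 0)"
  by (simp add: delta_def if_distrib[of "\<lambda>t. _ * t"] cong: if_cong)

section \<open>Band operators\<close>

context periodic
begin

text \<open>The operator acts on all functions, not only on \<open>lp p\<close>, so that it can also
  be evaluated on Bloch waves; locality makes every row a finite sum
  (\<open>band_expand\<close>).\<close>

definition band :: "nat \<Rightarrow> (('x \<Rightarrow> complex) \<Rightarrow> 'x \<Rightarrow> complex) \<Rightarrow> bool" where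
  "band r A \<longleftrightarrow> linear_op A \<and> (\<forall>u w x. (\<forall>y\<in>near r x. u y = w y) \<longrightarrow> A u x = A w x)"

lemma band_linear: "band r A \<Longrightarrow> linear_op A"
  by (simp add: band_def)

lemma band_cong: "band r A \<Longrightarrow> (\<And>y. y \<in> near r x \<Longrightarrow> u y = w y) \<Longrightarrow> A u x = A w x"
  by (simp add: band_def)

lemma band_expand:
  assumes "band r A"
  shows "A u x = (\<Sum>y\<in>near r x. u y * A (delta y) x)"
proof -
  have "A u x = A (\<lambda>z. \<Sum>y\<in>near r x. u y * delta y z) x"
    by (rule band_cong[OF assms]) (simp add: restrict_delta)
  also have "\<dots> = (\<Sum>y\<in>near r x. u y * A (delta y) x)"
    using linear_op_sum[OF band_linear[OF assms], of "near r x" u delta] by simp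
  finally show ?thesis .
qed

lemma band_comp:
  assumes "band r A" "band s B"
  shows "band (r + s) (\<lambda>u. A (B u))"
  unfolding band_def
proof (intro conjI allI impI)
  show "linear_op (\<lambda>u. A (B u))"
    using linear_opD[OF band_linear[OF assms(1)]] linear_opD[OF band_linear[OF assms(2)]]
    by (simp add: linear_op_def)
  fix u w :: "'x \<Rightarrow> complex" and x assume *: "\<forall>y\<in>near (r + s) x. u y = w y"
  show "A (B u) x = A (B w) x"
    by (intro band_cong[OF assms(1)] band_cong[OF assms(2)]) (use * near_trans in blast)
qed

lemma band_mono: "band r A \<Longrightarrow> r \<le> s \<Longrightarrow> band s A"
  unfolding band_def using near_mono by blast

lemma band_id: "band 0 (\<lambda>u. u)"
  by (simp add: band_def linear_op_def)

lemma band_funpow: "band r A \<Longrightarrow> band (k * r) (\<lambda>u. (A ^^ k) u)"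
proof (induction k)
  case 0
  then show ?case using band_id by simp
next
  case (Suc k)
  then show ?case using band_comp[of r A "k * r" "\<lambda>u. (A ^^ k) u"] by simp
qed

lemma band_lin_comb:
  assumes "band r A" "band r B"
  shows "band r (\<lambda>u x. a x * A u x + b x * B u x)"
  unfolding band_def
proof (intro conjI allI impI)
  show "linear_op (\<lambda>u x. a x * A u x + b x * B u x)"
    using linear_opD[OF band_linear[OF assms(1)]] linear_opD[OF band_linear[OF assms(2)]]
    by (simp add: linear_op_def algebra_simps)
  fix u w :: "'x \<Rightarrow> complex" and x assume *: "\<forall>y\<in>near r x. u y = w y"
  then show "a x * A u x + b x * B u x = a x * A w x + b x * B w x"
    using band_cong[OF assms(1), of x u w] band_cong[OF assms(2), of x u w] by simp
qed

text \<open>Rows are finite sums, so pointwise convergence passes through the operator.\<close>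

lemma band_tendsto:
  assumes "band r A" "\<And>y. (\<lambda>k. u k y) \<longlonglongrightarrow> l y"
  shows "(\<lambda>k. A (u k) x) \<longlonglongrightarrow> A l x"
proof -
  have "(\<lambda>k. \<Sum>y\<in>near r x. u k y * A (delta y) x) \<longlonglongrightarrow> (\<Sum>y\<in>near r x. l y * A (delta y) x)"
    by (intro tendsto_intros assms(2))
  then show ?thesis by (simp only: band_expand[OF assms(1), symmetric])
qed

lemma near_nonempty [simp]: "near r x \<noteq> {}"
  using near_self by blast

definition nnear :: "nat \<Rightarrow> real" where
  "nnear r = real (N * (2 * r + 1) ^ CARD('n))"

lemma card_near_eq_nnear: "real (card (near r x)) = nnear r"
  by (simp add: card_near nnear_def)

lemma nnear_ge_1: "1 \<le> nnear r"
proof -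
  have "0 < card (near r x)" for x using near_self by (auto simp: card_gt_0_iff)
  then show ?thesis unfolding card_near_eq_nnear[symmetric, of r "reps 0"]
    by (metis One_nat_def Suc_leI of_nat_1 of_nat_mono)
qed

text \<open>A crude Schur test: bounding a sum of \<open>C\<close> terms by \<open>C\<close> times the maximal one costs an
  extra factor \<open>C powr (1 / p)\<close> but avoids convexity arguments.\<close>

lemma schur_test:
  assumes "band r A" "\<And>x y. norm (A (delta y) x) \<le> M" "1 \<le> p" "u \<in> lp p"
  shows "A u \<in> lp p" "psum p (A u) \<le> (M * nnear r ^ 2) powr p * psum p u"
proof -
  let ?C = "nnear r"
  have M: "0 \<le> M" using assms(2) norm_ge_zero order_trans by blast
  have C: "1 \<le> ?C" by (rule nnear_ge_1)
  have pt: "norm (A u x) powr p \<le> (M * ?C) powr p * (\<Sum>y\<in>near r x. norm (u y) powr p)" for x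
  proof -
    obtain y0 where y0: "y0 \<in> near r x" "\<And>y. y \<in> near r x \<Longrightarrow> norm (u y) \<le> norm (u y0)"
    proof -
      have "finite ((\<lambda>y. norm (u y)) ` near r x)" "(\<lambda>y. norm (u y)) ` near r x \<noteq> {}"
        using near_self by auto
      from Max_in[OF this] Max_ge[OF this(1)] that show ?thesis by fastforce
    qed
    have "norm (A u x) \<le> (\<Sum>y\<in>near r x. norm (u y) * norm (A (delta y) x))"
      unfolding band_expand[OF assms(1), of u x] by (rule order_trans[OF norm_sum]) (simp add: norm_mult)
    also have "\<dots> \<le> (\<Sum>y\<in>near r x. norm (u y0) * M)"
      by (intro sum_mono mult_mono y0 assms(2)) auto
    also have "\<dots> = (M * ?C) * norm (u y0)" by (simp add: card_near_eq_nnear)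
    finally have "norm (A u x) powr p \<le> ((M * ?C) * norm (u y0)) powr p"
      using assms(3) by (intro powr_mono2) auto
    also have "\<dots> = (M * ?C) powr p * norm (u y0) powr p" using M C by (simp add: powr_mult)
    also have "\<dots> \<le> (M * ?C) powr p * (\<Sum>y\<in>near r x. norm (u y) powr p)"
      using y0(1) by (intro mult_left_mono member_le_sum) auto
    finally show ?thesis .
  qed
  \<comment> \<open>The number of rows meeting a column enters without exponent. Enlarging it to
    \<open>?C powr p\<close> turns the final bound into a \<open>p\<close>-th power, so that
    smallness can be required of \<open>M * nnear r ^ 2\<close> alone, independently of
    \<open>p\<close>.\<close>
  have C1: "?C \<le> ?C powr p" using C assms(3) powr_mono[of 1 p ?C] by simp
  have bd: "(\<Sum>x\<in>F. norm (A u x) powr p) \<le> (M * ?C ^ 2) powr p * psum p u" if F: "finite F" for F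
  proof -
    define G where "G = (\<Union>x\<in>F. near r x)"
    have G: "finite G" using F by (simp add: G_def)
    have "(\<Sum>x\<in>F. \<Sum>y\<in>near r x. norm (u y) powr p)
        = (\<Sum>x\<in>F. \<Sum>y\<in>{y\<in>G. y \<in> near r x}. norm (u y) powr p)"
      by (intro sum.cong refl) (auto simp: G_def)
    also have "\<dots> = (\<Sum>y\<in>G. \<Sum>x\<in>{x\<in>F. y \<in> near r x}. norm (u y) powr p)"
      by (rule sum.swap_restrict[OF F G])
    also have "\<dots> \<le> (\<Sum>y\<in>G. ?C * norm (u y) powr p)"
    proof (rule sum_mono)
      fix y
      have "card {x\<in>F. y \<in> near r x} \<le> card (near r y)"
        by (intro card_mono) (auto simp: near_sym[of y])
      then have "real (card {x\<in>F. y \<in> near r x}) \<le> ?C" by (metis card_near_eq_nnear of_nat_mono)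
      then show "(\<Sum>x\<in>{x\<in>F. y \<in> near r x}. norm (u y) powr p) \<le> ?C * norm (u y) powr p"
        by (simp add: mult_right_mono)
    qed
    also have "\<dots> = ?C * (\<Sum>y\<in>G. norm (u y) powr p)" by (simp add: sum_distrib_left)
    also have "\<dots> \<le> ?C powr p * psum p u"
      using C C1 by (intro mult_mono sum_le_psum assms G) (auto intro: sum_nonneg)
    finally have sm: "(\<Sum>x\<in>F. \<Sum>y\<in>near r x. norm (u y) powr p) \<le> ?C powr p * psum p u" .
    have "(\<Sum>x\<in>F. norm (A u x) powr p) \<le> (\<Sum>x\<in>F. (M * ?C) powr p * (\<Sum>y\<in>near r x. norm (u y) powr p))"
      by (intro sum_mono pt)
    also have "\<dots> = (M * ?C) powr p * (\<Sum>x\<in>F. \<Sum>y\<in>near r x. norm (u y) powr p)"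
      by (simp add: sum_distrib_left)
    also have "\<dots> \<le> (M * ?C) powr p * (?C powr p * psum p u)"
      by (intro mult_left_mono sm) auto
    also have "\<dots> = (M * ?C ^ 2) powr p * psum p u"
      using M C by (simp add: powr_mult power2_eq_square mult.assoc)
    finally show ?thesis .
  qed
  show "A u \<in> lp p" by (rule lpI[OF bd])
  show "psum p (A u) \<le> (M * ?C ^ 2) powr p * psum p u" by (rule psum_leI[OF bd])
qed

end

section \<open>The Neumann series of a small band operator\<close>

definition neumann :: "(('x \<Rightarrow> complex) \<Rightarrow> 'x \<Rightarrow> complex) \<Rightarrow> ('x \<Rightarrow> complex) \<Rightarrow> 'x \<Rightarrow> complex" where
  "neumann E f x = (\<Sum>k. (E ^^ k) f x)"

text \<open>The constant \<open>1 / 4\<close> leaves room for the weights \<open>2 ^ k\<close> in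
  \<open>neumann_lp\<close>: the products \<open>2 ^ k * (1 / 4) ^ k\<close> remain
  summable.\<close>

locale small_band = periodic adj act N reps
  for adj :: "'x::countable \<Rightarrow> 'x \<Rightarrow> bool"
    and act :: "('n::finite \<Rightarrow> int) \<Rightarrow> 'x \<Rightarrow> 'x"
    and N :: nat and reps :: "nat \<Rightarrow> 'x" +
  fixes p :: real and r :: nat and E :: "('x \<Rightarrow> complex) \<Rightarrow> 'x \<Rightarrow> complex"
  assumes p: "1 \<le> p" and band: "band r E"
    and lpE: "u \<in> lp p \<Longrightarrow> E u \<in> lp p"
    and psE: "u \<in> lp p \<Longrightarrow> psum p (E u) \<le> (1 / 4) powr p * psum p u"
begin

lemma E_pow:
  assumes "u \<in> lp p"
  shows "(E ^^ k) u \<in> lp p \<and> psum p ((E ^^ k) u) \<le> ((1 / 4) ^ k) powr p * psum p u"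
proof (induction k)
  case 0
  then show ?case using assms by simp
next
  case (Suc k)
  have "psum p (E ((E ^^ k) u)) \<le> (1 / 4) powr p * psum p ((E ^^ k) u)" using psE Suc by blast
  also have "\<dots> \<le> (1 / 4) powr p * (((1 / 4) ^ k) powr p * psum p u)"
    using Suc by (intro mult_left_mono) auto
  also have "\<dots> = ((1 / 4) ^ Suc k) powr p * psum p u" by (subst power_Suc, subst powr_mult) auto
  finally show ?case using lpE Suc by simp
qed

lemma E_pow_pointwise:
  assumes "u \<in> lp p"
  shows "norm ((E ^^ k) u x) \<le> psum p u powr (1 / p) * (1 / 4) ^ k"
proof -
  have "norm ((E ^^ k) u x) \<le> psum p ((E ^^ k) u) powr (1 / p)"
    by (rule norm_le_psum) (use E_pow[OF assms] p in auto)
  also have "\<dots> \<le> (((1 / 4) ^ k) powr p * psum p u) powr (1 / p)"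
    using E_pow[OF assms] p by (intro powr_mono2) auto
  also have "\<dots> = psum p u powr (1 / p) * (1 / 4) ^ k"
    using p by (simp add: powr_mult powr_powr)
  finally show ?thesis .
qed

lemma E_pow_summable: "u \<in> lp p \<Longrightarrow> summable (\<lambda>k. (E ^^ k) u x)"
  by (rule summable_comparison_test'[where g = "\<lambda>k. psum p u powr (1 / p) * (1 / 4) ^ k" and N = 0])
     (auto intro!: summable_mult summable_geometric E_pow_pointwise)

lemma neumann_LIMSEQ: "u \<in> lp p \<Longrightarrow> (\<lambda>n. \<Sum>k<n. (E ^^ k) u x) \<longlonglongrightarrow> neumann E u x"
  unfolding neumann_def by (rule summable_LIMSEQ[OF E_pow_summable])

text \<open>A weighted maximum replaces the triangle inequality for infinitely many terms: if
  \<open>m\<close> is the largest value of \<open>2 ^ k\<close> times the norm of the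
  \<open>k\<close>-th term, the terms add up to at most \<open>2 * m\<close>, and the
  \<open>p\<close>-th power of a maximum is at most the sum of the \<open>p\<close>-th
  powers.\<close>

lemma neumann_lp:
  assumes u: "u \<in> lp p"
  shows "neumann E u \<in> lp p" "psum p (neumann E u) \<le> 2 powr p * 2 * psum p u"
proof -
  have pt: "norm (\<Sum>k<n. (E ^^ k) u x) powr p \<le> 2 powr p * (\<Sum>k<n. (2 ^ k) powr p * norm ((E ^^ k) u x) powr p)" for n x
  proof (cases "n = 0")
    case False
    define m where "m = Max ((\<lambda>k. 2 ^ k * norm ((E ^^ k) u x)) ` {..<n})"
    have "m \<in> (\<lambda>k. 2 ^ k * norm ((E ^^ k) u x)) ` {..<n}"
      unfolding m_def by (rule Max_in) (use False in auto)
    then obtain k0 where k0: "k0 < n" "m = 2 ^ k0 * norm ((E ^^ k0) u x)" by auto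
    have m: "2 ^ k * norm ((E ^^ k) u x) \<le> m" if "k < n" for k
      unfolding m_def using that by (intro Max_ge) auto
    have "norm (\<Sum>k<n. (E ^^ k) u x) \<le> (\<Sum>k<n. norm ((E ^^ k) u x))" by (rule norm_sum)
    also have "\<dots> \<le> (\<Sum>k<n. m * (1 / 2) ^ k)"
      using m by (intro sum_mono) (simp add: power_divide field_simps)
    also have "\<dots> = m * (\<Sum>k<n. (1 / 2) ^ k)" by (simp add: sum_distrib_left)
    also have "\<dots> \<le> m * 2"
      using k0 by (intro mult_left_mono) (auto simp: sum_gp_strict)
    finally have "norm (\<Sum>k<n. (E ^^ k) u x) powr p \<le> (m * 2) powr p"
      using p by (intro powr_mono2) auto
    also have "\<dots> = 2 powr p * ((2 ^ k0) powr p * norm ((E ^^ k0) u x) powr p)"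
      using k0 by (simp add: powr_mult)
    also have "\<dots> \<le> 2 powr p * (\<Sum>k<n. (2 ^ k) powr p * norm ((E ^^ k) u x) powr p)"
      using k0 by (intro mult_left_mono member_le_sum) auto
    finally show ?thesis .
  qed simp
  have geo: "(\<Sum>k<n. ((1 / 2) ^ k) powr p) \<le> (2::real)" for n
  proof -
    have "(\<Sum>k<n. ((1 / 2) ^ k) powr p) \<le> (\<Sum>k<n. (1 / 2::real) ^ k)"
    proof (rule sum_mono)
      fix k :: nat
      have "((1 / 2) ^ k) powr p \<le> ((1 / 2::real) ^ k) powr 1"
        using p by (intro powr_mono') (auto simp: power_le_one)
      then show "((1 / 2) ^ k) powr p \<le> (1 / 2::real) ^ k" by simp
    qed
    also have "\<dots> \<le> 2" by (simp add: sum_gp_strict)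
    finally show ?thesis .
  qed
  have fin: "(\<Sum>x\<in>F. norm (\<Sum>k<n. (E ^^ k) u x) powr p) \<le> 2 powr p * 2 * psum p u" if F: "finite F" for F n
  proof -
    have "(\<Sum>x\<in>F. norm (\<Sum>k<n. (E ^^ k) u x) powr p)
        \<le> (\<Sum>x\<in>F. 2 powr p * (\<Sum>k<n. (2 ^ k) powr p * norm ((E ^^ k) u x) powr p))"
      by (intro sum_mono pt)
    also have "\<dots> = 2 powr p * (\<Sum>k<n. (2 ^ k) powr p * (\<Sum>x\<in>F. norm ((E ^^ k) u x) powr p))"
      by (simp add: sum_distrib_left sum.swap[of _ F])
    also have "\<dots> \<le> 2 powr p * (\<Sum>k<n. (2 ^ k) powr p * (((1 / 4) ^ k) powr p * psum p u))"
      using E_pow[OF u] sum_le_psum[OF _ F]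
      by (intro mult_left_mono sum_mono) (auto intro: order_trans)
    also have "\<dots> = 2 powr p * ((\<Sum>k<n. ((1 / 2) ^ k) powr p) * psum p u)"
    proof -
      have "(2 ^ k) powr p * (((1 / 4) ^ k) powr p * psum p u) = ((1 / 2) ^ k) powr p * psum p u" for k
      proof -
        have "(2 ^ k) powr p * ((1 / 4) ^ k) powr p = ((2::real) ^ k * (1 / 4) ^ k) powr p"
          by (simp only: powr_mult)
        also have "(2::real) ^ k * (1 / 4) ^ k = (1 / 2) ^ k" by (subst power_mult_distrib[symmetric]) simp
        finally show ?thesis by simp
      qed
      then show ?thesis by (simp only: sum_distrib_right)
    qed
    also have "\<dots> \<le> 2 powr p * (2 * psum p u)"
      by (intro mult_left_mono mult_right_mono geo) auto
    finally show ?thesis by simp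
  qed
  \<comment> \<open>Fatou's argument: on a finite vertex set the bound, uniform in \<open>n\<close>,
    survives the limit of the partial sums.\<close>
  have bd: "(\<Sum>x\<in>F. norm (neumann E u x) powr p) \<le> 2 powr p * 2 * psum p u" if F: "finite F" for F
  proof (rule tendsto_upperbound)
    show "(\<lambda>n. \<Sum>x\<in>F. norm (\<Sum>k<n. (E ^^ k) u x) powr p) \<longlonglongrightarrow> (\<Sum>x\<in>F. norm (neumann E u x) powr p)"
      using p by (intro tendsto_sum tendsto_powr' tendsto_norm neumann_LIMSEQ[OF u] tendsto_const) auto
    show "\<forall>\<^sub>F n in sequentially. (\<Sum>x\<in>F. norm (\<Sum>k<n. (E ^^ k) u x) powr p) \<le> 2 powr p * 2 * psum p u"
      using fin[OF F] by simp
  qed simp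
  show "neumann E u \<in> lp p" by (rule lpI[OF bd])
  show "psum p (neumann E u) \<le> 2 powr p * 2 * psum p u" by (rule psum_leI[OF bd])
qed

lemma E_neumann:
  assumes u: "u \<in> lp p"
  shows "E (neumann E u) x = neumann E u x - u x"
proof -
  have "(\<lambda>n. E (\<lambda>y. \<Sum>k<n. (E ^^ k) u y) x) \<longlonglongrightarrow> E (neumann E u) x"
    by (intro band_tendsto[OF band] neumann_LIMSEQ u)
  moreover have "E (\<lambda>y. \<Sum>k<n. (E ^^ k) u y) x = (\<Sum>k<Suc n. (E ^^ k) u x) - u x" for n
    using linear_op_sum[OF band_linear[OF band], of "{..<n}" "\<lambda>_. 1" "\<lambda>k. (E ^^ k) u"]
    by (subst sum.lessThan_Suc_shift) simp
  moreover have "(\<lambda>n. (\<Sum>k<Suc n. (E ^^ k) u x) - u x) \<longlonglongrightarrow> neumann E u x - u x"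
    by (intro tendsto_intros LIMSEQ_Suc[OF neumann_LIMSEQ] u)
  ultimately show ?thesis using LIMSEQ_unique by simp
qed

text \<open>The series telescopes: its \<open>k\<close>-th term is a difference of consecutive
  powers applied to \<open>u\<close>, and these tend to zero pointwise.\<close>

lemma neumann_left_inverse:
  assumes u: "u \<in> lp p"
  shows "neumann E (\<lambda>x. u x - E u x) = u"
proof
  fix x
  have "(E ^^ k) (\<lambda>x. u x - E u x) x = (E ^^ k) u x - (E ^^ Suc k) u x" for k
    using linear_op_diff[OF band_linear[OF band_funpow[OF band]], of k u "E u"]
    by (simp add: funpow_swap1)
  then have "neumann E (\<lambda>x. u x - E u x) x = (\<Sum>k. (E ^^ k) u x - (E ^^ Suc k) u x)"
    by (simp add: neumann_def)
  also have "\<dots> = (E ^^ 0) u x - 0"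
    by (intro sums_unique[symmetric] telescope_sums' summable_LIMSEQ_zero E_pow_summable u)
  finally show "neumann E (\<lambda>x. u x - E u x) x = u x" by simp
qed

lemma neumann_linear:
  assumes "u \<in> lp p" "w \<in> lp p"
  shows "neumann E (\<lambda>x. a * u x + b * w x) = (\<lambda>x. a * neumann E u x + b * neumann E w x)"
proof
  fix x
  have "neumann E (\<lambda>x. a * u x + b * w x) x = (\<Sum>k. a * (E ^^ k) u x + b * (E ^^ k) w x)"
    using linear_opD[OF band_linear[OF band_funpow[OF band]]] by (simp add: neumann_def)
  also have "\<dots> = a * neumann E u x + b * neumann E w x"
    using E_pow_summable[OF assms(1)] E_pow_summable[OF assms(2)] unfolding neumann_def
    by (subst suminf_add[symmetric]) (auto simp: summable_mult suminf_mult)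
  finally show "neumann E (\<lambda>x. a * u x + b * w x) x = a * neumann E u x + b * neumann E w x" .
qed

lemma neumann_sum:
  assumes "finite Y" "\<And>b. b \<in> Y \<Longrightarrow> G b \<in> lp p"
  shows "neumann E (\<lambda>x. \<Sum>b\<in>Y. c b * G b x) = (\<lambda>x. \<Sum>b\<in>Y. c b * neumann E (G b) x)"
  using assms
proof (induction Y rule: finite_induct)
  case empty
  have "(\<lambda>_. 0) \<in> lp p" by (rule lp_finite_support[of "{}"]) auto
  from neumann_linear[OF this this, of 0 0] show ?case by simp
next
  case (insert a Y)
  have "(\<lambda>x. \<Sum>b\<in>Y. c b * G b x) \<in> lp p" using insert p by (intro lp_lin_comb) auto
  then show ?case using insert neumann_linear[of "G a" "\<lambda>x. \<Sum>b\<in>Y. c b * G b x" "c a" 1] by simp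
qed

lemma neumann_diff:
  assumes "u \<in> lp p" "w \<in> lp p"
  shows "neumann E (\<lambda>x. u x - w x) = (\<lambda>x. neumann E u x - neumann E w x)"
  using neumann_linear[OF assms, of 1 "-1"] by simp

end

section \<open>A Fredholm criterion\<close>

context periodic
begin

text \<open>For finite \<open>Y\<close> the discarded part has finite rank: it only produces
  combinations of the \<open>delta b\<close> with \<open>b\<close> in \<open>Y\<close>.\<close>

definition tail :: "'x set \<Rightarrow> (('x \<Rightarrow> complex) \<Rightarrow> 'x \<Rightarrow> complex) \<Rightarrow> ('x \<Rightarrow> complex) \<Rightarrow> 'x \<Rightarrow> complex" where
  "tail Y T u x = (if x \<in> Y then 0 else T u x)"

lemma band_tail:
  assumes "band r T"
  shows "band r (tail Y T)"
  using band_lin_comb[OF assms assms, of "\<lambda>x. if x \<in> Y then 0 else 1" "\<lambda>_. 0"]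
  by (simp add: tail_def[abs_def] if_distrib[of "\<lambda>t. t * _"] cong: if_cong)

lemma small_band_tail:
  assumes p: "1 \<le> p" and T: "band r T"
    and small: "\<And>x y. x \<notin> Y \<Longrightarrow> norm (T (delta y) x) * nnear r ^ 2 \<le> 1 / 4"
  shows "small_band adj act N reps p r (tail Y T)"
proof -
  have bd: "band r (tail Y T)" by (rule band_tail[OF T])
  have pos: "0 < nnear r ^ 2" using nnear_ge_1[of r] by simp
  have ent: "norm (tail Y T (delta y) x) \<le> 1 / 4 / nnear r ^ 2" for x y
    using small[of x y] pos by (cases "x \<in> Y") (simp_all add: tail_def pos_le_divide_eq)
  have eq: "(1 / 4 / nnear r ^ 2) * nnear r ^ 2 = 1 / 4" using pos by simp
  show ?thesis
    by unfold_locales (use schur_test[OF bd ent p] p bd in \<open>simp_all only: eq\<close>)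
qed

text \<open>A two-sided regularizer up to operators \<open>T1\<close>, \<open>T2\<close> that are small outside a finite set \<open>Y\<close>
  suffices: inverting the identity minus the small part leaves only corrections of finite rank.\<close>

lemma fredholm_lpI:
  assumes p: "1 \<le> p"
    and A: "band s A" "lp_bounded p A"
    and R1: "linear_op R1" "lp_bounded p R1" and R2: "lp_bounded p R2"
    and T: "band r T1" "band r T2"
    and left: "\<And>u. R1 (A u) = (\<lambda>x. u x - T1 u x)"
    and right: "\<And>u. A (R2 u) = (\<lambda>x. u x - T2 u x)"
    and Y: "finite Y"
    and small: "\<And>x y. x \<notin> Y \<Longrightarrow> norm (T1 (delta y) x) * nnear r ^ 2 \<le> 1 / 4"
      "\<And>x y. x \<notin> Y \<Longrightarrow> norm (T2 (delta y) x) * nnear r ^ 2 \<le> 1 / 4"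
  shows "fredholm_lp p A"
proof -
  have p0: "0 < p" using p by simp
  define E1 where "E1 = tail Y T1"
  define E2 where "E2 = tail Y T2"
  interpret E1: small_band adj act N reps p r E1
    unfolding E1_def by (rule small_band_tail[OF p T(1) small(1)])
  interpret E2: small_band adj act N reps p r E2
    unfolding E2_def by (rule small_band_tail[OF p T(2) small(2)])
  let ?J1 = "neumann E1" and ?J2 = "neumann E2"
  have split1: "(\<lambda>x. u x - E1 u x) = (\<lambda>x. R1 (A u) x + (\<Sum>b\<in>Y. T1 u b * delta b x))" for u
    by (auto simp: left E1_def tail_def restrict_delta[OF Y])
  \<comment> \<open>\<open>u\<close> is recovered from \<open>A u\<close> and the finitely many
    numbers \<open>T1 u b\<close>. This bounds the kernel at once and also drives the proof that the
    range is closed.\<close>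
  have recover: "u = (\<lambda>x. ?J1 (R1 (A u)) x + (\<Sum>b\<in>Y. T1 u b * ?J1 (delta b) x))" if u: "u \<in> lp p" for u
  proof -
    have RA: "R1 (A u) \<in> lp p" using u A(2) R1(2) lp_boundedD by blast
    have S: "(\<lambda>x. \<Sum>b\<in>Y. T1 u b * delta b x) \<in> lp p"
      by (intro lp_lin_comb Y delta_in_lp p0)
    have "u = ?J1 (\<lambda>x. R1 (A u) x + (\<Sum>b\<in>Y. T1 u b * delta b x))"
      using E1.neumann_left_inverse[OF u] by (simp only: split1)
    also have "\<dots> = (\<lambda>x. ?J1 (R1 (A u)) x + ?J1 (\<lambda>x. \<Sum>b\<in>Y. T1 u b * delta b x) x)"
      using E1.neumann_linear[OF RA S, of 1 1] by simp
    also have "\<dots> = (\<lambda>x. ?J1 (R1 (A u)) x + (\<Sum>b\<in>Y. T1 u b * ?J1 (delta b) x))"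
      by (simp only: E1.neumann_sum[OF Y delta_in_lp])
    finally show ?thesis .
  qed
  have Jd: "?J1 (delta b) \<in> lp p" for b by (rule E1.neumann_lp[OF delta_in_lp])
  have R10: "R1 (\<lambda>_. 0) = (\<lambda>_. 0)" by (rule linear_op_zero[OF R1(1)])
  have zero_lp: "(\<lambda>_. 0) \<in> lp p" by (rule lp_finite_support[of "{}"]) auto
  have J10: "?J1 (\<lambda>_. 0) = (\<lambda>_. 0)" using E1.neumann_linear[OF zero_lp zero_lp, of 0 0] by simp
  have "{u \<in> lp p. A u = (\<lambda>_. 0)} \<subseteq> lin_comb ((\<lambda>b. ?J1 (delta b)) ` Y)"
  proof clarify
    fix u assume u: "u \<in> lp p" "A u = (\<lambda>_. 0)"
    have "u = (\<lambda>x. \<Sum>b\<in>Y. T1 u b * ?J1 (delta b) x)"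
      using recover[OF u(1)] by (simp add: u(2) R10 J10)
    then show "u \<in> lin_comb ((\<lambda>b. ?J1 (delta b)) ` Y)" using lin_combI[OF Y, of "T1 u" "\<lambda>b. ?J1 (delta b)"] by simp
  qed
  then have kernel: "\<exists>F. finite F \<and> F \<subseteq> lp p \<and> {u \<in> lp p. A u = (\<lambda>_. 0)} \<subseteq> lin_comb F"
    using Y Jd by (intro exI[of _ "(\<lambda>b. ?J1 (delta b)) ` Y"]) auto
  have closed: "w \<in> A ` lp p"
    if w: "w \<in> lp p" and s: "\<And>k. s k \<in> A ` lp p" and lim: "(\<lambda>k. lp_norm p (\<lambda>x. s k x - w x)) \<longlonglongrightarrow> 0"
    for w and s :: "nat \<Rightarrow> 'x \<Rightarrow> complex"
  proof -
    have "\<forall>k. \<exists>u. u \<in> lp p \<and> s k = A u" using s by blast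
    from choice[OF this] obtain u where u: "\<And>k. u k \<in> lp p" "\<And>k. s k = A (u k)" by blast
    have s_lp: "s k \<in> lp p" for k using u lp_boundedD[OF A(2)] by simp
    have d_lp: "(\<lambda>x. s k x - w x) \<in> lp p" for k by (rule lp_diff[OF s_lp w p0])
    have ps: "(\<lambda>k. psum p (\<lambda>x. s k x - w x)) \<longlonglongrightarrow> 0"
    proof -
      have "psum p (\<lambda>x. s k x - w x) = lp_norm p (\<lambda>x. s k x - w x) powr p" for k
        using p0 by (simp add: lp_norm_def powr_powr flip: psum_def)
      moreover have "(\<lambda>k. lp_norm p (\<lambda>x. s k x - w x) powr p) \<longlonglongrightarrow> 0"
        using p0 lim by (intro tendsto_zero_powrI[OF lim tendsto_const]) (auto simp: lp_norm_def)
      ultimately show ?thesis by simp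
    qed
    have pw: "(\<lambda>k. f k x) \<longlonglongrightarrow> 0"
      if f: "\<And>k. f k \<in> lp p" "\<And>k. psum p (f k) \<le> c * psum p (\<lambda>x. s k x - w x)" for f :: "nat \<Rightarrow> 'x \<Rightarrow> complex" and c x
    proof -
      have b: "norm (f k x) \<le> (c * psum p (\<lambda>x. s k x - w x)) powr (1 / p)" for k
      proof -
        have "norm (f k x) \<le> psum p (f k) powr (1 / p)" by (rule norm_le_psum[OF f(1) p0])
        also have "\<dots> \<le> (c * psum p (\<lambda>x. s k x - w x)) powr (1 / p)"
          using p0 by (intro powr_mono2 f(2)) auto
        finally show ?thesis .
      qed
      have "(\<lambda>k. (c * psum p (\<lambda>x. s k x - w x)) powr (1 / p)) \<longlonglongrightarrow> 0"
      proof (rule tendsto_zero_powrI[OF _ tendsto_const])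
        show "(\<lambda>k. c * psum p (\<lambda>x. s k x - w x)) \<longlonglongrightarrow> 0" using tendsto_mult_right_zero[OF ps] .
        show "\<forall>\<^sub>F k in sequentially. 0 \<le> c * psum p (\<lambda>x. s k x - w x)"
          using order_trans[OF psum_nonneg f(2)] by simp
      qed (use p0 in auto)
      then show ?thesis by (rule Lim_null_comparison[rotated]) (use b in auto)
    qed
    have "lp_bounded p ?J1"
      unfolding lp_bounded_def by (intro exI[of _ "2 powr p * 2"]) (use E1.neumann_lp in auto)
    then have "lp_bounded p (\<lambda>u. ?J1 (R1 u))" by (rule lp_bounded_comp[OF _ R1(2)])
    then obtain c where c: "\<And>u. u \<in> lp p \<Longrightarrow> ?J1 (R1 u) \<in> lp p \<and> psum p (?J1 (R1 u)) \<le> c * psum p u"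
      unfolding lp_bounded_def by blast
    have sw: "(\<lambda>k. s k x) \<longlonglongrightarrow> w x" for x
      using pw[of "\<lambda>k x. s k x - w x" 1 x] d_lp by (simp add: LIM_zero_iff)
    have JR: "(\<lambda>k. ?J1 (R1 (s k)) x) \<longlonglongrightarrow> ?J1 (R1 w) x" for x
    proof -
      have eq: "?J1 (R1 (\<lambda>x. s k x - w x)) = (\<lambda>x. ?J1 (R1 (s k)) x - ?J1 (R1 w) x)" for k
        using E1.neumann_diff[of "R1 (s k)" "R1 w"] lp_boundedD[OF R1(2)] s_lp w
        by (simp add: linear_op_diff[OF R1(1)])
      have "(\<lambda>k. ?J1 (R1 (\<lambda>x. s k x - w x)) x) \<longlonglongrightarrow> 0"
        using c[OF d_lp] by (intro pw[of _ c]) auto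
      then show ?thesis unfolding eq by (rule LIM_zero_cancel)
    qed
    \<comment> \<open>The preimages \<open>u k\<close> need not converge, as the numbers
      \<open>T1 (u k) b\<close> are not controlled. But \<open>s k\<close> minus
      \<open>A (?J1 (R1 (s k)))\<close> stays in one finite-dimensional span and converges
      pointwise, so its limit lies there too.\<close>
    have "\<exists>a. (\<lambda>x. w x - A (?J1 (R1 w)) x) = (\<lambda>x. \<Sum>b\<in>Y. a b * A (?J1 (delta b)) x)"
    proof (rule span_pointwise_closed[OF Y])
      fix x show "(\<lambda>k. s k x - A (?J1 (R1 (s k))) x) \<longlonglongrightarrow> w x - A (?J1 (R1 w)) x"
        by (intro tendsto_diff sw band_tendsto[OF A(1)] JR)
    next
      fix k
      have "s k = A (\<lambda>x. ?J1 (R1 (s k)) x + (\<Sum>b\<in>Y. T1 (u k) b * ?J1 (delta b) x))"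
        using recover[OF u(1)[of k]] by (simp add: u(2))
      also have "\<dots> = (\<lambda>x. A (?J1 (R1 (s k))) x + A (\<lambda>x. \<Sum>b\<in>Y. T1 (u k) b * ?J1 (delta b) x) x)"
        by (rule linear_op_add[OF band_linear[OF A(1)]])
      also have "A (\<lambda>x. \<Sum>b\<in>Y. T1 (u k) b * ?J1 (delta b) x) = (\<lambda>x. \<Sum>b\<in>Y. T1 (u k) b * A (?J1 (delta b)) x)"
        by (rule linear_op_sum[OF band_linear[OF A(1)] Y])
      finally have "s k x - A (?J1 (R1 (s k))) x = (\<Sum>b\<in>Y. T1 (u k) b * A (?J1 (delta b)) x)" for x
        using fun_cong[of "s k" _ x] by fastforce
      then show "\<exists>a. (\<lambda>x. s k x - A (?J1 (R1 (s k))) x) = (\<lambda>x. \<Sum>b\<in>Y. a b * A (?J1 (delta b)) x)"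
        by blast
    qed
    then obtain a where a: "(\<lambda>x. w x - A (?J1 (R1 w)) x) = (\<lambda>x. \<Sum>b\<in>Y. a b * A (?J1 (delta b)) x)" by blast
    define y where "y = (\<lambda>x. ?J1 (R1 w) x + (\<Sum>b\<in>Y. a b * ?J1 (delta b) x))"
    have "A y = (\<lambda>x. A (?J1 (R1 w)) x + (\<Sum>b\<in>Y. a b * A (?J1 (delta b)) x))"
      unfolding y_def by (subst linear_op_add[OF band_linear[OF A(1)]], subst linear_op_sum[OF band_linear[OF A(1)] Y]) (rule refl)
    also have "\<dots> = w"
    proof
      fix x show "A (?J1 (R1 w)) x + (\<Sum>b\<in>Y. a b * A (?J1 (delta b)) x) = w x"
        using fun_cong[OF a, of x] by (simp add: algebra_simps)
    qed
    finally have "w = A y" by simp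
    moreover have "y \<in> lp p"
      unfolding y_def using c[OF w] by (intro lp_add lp_lin_comb Y Jd p0) auto
    ultimately show ?thesis by blast
  qed
  have "lp p \<subseteq> {(\<lambda>x. r x + c x) | r c. r \<in> A ` lp p \<and> c \<in> lin_comb (delta ` Y)}"
  proof
    fix w :: "'x \<Rightarrow> complex" assume w: "w \<in> lp p"
    \<comment> \<open>\<open>?f\<close> minus \<open>E2 ?f\<close> is \<open>w\<close>, so
      \<open>A (R2 ?f)\<close> differs from \<open>w\<close> only by the rows of
      \<open>T2 ?f\<close> in \<open>Y\<close>.\<close>
    let ?f = "?J2 w"
    have f: "?f \<in> lp p" by (rule E2.neumann_lp[OF w])
    have "A (R2 ?f) x = w x - (\<Sum>b\<in>Y. T2 ?f b * delta b x)" for x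
      using E2.E_neumann[OF w, of x] by (auto simp: right E2_def tail_def restrict_delta[OF Y] split: if_splits)
    then have "w = (\<lambda>x. A (R2 ?f) x + (\<Sum>b\<in>Y. T2 ?f b * delta b x))" by (intro ext) simp
    moreover have "A (R2 ?f) \<in> A ` lp p" using lp_boundedD[OF R2 f] by blast
    ultimately show "w \<in> {(\<lambda>x. r x + c x) | r c. r \<in> A ` lp p \<and> c \<in> lin_comb (delta ` Y)}"
      using lin_combI[OF Y, of "T2 ?f" delta] unfolding mem_Collect_eq
      by (intro exI[of _ "A (R2 ?f)"] exI[of _ "\<lambda>x. \<Sum>b\<in>Y. T2 ?f b * delta b x"] conjI)
  qed
  then have coker: "\<exists>F. finite F \<and> F \<subseteq> lp p \<and>
      lp p \<subseteq> {(\<lambda>x. r x + c x) | r c. r \<in> A ` lp p \<and> c \<in> lin_comb F}"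
    using Y delta_in_lp by (intro exI[of _ "delta ` Y"]) auto
  show ?thesis
    unfolding fredholm_lp_def using kernel closed coker by blast
qed

end

section \<open>The Laplacian and Bloch waves\<close>

lemma cnj_eq_inverse: "norm z = 1 \<Longrightarrow> cnj z = inverse z"
  by (rule inverse_unique[symmetric]) (simp add: complex_norm_square[symmetric])

lemma
  assumes "t \<in> torus"
  shows tpow_add: "tpow t (\<alpha> + \<beta>) = tpow t \<alpha> * tpow t \<beta>"
    and norm_tpow: "norm (tpow t \<alpha>) = 1"
    and cnj_tpow: "cnj (tpow t \<alpha>) = tpow t (- \<alpha>)"
proof -
  have t: "norm (t k) = 1" "t k \<noteq> 0" for k
  proof -
    show "norm (t k) = 1" using assms by (simp add: torus_def)
    then show "t k \<noteq> 0" by auto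
  qed
  show "tpow t (\<alpha> + \<beta>) = tpow t \<alpha> * tpow t \<beta>"
    using t by (simp add: tpow_def power_int_add prod.distrib)
  show n: "norm (tpow t \<alpha>) = 1"
    using t by (simp add: tpow_def prod_norm[symmetric] norm_power_int)
  show "cnj (tpow t \<alpha>) = tpow t (- \<alpha>)"
    unfolding cnj_eq_inverse[OF n] by (simp add: tpow_def power_int_minus prod_inversef[symmetric] o_def)
qed

lemma tpow_0 [simp]: "tpow t 0 = 1"
  by (simp add: tpow_def)

text \<open>The summands are the powers of an \<open>M\<close>-th root of unity, which differs from
  1 because \<open>M\<close> does not divide \<open>g\<close>.\<close>

lemma sum_cis_powi_eq_0:
  assumes "0 < M" "g \<noteq> 0" "\<bar>g\<bar> < int M"
  shows "(\<Sum>j<M. cis (2 * pi * real j / real M) powi g) = 0"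
proof -
  define z where "z = cis (2 * pi * of_int g / real M)"
  have "cis (2 * pi * real j / real M) powi g = z ^ j" for j
    unfolding z_def cis_power_int Complex.DeMoivre by (rule arg_cong[of _ _ cis]) simp
  then have "(\<Sum>j<M. cis (2 * pi * real j / real M) powi g) = (\<Sum>j<M. z ^ j)" by simp
  moreover have "z ^ M = 1"
  proof -
    have "z ^ M = cis (2 * pi * of_int g)"
      unfolding z_def Complex.DeMoivre using assms by (intro arg_cong[of _ _ cis]) simp
    then show ?thesis by (simp add: cis_multiple_2pi)
  qed
  moreover have "z \<noteq> 1"
  proof
    assume "z = 1"
    then have "cos (2 * pi * of_int g / real M) = 1" by (metis z_def cis.sel(1) one_complex.sel(1))
    then obtain n :: int where "2 * pi * of_int g / real M = of_int n * 2 * pi"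
      unfolding cos_one_2pi_int by blast
    then have "real_of_int g = of_int (n * int M)" using assms by (simp add: field_simps)
    then have "g = n * int M" by (simp only: of_int_eq_iff)
    then have "\<bar>g\<bar> = \<bar>n\<bar> * int M" by (simp add: abs_mult)
    moreover have "n \<noteq> 0" using \<open>g = n * int M\<close> assms by auto
    ultimately have "int M \<le> \<bar>g\<bar>" using mult_right_mono[of 1 "\<bar>n\<bar>" "int M"] by simp
    then show False using assms by simp
  qed
  ultimately show ?thesis by (simp add: sum_gp_strict)
qed

section \<open>Schroedinger operators, their damping operators and quasi-periodic functions\<close>

context periodic
begin

definition lap :: "('x \<Rightarrow> complex) \<Rightarrow> 'x \<Rightarrow> complex" where
  "lap u x = (\<Sum>y\<in>nbrs adj x. u y) / of_nat (deg adj x)"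

text \<open>The minus sign fits \<open>a = z - v\<close>, for which this is the Schroedinger
  operator minus \<open>z\<close>; a constant potential \<open>z - c\<close> gives the shifted limit
  operator.\<close>

definition ham :: "('x \<Rightarrow> complex) \<Rightarrow> ('x \<Rightarrow> complex) \<Rightarrow> 'x \<Rightarrow> complex" where
  "ham a u x = lap u x - a x * u x"

text \<open>For \<open>a\<close> the conjugate of \<open>b\<close> this is
  \<open>I - \<epsilon> B* B\<close> with \<open>B = ham b\<close>. The two potentials are kept
  separate so that exchanging them gives the operator with \<open>B B*\<close>.\<close>

definition damp :: "real \<Rightarrow> ('x \<Rightarrow> complex) \<Rightarrow> ('x \<Rightarrow> complex) \<Rightarrow> ('x \<Rightarrow> complex) \<Rightarrow> 'x \<Rightarrow> complex" where
  "damp \<epsilon> a b u x = u x - of_real \<epsilon> * ham a (ham b u) x"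

lemma band_lap: "band D lap"
  unfolding band_def
proof (intro conjI allI impI)
  show "linear_op lap"
    by (simp add: linear_op_def lap_def[abs_def] sum.distrib sum_distrib_left add_divide_distrib)
  fix u w :: "'x \<Rightarrow> complex" and x assume "\<forall>y\<in>near D x. u y = w y"
  then show "lap u x = lap w x"
    unfolding lap_def by (intro arg_cong2[of _ _ _ _ "(/)"] sum.cong refl) (use nbrs_near in blast)
qed

lemma band_ham: "band D (ham a)"
proof -
  have "band D (\<lambda>u x. 1 * lap u x + - a x * u x)"
    by (rule band_lin_comb[OF band_lap band_mono[OF band_id]]) simp
  then show ?thesis by (simp add: ham_def[abs_def])
qed

lemma band_damp: "band (2 * D) (damp \<epsilon> a b)"
proof -
  have "band (2 * D) (\<lambda>u x. 1 * u x + - of_real \<epsilon> * ham a (ham b u) x)"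
    by (rule band_lin_comb[OF band_mono[OF band_id]])
       (use band_comp[OF band_ham band_ham] in \<open>simp_all add: mult_2\<close>)
  then show ?thesis by (simp add: damp_def[abs_def])
qed

lemma norm_lap_le:
  assumes "\<And>y. y \<in> nbrs adj x \<Longrightarrow> norm (u y) \<le> c"
  shows "norm (lap u x) \<le> c"
proof -
  have "norm (\<Sum>y\<in>nbrs adj x. u y) \<le> of_nat (deg adj x) * c"
    unfolding deg_def by (rule sum_norm_bound) (rule assms)
  then show ?thesis using deg_pos[of x] by (simp add: lap_def norm_divide pos_divide_le_eq mult.commute)
qed

lemma lp_bounded_lap:
  assumes "1 \<le> p"
  shows "lp_bounded p lap"
proof -
  have "norm (lap (delta y) x) \<le> 1" for x y by (rule norm_lap_le) (simp add: delta_def)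
  from schur_test[OF band_lap this assms] show ?thesis
    unfolding lp_bounded_def by (intro exI[of _ "(1 * (nnear D)\<^sup>2) powr p"]) auto
qed

lemma lp_bounded_ham:
  assumes "1 \<le> p" "bounded (range a)"
  shows "lp_bounded p (ham a)"
proof -
  obtain c where "\<And>x. norm (a x) \<le> c" using assms(2) by (auto simp: bounded_iff)
  then have "lp_bounded p (\<lambda>u x. lap u x + - a x * u x)"
    using assms(1) by (intro lp_bounded_add lp_bounded_lap lp_bounded_mult[of _ _ c]) auto
  then show ?thesis by (simp add: ham_def[abs_def])
qed

lemma lp_bounded_damp:
  assumes "1 \<le> p" "bounded (range a)" "bounded (range b)"
  shows "lp_bounded p (damp \<epsilon> a b)"
proof -
  have "lp_bounded p (\<lambda>u. u)" unfolding lp_bounded_def by (intro exI[of _ 1]) auto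
  moreover have "lp_bounded p (\<lambda>u x. - of_real \<epsilon> * ham a (ham b u) x)"
  proof (rule lp_bounded_comp[of p "\<lambda>u x. - of_real \<epsilon> * u x" "\<lambda>u. ham a (ham b u)"])
    show "lp_bounded p (\<lambda>u x. - of_real \<epsilon> * u x)"
      using assms(1) by (intro lp_bounded_mult[where c = "\<bar>\<epsilon>\<bar>"]) auto
    show "lp_bounded p (\<lambda>u. ham a (ham b u))"
      by (rule lp_bounded_comp[OF lp_bounded_ham[OF assms(1,2)] lp_bounded_ham[OF assms(1,3)]])
  qed
  ultimately have "lp_bounded p (\<lambda>u x. u x + - of_real \<epsilon> * ham a (ham b u) x)"
    using assms(1) lp_bounded_add[of p "\<lambda>u. u" "\<lambda>u x. - of_real \<epsilon> * ham a (ham b u) x"] by simp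
  then show ?thesis by (simp add: damp_def[abs_def])
qed

lemma lap_act: "lap u (act \<alpha> x) = lap (\<lambda>y. u (act \<alpha> y)) x"
  by (simp add: lap_def nbrs_act sum.reindex)

lemma ham_act: "ham a u (act \<alpha> x) = ham (\<lambda>y. a (act \<alpha> y)) (\<lambda>y. u (act \<alpha> y)) x"
  by (simp add: ham_def lap_act)

lemma damp_act: "damp \<epsilon> a b u (act \<alpha> x) = damp \<epsilon> (\<lambda>y. a (act \<alpha> y)) (\<lambda>y. b (act \<alpha> y)) (\<lambda>y. u (act \<alpha> y)) x"
  by (simp add: damp_def ham_act)

text \<open>The sign is that of \<open>symbol\<close>: by periodicity the kernel at
  \<open>act \<beta> (reps i)\<close> and \<open>reps j\<close> equals the one at
  \<open>reps i\<close> and \<open>act (- \<beta>) (reps j)\<close>, where \<open>u\<close> has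
  picked up the factor \<open>tpow t \<beta>\<close>.\<close>

definition quasi :: "('n \<Rightarrow> complex) \<Rightarrow> ('x \<Rightarrow> complex) \<Rightarrow> bool" where
  "quasi t u \<longleftrightarrow> (\<forall>\<alpha> x. u (act \<alpha> x) = tpow t (- \<alpha>) * u x)"

lemma quasiD: "quasi t u \<Longrightarrow> u (act \<alpha> x) = tpow t (- \<alpha>) * u x"
  by (simp add: quasi_def)

lemma quasi_rep: "quasi t u \<Longrightarrow> u x = tpow t (- crd x) * u (reps (idx x))"
  using quasiD[of t u "crd x" "reps (idx x)"] by simp

lemma norm_quasi_rep: "quasi t u \<Longrightarrow> t \<in> torus \<Longrightarrow> norm (u x) = norm (u (reps (idx x)))"
  using quasi_rep[of t u x] norm_tpow[of t] by (metis mult_1 norm_mult)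

lemma quasi_lap: "quasi t u \<Longrightarrow> quasi t (lap u)"
  unfolding quasi_def lap_act by (simp add: lap_def sum_distrib_left[symmetric])

lemma quasi_ham: "quasi t u \<Longrightarrow> quasi t (ham (\<lambda>_. \<mu>) u)"
  using quasi_lap[of t u] by (simp add: quasi_def ham_def algebra_simps)

lemma quasi_damp: "quasi t u \<Longrightarrow> quasi t (damp \<epsilon> (\<lambda>_. \<mu>) (\<lambda>_. \<nu>) u)"
  using quasi_ham[OF quasi_ham, of t u \<mu> \<nu>] by (simp add: quasi_def damp_def algebra_simps)

text \<open>The weight \<open>deg\<close> makes \<open>lap\<close> self-adjoint.\<close>

definition inner_rep :: "('x \<Rightarrow> complex) \<Rightarrow> ('x \<Rightarrow> complex) \<Rightarrow> complex" where
  "inner_rep u w = (\<Sum>i<N. of_nat (deg adj (reps i)) * (u (reps i) * cnj (w (reps i))))"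

definition sqnorm_rep :: "('x \<Rightarrow> complex) \<Rightarrow> real" where
  "sqnorm_rep u = (\<Sum>i<N. real (deg adj (reps i)) * (norm (u (reps i)))\<^sup>2)"

lemma inner_rep_self: "inner_rep u u = of_real (sqnorm_rep u)"
  unfolding inner_rep_def sqnorm_rep_def
  by (simp only: of_real_sum of_real_mult of_real_of_nat_eq complex_norm_square)

lemma sqnorm_rep_nonneg: "0 \<le> sqnorm_rep u"
  by (simp add: sqnorm_rep_def sum_nonneg)

text \<open>The modulus of \<open>u\<close> is periodic and every degree is at least 1, so one cell
  controls the supremum.\<close>

lemma sqnorm_rep_ge:
  assumes "quasi t u" "t \<in> torus"
  shows "(norm (u x))\<^sup>2 \<le> sqnorm_rep u"
proof -
  have "(norm (u x))\<^sup>2 = 1 * (norm (u (reps (idx x))))\<^sup>2" using norm_quasi_rep[OF assms] by simp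
  also have "\<dots> \<le> real (deg adj (reps (idx x))) * (norm (u (reps (idx x))))\<^sup>2"
    using deg_pos[of "reps (idx x)"] by (intro mult_right_mono) (auto simp del: deg_pos)
  also have "\<dots> \<le> sqnorm_rep u"
    unfolding sqnorm_rep_def
    by (rule member_le_sum[where f = "\<lambda>i. real (deg adj (reps i)) * (norm (u (reps i)))\<^sup>2"]) auto
  finally show ?thesis .
qed

text \<open>Reversing an edge that starts at a representative and translating it so that it again
  starts at one is an involution. The factors agree because the multipliers of \<open>u\<close> and
  of the conjugate of \<open>w\<close> are inverse to each other.\<close>

lemma lap_selfadjoint:
  assumes "quasi t u" "quasi t w" "t \<in> torus"
  shows "inner_rep (lap u) w = inner_rep u (lap w)"
proof -
  let ?f = "\<lambda>(i, y). (idx y, act (- crd y) (reps i))"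
  have "inner_rep (lap u) w = (\<Sum>i<N. \<Sum>y\<in>nbrs adj (reps i). u y * cnj (w (reps i)))"
    unfolding inner_rep_def lap_def using deg_pos
    by (intro sum.cong refl) (simp add: sum_distrib_right sum_divide_distrib sum_distrib_left less_imp_neq[symmetric])
  also have "\<dots> = (\<Sum>(i, y)\<in>Sigma {..<N} (\<lambda>i. nbrs adj (reps i)). u y * cnj (w (reps i)))"
    by (subst sum.Sigma) auto
  also have "\<dots> = (\<Sum>(i, y)\<in>Sigma {..<N} (\<lambda>i. nbrs adj (reps i)). u (reps i) * cnj (w y))"
  proof (rule sum.reindex_bij_witness[where i = ?f and j = ?f])
    have adj: "adj (reps (idx y)) (act (- crd y) x)" if "adj x y" for x y
    proof -
      have "adj (act (- crd y) y) (act (- crd y) x)" using that adj_sym by simp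
      moreover have "act (- crd y) y = reps (idx y)" by (metis act_crd act_uminus_act(1))
      ultimately show ?thesis by simp
    qed
    fix q assume q: "q \<in> Sigma {..<N} (\<lambda>i. nbrs adj (reps i))"
    then obtain i y where iy: "q = (i, y)" "i < N" "adj (reps i) y" by (auto simp: nbrs_def)
    show "?f (?f q) = q" using iy by simp
    show "?f q \<in> Sigma {..<N} (\<lambda>i. nbrs adj (reps i))" using iy adj by (simp add: nbrs_def)
    then show "?f q \<in> Sigma {..<N} (\<lambda>i. nbrs adj (reps i))" .
    show "?f (?f q) = q" using iy by simp
    show "(case ?f q of (i, y) \<Rightarrow> u (reps i) * cnj (w y)) = (case q of (i, y) \<Rightarrow> u y * cnj (w (reps i)))"
      using iy quasi_rep[OF assms(1), of y] quasiD[OF assms(2), of "- crd y" "reps i"] cnj_tpow[OF assms(3)]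
      by simp
  qed
  also have "\<dots> = (\<Sum>i<N. \<Sum>y\<in>nbrs adj (reps i). u (reps i) * cnj (w y))"
    by (subst sum.Sigma) auto
  also have "\<dots> = inner_rep u (lap w)"
    unfolding inner_rep_def lap_def using deg_pos
    by (intro sum.cong refl) (simp add: sum_distrib_left sum_divide_distrib less_imp_neq[symmetric])
  finally show ?thesis .
qed

lemma ham_adjoint:
  assumes "quasi t u" "quasi t w" "t \<in> torus"
  shows "inner_rep (ham (\<lambda>_. \<mu>) u) w = inner_rep u (ham (\<lambda>_. cnj \<mu>) w)"
proof -
  have "inner_rep (ham (\<lambda>_. \<mu>) u) w = inner_rep (lap u) w - \<mu> * inner_rep u w"
    by (simp add: inner_rep_def ham_def algebra_simps sum_subtractf sum_distrib_left)
  moreover have "inner_rep u (ham (\<lambda>_. cnj \<mu>) w) = inner_rep u (lap w) - \<mu> * inner_rep u w"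
    by (simp add: inner_rep_def ham_def algebra_simps sum_subtractf sum_distrib_left)
  ultimately show ?thesis using lap_selfadjoint[OF assms] by simp
qed

definition total_deg :: real where
  "total_deg = (\<Sum>i<N. real (deg adj (reps i)))"

text \<open>The estimate passes through the supremum norm, which costs the factor
  \<open>total_deg\<close>; a bound uniform in \<open>t\<close> is all that the choice of
  \<open>\<epsilon>\<close> asks for.\<close>

lemma sqnorm_rep_ham_le:
  assumes "quasi t u" "t \<in> torus" "norm \<mu> \<le> c"
  shows "sqnorm_rep (ham (\<lambda>_. \<mu>) u) \<le> total_deg * (1 + c)\<^sup>2 * sqnorm_rep u"
proof -
  define s where "s = sqrt (sqnorm_rep u)"
  have le: "norm (u y) \<le> s" for y using sqnorm_rep_ge[OF assms(1,2), of y] unfolding s_def by (rule real_le_rsqrt)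
  have pt: "norm (ham (\<lambda>_. \<mu>) u x) \<le> (1 + c) * s" for x
  proof -
    have "norm (ham (\<lambda>_. \<mu>) u x) \<le> norm (lap u x) + norm (\<mu> * u x)"
      unfolding ham_def by (rule norm_triangle_ineq4)
    also have "\<dots> \<le> s + c * s"
      unfolding norm_mult using assms(3) le order_trans[OF norm_ge_zero assms(3)]
      by (intro add_mono norm_lap_le mult_mono) auto
    finally show ?thesis by (simp add: distrib_right)
  qed
  have "sqnorm_rep (ham (\<lambda>_. \<mu>) u) \<le> (\<Sum>i<N. real (deg adj (reps i)) * ((1 + c) * s)\<^sup>2)"
    unfolding sqnorm_rep_def by (intro sum_mono mult_left_mono power_mono pt) auto
  also have "\<dots> = total_deg * (1 + c)\<^sup>2 * sqnorm_rep u"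
    using sqnorm_rep_nonneg[of u] by (simp add: s_def total_deg_def power_mult_distrib sum_distrib_right mult.assoc)
  finally show ?thesis .
qed

lemma sqnorm_rep_diff:
  "sqnorm_rep (\<lambda>x. u x - of_real \<epsilon> * s x) = sqnorm_rep u - 2 * \<epsilon> * Re (inner_rep s u) + \<epsilon>\<^sup>2 * sqnorm_rep s"
proof -
  have *: "(norm (a - of_real \<epsilon> * b))\<^sup>2 = (norm a)\<^sup>2 - 2 * \<epsilon> * Re (b * cnj a) + \<epsilon>\<^sup>2 * (norm b)\<^sup>2" for a b
    unfolding cmod_power2 by (simp add: power2_eq_square algebra_simps)
  show ?thesis
    unfolding sqnorm_rep_def inner_rep_def *
    by (simp add: algebra_simps sum.distrib sum_subtractf sum_distrib_left)
qed

text \<open>Expanding the square subtracts \<open>2 * \<epsilon>\<close> times the squared norm of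
  \<open>B u\<close> and adds a term with \<open>\<epsilon>\<^sup>2\<close>. The second condition on
  \<open>\<epsilon>\<close> bounds that term by half of the gain, and \<open>lower\<close> turns the
  other half into \<open>\<epsilon> * \<delta>\<close>.\<close>

lemma sqnorm_rep_damp_le:
  assumes u: "quasi t u" and t: "t \<in> torus" and c: "norm \<mu> \<le> c"
    and lower: "\<delta> * sqnorm_rep u \<le> sqnorm_rep (ham (\<lambda>_. \<mu>) u)"
    and \<epsilon>: "0 < \<epsilon>" "\<epsilon> * (total_deg * (1 + c)\<^sup>2) \<le> 1"
  shows "sqnorm_rep (damp \<epsilon> (\<lambda>_. cnj \<mu>) (\<lambda>_. \<mu>) u) \<le> (1 - \<epsilon> * \<delta>) * sqnorm_rep u"
proof -
  let ?w = "ham (\<lambda>_. \<mu>) u"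
  let ?s = "ham (\<lambda>_. cnj \<mu>) ?w"
  have w: "quasi t ?w" by (rule quasi_ham[OF u])
  have "inner_rep ?s u = inner_rep ?w ?w" using ham_adjoint[OF w u t, of "cnj \<mu>"] by simp
  then have re: "Re (inner_rep ?s u) = sqnorm_rep ?w" by (simp add: inner_rep_self)
  have eq: "sqnorm_rep (damp \<epsilon> (\<lambda>_. cnj \<mu>) (\<lambda>_. \<mu>) u)
      = sqnorm_rep u - 2 * \<epsilon> * sqnorm_rep ?w + \<epsilon>\<^sup>2 * sqnorm_rep ?s"
    unfolding damp_def[abs_def] sqnorm_rep_diff re ..
  have "\<epsilon>\<^sup>2 * sqnorm_rep ?s \<le> \<epsilon>\<^sup>2 * (total_deg * (1 + c)\<^sup>2 * sqnorm_rep ?w)"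
    using c by (intro mult_left_mono sqnorm_rep_ham_le[OF w t]) auto
  moreover have "\<epsilon>\<^sup>2 * (total_deg * (1 + c)\<^sup>2 * sqnorm_rep ?w)
      = (\<epsilon> * (total_deg * (1 + c)\<^sup>2)) * (\<epsilon> * sqnorm_rep ?w)" by (simp add: power2_eq_square)
  moreover have "\<dots> \<le> 1 * (\<epsilon> * sqnorm_rep ?w)"
    using \<epsilon> sqnorm_rep_nonneg by (intro mult_right_mono) auto
  moreover have "\<epsilon> * (\<delta> * sqnorm_rep u) \<le> \<epsilon> * sqnorm_rep ?w"
    using \<epsilon> lower by (intro mult_left_mono) auto
  ultimately show ?thesis unfolding eq left_diff_distrib mult.assoc[of \<epsilon> \<delta>] by linarith
qed

text \<open>Averaging over a grid of roots of unity that is finer than the band width replaces Fourier inversion.\<close>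

lemma delta_eq_average:
  assumes near: "x \<in> near (2 * r) y"
  defines "M \<equiv> 2 * r + 1"
  defines "ts \<equiv> \<lambda>s :: 'n \<Rightarrow> nat. \<lambda>k. cis (2 * pi * real (s k) / real M)"
  shows "delta y x = (\<Sum>s\<in>UNIV \<rightarrow>\<^sub>E {..<M}. 1 / of_nat M ^ CARD('n) *
      (if idx x = idx y then tpow (ts s) (crd y - crd x) else 0))"
proof (cases "idx x = idx y")
  case False
  then show ?thesis by (auto simp: delta_def)
next
  case True
  define g where "g = crd y - crd x"
  have M: "0 < M" by (simp add: M_def)
  \<comment> \<open>The grid has more points per direction than the largest coordinate difference
    \<open>2 * r\<close>, so a nonzero difference is never a multiple of \<open>M\<close>.\<close>
  have g: "\<bar>g k\<bar> < int M" for k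
    using near by (auto simp: near_def g_def M_def abs_minus_commute le_imp_0_less dest!: spec[of _ k])
  have "(\<Sum>s\<in>UNIV \<rightarrow>\<^sub>E {..<M}. tpow (ts s) g)
      = (\<Prod>k\<in>UNIV. \<Sum>j<M. cis (2 * pi * real j / real M) powi g k)"
    unfolding tpow_def ts_def by (subst prod_sum_PiE) auto
  also have "\<dots> = (if g = 0 then of_nat M ^ CARD('n) else 0)"
  proof (cases "g = 0")
    case False
    then obtain k where "g k \<noteq> 0" by (auto simp: fun_eq_iff)
    then have "(\<Sum>j<M. cis (2 * pi * real j / real M) powi g k) = 0"
      using sum_cis_powi_eq_0[OF M] g by blast
    then show ?thesis using False by (auto intro!: prod_zero)
  qed simp
  finally have sum: "(\<Sum>s\<in>UNIV \<rightarrow>\<^sub>E {..<M}. tpow (ts s) g) = (if g = 0 then of_nat M ^ CARD('n) else 0)" .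
  have "(\<Sum>s\<in>UNIV \<rightarrow>\<^sub>E {..<M}. 1 / of_nat M ^ CARD('n) * tpow (ts s) g) = (if g = 0 then 1 else 0)"
    unfolding sum_distrib_left[symmetric] sum using M by simp
  moreover have "x = y \<longleftrightarrow> g = 0" using True vertex_eqI[of x y] by (auto simp: g_def)
  ultimately show ?thesis using True by (simp add: delta_def g_def)
qed

text \<open>In the window seen by row \<open>x\<close>, \<open>delta y\<close> is an average of
  waves whose squared cell norm is at most \<open>total_deg\<close>. The hypothesis controls the
  image of each wave in its cell, hence also at \<open>x\<close>, and averaging costs nothing; so
  the bound is free of the band width \<open>r\<close>.\<close>

lemma entry_bound:
  assumes A: "band r A"
    and contr: "\<And>t u. t \<in> torus \<Longrightarrow> quasi t u \<Longrightarrow> quasi t (A u) \<and> sqnorm_rep (A u) \<le> \<theta> * sqnorm_rep u"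
    and \<theta>: "0 \<le> \<theta>"
  shows "norm (A (delta y) x) \<le> sqrt (\<theta> * total_deg)"
proof (cases "y \<in> near r x")
  case False
  then have "A (delta y) x = A (\<lambda>_. 0) x" by (intro band_cong[OF A]) (auto simp: delta_def)
  then have "A (delta y) x = 0" by (simp add: linear_op_zero[OF band_linear[OF A]])
  then show ?thesis using \<theta> by (simp add: total_deg_def sum_nonneg)
next
  case True
  define M where "M = 2 * r + 1"
  define G where "G = ((UNIV :: 'n set) \<rightarrow>\<^sub>E {..<M})"
  define ts where "ts = (\<lambda>s :: 'n \<Rightarrow> nat. \<lambda>k. cis (2 * pi * real (s k) / real M))"
  define wave where "wave = (\<lambda>s z. if idx z = idx y then tpow (ts s) (crd y - crd z) else 0)"
  have finG: "finite G" by (simp add: G_def finite_PiE)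
  have cardG: "card G = M ^ CARD('n)" by (simp add: G_def card_PiE)
  have M: "0 < M" by (simp add: M_def)
  have ts: "ts s \<in> torus" for s by (simp add: ts_def torus_def)
  have quasi: "quasi (ts s) (wave s)" for s
  proof -
    have "tpow (ts s) (crd y - (\<alpha> + crd x)) = tpow (ts s) (- \<alpha>) * tpow (ts s) (crd y - crd x)" for \<alpha> x
      unfolding tpow_add[OF ts, symmetric] by (rule arg_cong[of _ _ "tpow (ts s)"]) simp
    then show ?thesis by (simp add: quasi_def wave_def)
  qed
  have "sqnorm_rep (wave s) \<le> total_deg" for s
    unfolding sqnorm_rep_def total_deg_def wave_def
    by (intro sum_mono) (simp add: norm_tpow[OF ts])
  then have b: "norm (A (wave s) x) \<le> sqrt (\<theta> * total_deg)" for s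
  proof -
    have "(norm (A (wave s) x))\<^sup>2 \<le> sqnorm_rep (A (wave s))"
      using contr[OF ts quasi] sqnorm_rep_ge[OF _ ts] by blast
    also have "\<dots> \<le> \<theta> * sqnorm_rep (wave s)" using contr[OF ts quasi] by blast
    also have "\<dots> \<le> \<theta> * total_deg" by (intro mult_left_mono \<theta>) fact
    finally show ?thesis by (rule real_le_rsqrt)
  qed
  have "A (delta y) x = A (\<lambda>z. \<Sum>s\<in>G. 1 / of_nat M ^ CARD('n) * wave s z) x"
  proof (rule band_cong[OF A])
    fix z assume "z \<in> near r x"
    then have "z \<in> near (2 * r) y" using near_trans[of x r y z r] True by (simp add: near_sym[of x] mult_2)
    from delta_eq_average[OF this] show "delta y z = (\<Sum>s\<in>G. 1 / of_nat M ^ CARD('n) * wave s z)"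
      unfolding G_def M_def wave_def ts_def .
  qed
  also have "\<dots> = (\<Sum>s\<in>G. 1 / of_nat M ^ CARD('n) * A (wave s) x)"
    by (simp only: linear_op_sum[OF band_linear[OF A] finG, of "\<lambda>_. 1 / of_nat M ^ CARD('n)" wave])
  finally have "norm (A (delta y) x) \<le> (\<Sum>s\<in>G. norm (1 / of_nat M ^ CARD('n) * A (wave s) x))"
    by (metis norm_sum)
  also have "\<dots> \<le> (\<Sum>s\<in>G. 1 / real M ^ CARD('n) * sqrt (\<theta> * total_deg))"
    using b by (intro sum_mono) (simp add: norm_mult norm_divide norm_power divide_right_mono)
  also have "\<dots> = sqrt (\<theta> * total_deg)" using M by (simp add: cardG)
  finally show ?thesis .
qed

end

section \<open>Limit potentials and uniform invertibility\<close>

lemma bounded_seq_finite: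
  fixes f :: "nat \<Rightarrow> 'i \<Rightarrow> complex"
  assumes "finite I" "\<And>i m. i \<in> I \<Longrightarrow> norm (f m i) \<le> B"
  shows "\<exists>r l. strict_mono (r :: nat \<Rightarrow> nat) \<and> (\<forall>i\<in>I. (\<lambda>m. f (r m) i) \<longlonglongrightarrow> l i)"
  using assms
proof (induction I rule: finite_induct)
  case empty
  then show ?case using strict_mono_id by auto
next
  case (insert a I)
  then obtain r l where r: "strict_mono (r :: nat \<Rightarrow> nat)" and l: "\<forall>i\<in>I. (\<lambda>m. f (r m) i) \<longlonglongrightarrow> l i"
    by (metis insertI2)
  have "bounded (range (\<lambda>m. f (r m) a))"
    unfolding bounded_iff using insert.prems[of a] by (intro exI[of _ B]) auto
  then obtain c s where s: "strict_mono (s :: nat \<Rightarrow> nat)" "((\<lambda>m. f (r m) a) \<circ> s) \<longlonglongrightarrow> c"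
    using bounded_imp_convergent_subsequence by blast
  have "\<forall>i\<in>insert a I. (\<lambda>m. f ((r \<circ> s) m) i) \<longlonglongrightarrow> (l(a := c)) i"
  proof
    fix i assume i: "i \<in> insert a I"
    show "(\<lambda>m. f ((r \<circ> s) m) i) \<longlonglongrightarrow> (l(a := c)) i"
    proof (cases "i = a")
      case True
      then show ?thesis using s by (simp add: o_def)
    next
      case False
      then have "(\<lambda>m. f (r m) i) \<longlonglongrightarrow> l i" using i l by auto
      from LIMSEQ_subseq_LIMSEQ[OF this s(1)] False show ?thesis by (simp add: o_def)
    qed
  qed
  moreover have "strict_mono (r \<circ> s)" using r s by (simp add: strict_mono_o)
  ultimately show ?case by blast
qed

text \<open>With \<open>s\<close> the \<open>d\<close>-th root of \<open>q\<close>, the sequence is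
  the \<open>d\<close>-th power of one that tends to zero.\<close>

lemma linear_power_times_geometric_tendsto_0:
  fixes q a b :: real
  assumes "0 \<le> q" "q < 1" "0 < d"
  shows "(\<lambda>k. (a * real k + b) ^ d * q ^ k) \<longlonglongrightarrow> 0"
proof -
  define s where "s = root d q"
  have s: "0 \<le> s" "s < 1" "s ^ d = q" using assms by (simp_all add: s_def)
  have "(\<lambda>k. a * (real k * s ^ k) + b * s ^ k) \<longlonglongrightarrow> a * 0 + b * 0"
    using s powser_times_n_limit_0[of s] by (intro tendsto_intros LIMSEQ_power_zero) auto
  then have "(\<lambda>k. (a * (real k * s ^ k) + b * s ^ k) ^ d) \<longlonglongrightarrow> (a * 0 + b * 0) ^ d" by (rule tendsto_power)
  moreover have "(a * (real k * s ^ k) + b * s ^ k) ^ d = (a * real k + b) ^ d * q ^ k" for k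
  proof -
    have "a * (real k * s ^ k) + b * s ^ k = (a * real k + b) * s ^ k" by (simp add: algebra_simps)
    moreover have "(s ^ k) ^ d = q ^ k" unfolding s(3)[symmetric] by (simp add: power_mult[symmetric] mult.commute)
    ultimately show ?thesis by (simp add: power_mult_distrib)
  qed
  ultimately show ?thesis using assms by (simp add: zero_power)
qed

context periodic
begin

lemma limit_potentialsD:
  assumes v: "v \<in> SO act" and w: "w \<in> limit_potentials act v"
  shows "w = (\<lambda>_. w x0)"
proof
  fix x
  obtain g :: "nat \<Rightarrow> 'n \<Rightarrow> int" where g: "filterlim g cofinite sequentially"
    and lim: "\<And>x. (\<lambda>m. v (act (g m) x)) \<longlonglongrightarrow> w x"
    using w unfolding limit_potentials_def by blast
  have "((\<lambda>\<alpha>. v (act \<alpha> x) - v (act \<alpha> x0)) \<longlongrightarrow> 0) cofinite" using v by (simp add: SO_def)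
  then have "(\<lambda>m. v (act (g m) x) - v (act (g m) x0)) \<longlonglongrightarrow> 0" using g by (rule filterlim_compose)
  moreover have "(\<lambda>m. v (act (g m) x) - v (act (g m) x0)) \<longlonglongrightarrow> w x - w x0" by (intro tendsto_diff lim)
  ultimately have "w x - w x0 = 0" using LIMSEQ_unique by blast
  then show "w x = w x0" by simp
qed

text \<open>Subsequences are extracted at a single vertex; slow oscillation spreads the convergence
  to all others.\<close>

lemma SO_shift_tendsto:
  assumes v: "v \<in> SO act" and g: "filterlim g cofinite sequentially"
    and lim: "(\<lambda>m. v (act (g m) x0)) \<longlonglongrightarrow> c"
  shows "(\<lambda>m. v (act (g m) x)) \<longlonglongrightarrow> c"
proof -
  have "((\<lambda>\<alpha>. v (act \<alpha> x) - v (act \<alpha> x0)) \<longlongrightarrow> 0) cofinite" using v by (simp add: SO_def)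
  then have "(\<lambda>m. v (act (g m) x) - v (act (g m) x0)) \<longlonglongrightarrow> 0" using g by (rule filterlim_compose)
  from tendsto_add[OF this lim] show ?thesis by simp
qed

lemma limit_potentialsI:
  assumes "v \<in> SO act" "filterlim g cofinite sequentially" "(\<lambda>m. v (act (g m) x0)) \<longlonglongrightarrow> c"
  shows "(\<lambda>_. c) \<in> limit_potentials act v"
  unfolding limit_potentials_def using assms(2) SO_shift_tendsto[OF assms] by blast

text \<open>Every finite set of lattice points lies in some box around 0.\<close>

lemma filterlim_cofinite_nearorb:
  fixes \<alpha> :: "nat \<Rightarrow> 'n \<Rightarrow> int"
  assumes "\<And>m. \<alpha> m \<notin> nearorb m 0"
  shows "filterlim \<alpha> cofinite sequentially"
  unfolding filterlim_iff eventually_cofinite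
proof (intro allI impI)
  fix P :: "('n \<Rightarrow> int) \<Rightarrow> bool" assume fin: "finite {x. \<not> P x}"
  define m0 where "m0 = (\<Sum>x\<in>{x. \<not> P x}. \<Sum>k\<in>UNIV. nat \<bar>x k\<bar>)"
  have "x \<in> nearorb m0 0" if "\<not> P x" for x
  proof -
    have "\<bar>x k\<bar> \<le> int m0" for k
    proof -
      have "nat \<bar>x k\<bar> \<le> (\<Sum>k\<in>UNIV. nat \<bar>x k\<bar>)" by (rule member_le_sum) auto
      also have "\<dots> \<le> m0" unfolding m0_def
        by (rule member_le_sum[where f = "\<lambda>x. \<Sum>k\<in>UNIV. nat \<bar>x k\<bar>"]) (use that fin in auto)
      finally show ?thesis by linarith
    qed
    then show ?thesis by (simp add: nearorb_def)
  qed
  moreover have "nearorb m0 0 \<subseteq> nearorb m 0" if "m0 \<le> m" for m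
    using that by (auto simp: nearorb_def intro: order_trans)
  ultimately have "P (\<alpha> m)" if "m0 \<le> m" for m using assms[of m] that by blast
  then show "eventually (\<lambda>m. P (\<alpha> m)) sequentially" by (auto simp: eventually_sequentially)
qed

text \<open>A diagonal choice: for each \<open>m\<close> one lattice point outside the box of radius
  \<open>m\<close> at which \<open>v\<close> is within \<open>1 / real (Suc m)\<close> of
  \<open>l\<close>.\<close>

lemma limit_potentials_closed:
  assumes v: "v \<in> SO act" and c: "\<And>j. (\<lambda>_. c j) \<in> limit_potentials act v" and lim: "c \<longlonglongrightarrow> l"
  shows "(\<lambda>_. l) \<in> limit_potentials act v"
proof -
  fix x0 :: 'x
  have "\<exists>\<alpha>. \<alpha> \<notin> nearorb m 0 \<and> norm (v (act \<alpha> x0) - l) < 1 / real (Suc m)" for m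
  proof -
    let ?e = "1 / real (Suc m) / 2"
    have e: "0 < ?e" by simp
    obtain j where j: "norm (c j - l) < ?e" using LIMSEQ_D[OF lim e] by (meson order_refl)
    obtain g :: "nat \<Rightarrow> 'n \<Rightarrow> int" where g: "filterlim g cofinite sequentially"
      and gl: "\<And>x. (\<lambda>m. v (act (g m) x)) \<longlonglongrightarrow> c j"
      using c[of j] unfolding limit_potentials_def by blast
    have "eventually (\<lambda>\<alpha>. \<alpha> \<notin> nearorb m 0) (cofinite :: ('n \<Rightarrow> int) filter)" by (simp add: eventually_cofinite)
    then have "eventually (\<lambda>k. g k \<notin> nearorb m 0) sequentially" using g unfolding filterlim_iff by blast
    moreover have "eventually (\<lambda>k. norm (v (act (g k) x0) - c j) < ?e) sequentially"
      using tendstoD[OF gl e] by (simp add: dist_norm)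
    ultimately have "eventually (\<lambda>k. g k \<notin> nearorb m 0 \<and> norm (v (act (g k) x0) - c j) < ?e) sequentially"
      by eventually_elim simp
    then obtain k where k: "g k \<notin> nearorb m 0" "norm (v (act (g k) x0) - c j) < ?e"
      using eventually_happens by fastforce
    have "norm (v (act (g k) x0) - l) < ?e + ?e"
      by (rule norm_diff_triangle_less[OF k(2) j])
    then show ?thesis using k(1) unfolding field_sum_of_halves by blast
  qed
  then obtain \<alpha> where \<alpha>: "\<And>m. \<alpha> m \<notin> nearorb m 0" "\<And>m. norm (v (act (\<alpha> m) x0) - l) < 1 / real (Suc m)"
    by metis
  have "(\<lambda>m. v (act (\<alpha> m) x0) - l) \<longlonglongrightarrow> 0"
    by (rule Lim_null_comparison[OF _ LIMSEQ_inverse_real_of_nat])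
       (use \<alpha>(2) in \<open>auto simp: inverse_eq_divide intro!: always_eventually less_imp_le\<close>)
  then show ?thesis
    by (intro limit_potentialsI[OF v filterlim_cofinite_nearorb[OF \<alpha>(1)], of x0]) (rule LIM_zero_cancel)
qed

text \<open>Substituting \<open>y = act (- \<beta>) (reps j)\<close> merges the sums over
  \<open>j\<close> and \<open>\<beta>\<close> into one over vertices, and
  \<open>tpow t \<beta>\<close> is absorbed by the quasi-periodicity of \<open>u\<close>.\<close>

lemma symbol_apply:
  assumes u: "quasi t u" and t: "t \<in> torus" and i: "i < N"
  shows "(\<Sum>j<N. symbol adj act N reps (\<lambda>_. c) t $$ (i, j) * u (reps j)) = lap u (reps i) + c * u (reps i)"
proof -
  let ?k = "kernel_fn adj (\<lambda>_. c)"
  define S where "S j = {\<beta>. ?k (act \<beta> (reps i)) (reps j) \<noteq> 0}" for j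
  define Y where "Y = {y. ?k (reps i) y \<noteq> 0}"
  have Ysub: "Y \<subseteq> insert (reps i) (nbrs adj (reps i))"
    by (auto simp: Y_def kernel_fn_def nbrs_def split: if_splits)
  then have finY: "finite Y" by (rule finite_subset) simp
  have k_act: "?k (act \<beta> x) (act \<beta> y) = ?k x y" for \<beta> x y
    by (simp add: kernel_fn_def act_eq_iff)
  have k_move: "?k (act \<beta> x) y = ?k x (act (- \<beta>) y)" for \<beta> x y
    using k_act[of \<beta> x "act (- \<beta>) y"] by simp
  have SY: "\<beta> \<in> S j \<longleftrightarrow> act (- \<beta>) (reps j) \<in> Y" for \<beta> j by (simp add: S_def Y_def k_move)
  \<comment> \<open>Finiteness matters: over an infinite index set the sum in \<open>symbol\<close>
    would be 0 by convention.\<close>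
  have finS: "finite (S j)" if "j < N" for j
  proof (rule finite_subset)
    show "S j \<subseteq> (\<lambda>y. - crd y) ` Y"
    proof
      fix \<beta> assume "\<beta> \<in> S j"
      then show "\<beta> \<in> (\<lambda>y. - crd y) ` Y" using that by (intro image_eqI[of _ _ "act (- \<beta>) (reps j)"]) (auto simp: SY)
    qed
  qed (use finY in simp)
  have "(\<Sum>j<N. symbol adj act N reps (\<lambda>_. c) t $$ (i, j) * u (reps j))
      = (\<Sum>j<N. \<Sum>\<beta>\<in>S j. ?k (act \<beta> (reps i)) (reps j) * tpow t \<beta> * u (reps j))"
    using i by (intro sum.cong refl) (simp add: symbol_def S_def sum_distrib_right)
  also have "\<dots> = (\<Sum>(j, \<beta>)\<in>Sigma {..<N} S. ?k (act \<beta> (reps i)) (reps j) * tpow t \<beta> * u (reps j))"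
    using finS by (subst sum.Sigma) auto
  also have "\<dots> = (\<Sum>y\<in>Y. ?k (reps i) y * u y)"
  proof (rule sum.reindex_bij_witness[where j = "\<lambda>(j, \<beta>). act (- \<beta>) (reps j)" and i = "\<lambda>y. (idx y, - crd y)"])
    fix q assume "q \<in> Sigma {..<N} S"
    then obtain j \<beta> where q: "q = (j, \<beta>)" "j < N" "\<beta> \<in> S j" by auto
    show "(case q of (j, \<beta>) \<Rightarrow> act (- \<beta>) (reps j)) \<in> Y" using q SY by simp
    show "(idx (case q of (j, \<beta>) \<Rightarrow> act (- \<beta>) (reps j)), - crd (case q of (j, \<beta>) \<Rightarrow> act (- \<beta>) (reps j))) = q"
      using q by simp
    show "?k (reps i) (case q of (j, \<beta>) \<Rightarrow> act (- \<beta>) (reps j)) * u (case q of (j, \<beta>) \<Rightarrow> act (- \<beta>) (reps j))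
        = (case q of (j, \<beta>) \<Rightarrow> ?k (act \<beta> (reps i)) (reps j) * tpow t \<beta> * u (reps j))"
      using q quasiD[OF u, of "- \<beta>" "reps j"] by (simp add: k_move)
  next
    fix y assume "y \<in> Y"
    then show "(case (idx y, - crd y) of (j, \<beta>) \<Rightarrow> act (- \<beta>) (reps j)) = y"
      and "(idx y, - crd y) \<in> Sigma {..<N} S" by (simp_all add: SY)
  qed
  also have "\<dots> = (\<Sum>y\<in>insert (reps i) (nbrs adj (reps i)). ?k (reps i) y * u y)"
    using Ysub by (intro sum.mono_neutral_left) (auto simp: Y_def)
  also have "\<dots> = c * u (reps i) + (\<Sum>y\<in>nbrs adj (reps i). ?k (reps i) y * u y)"
    by (subst sum.insert) (simp_all add: kernel_fn_def, simp add: nbrs_def)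
  also have "(\<Sum>y\<in>nbrs adj (reps i). ?k (reps i) y * u y) = lap u (reps i)"
    unfolding lap_def sum_divide_distrib
    by (intro sum.cong refl) (auto simp: nbrs_def kernel_fn_def)
  finally show ?thesis by simp
qed

text \<open>A quasi-periodic function amounts to its vector of values at the representatives. The
  symbol is the matrix of the operator in these coordinates, and its eigenvectors are Bloch
  waves.\<close>

lemma eigenvalue_symbol_iff:
  assumes t: "t \<in> torus"
  shows "eigenvalue (symbol adj act N reps (\<lambda>_. c) t) z
    \<longleftrightarrow> (\<exists>u. quasi t u \<and> (\<exists>x. u x \<noteq> 0) \<and> (\<forall>x. lap u x + c * u x = z * u x))"
    (is "eigenvalue ?S z \<longleftrightarrow> _")
proof -
  have dim: "dim_row ?S = N" "dim_col ?S = N" by (simp_all add: symbol_def)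
  have mv: "(?S *\<^sub>v a) $ i = lap u (reps i) + c * u (reps i)"
    if "quasi t u" "a \<in> carrier_vec N" "\<And>j. j < N \<Longrightarrow> a $ j = u (reps j)" "i < N" for a u i
  proof -
    have "(?S *\<^sub>v a) $ i = (\<Sum>j<N. ?S $$ (i, j) * a $ j)"
      using that by (auto simp: dim scalar_prod_def lessThan_atLeast0 intro!: sum.cong)
    then show ?thesis using symbol_apply[OF that(1) t that(4), of c] that(3) by simp
  qed
  show ?thesis
  proof
    assume "eigenvalue ?S z"
    then obtain a where a: "a \<in> carrier_vec N" "a \<noteq> 0\<^sub>v N" "?S *\<^sub>v a = z \<cdot>\<^sub>v a"
      unfolding eigenvalue_def eigenvector_def dim by blast
    define u where "u x = tpow t (- crd x) * a $ idx x" for x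
    have u: "quasi t u" by (simp add: quasi_def u_def tpow_add[OF t, symmetric])
    have rep: "u (reps j) = a $ j" if "j < N" for j using that by (simp add: u_def)
    have eq_rep: "lap u (reps i) + c * u (reps i) = z * u (reps i)" if "i < N" for i
      using mv[OF u a(1) rep[symmetric] that] a(1,3) that rep[OF that] by simp
    have "lap u x + c * u x = z * u x" for x
    proof -
      have "lap u x + c * u x = tpow t (- crd x) * (lap u (reps (idx x)) + c * u (reps (idx x)))"
        using quasi_rep[OF quasi_lap[OF u], of x] quasi_rep[OF u, of x] by (simp add: algebra_simps)
      also have "\<dots> = z * u x" using eq_rep[of "idx x"] quasi_rep[OF u, of x] by (simp add: algebra_simps)
      finally show ?thesis .
    qed
    moreover have "\<exists>x. u x \<noteq> 0"
    proof (rule ccontr)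
      assume "\<not> ?thesis"
      then have "a = 0\<^sub>v N" using a(1) rep by (intro eq_vecI) auto
      then show False using a(2) by simp
    qed
    ultimately show "\<exists>u. quasi t u \<and> (\<exists>x. u x \<noteq> 0) \<and> (\<forall>x. lap u x + c * u x = z * u x)" using u by blast
  next
    assume "\<exists>u. quasi t u \<and> (\<exists>x. u x \<noteq> 0) \<and> (\<forall>x. lap u x + c * u x = z * u x)"
    then obtain u x where u: "quasi t u" "u x \<noteq> 0" "\<And>x. lap u x + c * u x = z * u x" by blast
    define a where "a = vec N (\<lambda>j. u (reps j))"
    have a: "a \<in> carrier_vec N" "\<And>j. j < N \<Longrightarrow> a $ j = u (reps j)" by (simp_all add: a_def)
    have "a \<noteq> 0\<^sub>v N"
    proof
      assume "a = 0\<^sub>v N"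
      then have "u (reps (idx x)) = 0" using a(2)[of "idx x"] by simp
      then show False using u(2) quasi_rep[OF u(1), of x] by simp
    qed
    moreover have "?S *\<^sub>v a = z \<cdot>\<^sub>v a"
    proof (rule eq_vecI)
      fix i assume "i < dim_vec (z \<cdot>\<^sub>v a)"
      then have i: "i < N" by (simp add: a_def)
      show "(?S *\<^sub>v a) $ i = (z \<cdot>\<^sub>v a) $ i"
        using mv[OF u(1) a i] i a(1) by (simp add: u(3) a(2) del: index_mult_mat_vec)
    qed (simp add: dim a_def)
    ultimately show "eigenvalue ?S z" unfolding eigenvalue_def eigenvector_def dim using a(1) by blast
  qed
qed

section \<open>Continuity in the potential, compactness, and matrix entries far from the
  origin\<close>

lemma tendsto_lap: "(\<And>y. (\<lambda>m. u m y) \<longlonglongrightarrow> l y) \<Longrightarrow> (\<lambda>m. lap (u m) x) \<longlonglongrightarrow> lap l x"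
  by (rule band_tendsto[OF band_lap])

lemma tendsto_ham:
  "(\<And>y. (\<lambda>m. a m y) \<longlonglongrightarrow> b y) \<Longrightarrow> (\<And>y. (\<lambda>m. u m y) \<longlonglongrightarrow> l y) \<Longrightarrow> (\<lambda>m. ham (a m) (u m) x) \<longlonglongrightarrow> ham b l x"
  unfolding ham_def by (intro tendsto_intros tendsto_lap)

lemma tendsto_damp:
  "(\<And>y. (\<lambda>m. a m y) \<longlonglongrightarrow> a' y) \<Longrightarrow> (\<And>y. (\<lambda>m. b m y) \<longlonglongrightarrow> b' y) \<Longrightarrow> (\<And>y. (\<lambda>m. u m y) \<longlonglongrightarrow> l y)
    \<Longrightarrow> (\<lambda>m. damp \<epsilon> (a m) (b m) (u m) x) \<longlonglongrightarrow> damp \<epsilon> a' b' l x"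
  unfolding damp_def by (intro tendsto_intros tendsto_ham)

lemma tendsto_damp_funpow:
  assumes "\<And>y. (\<lambda>m. a m y) \<longlonglongrightarrow> a' y" "\<And>y. (\<lambda>m. b m y) \<longlonglongrightarrow> b' y"
  shows "(\<lambda>m. (damp \<epsilon> (a m) (b m) ^^ K) u x) \<longlonglongrightarrow> (damp \<epsilon> a' b' ^^ K) u x"
  by (induction K arbitrary: x) (simp_all add: tendsto_damp[OF assms])

lemma damp_funpow_act:
  "(damp \<epsilon> a b ^^ K) u (act \<alpha> x)
    = (damp \<epsilon> (\<lambda>y. a (act \<alpha> y)) (\<lambda>y. b (act \<alpha> y)) ^^ K) (\<lambda>y. u (act \<alpha> y)) x"
proof (induction K arbitrary: x)
  case (Suc K)
  then show ?case by (simp add: damp_act)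
qed simp

lemma norm_limit_potential_le:
  assumes "(\<lambda>_. c) \<in> limit_potentials act v" "\<And>x. norm (v x) \<le> V"
  shows "norm c \<le> V"
proof -
  obtain g :: "nat \<Rightarrow> 'n \<Rightarrow> int" where "\<forall>x. (\<lambda>k. v (act (g k) x)) \<longlonglongrightarrow> c"
    using assms(1) unfolding limit_potentials_def by blast
  then have "(\<lambda>k. norm (v (act (g k) undefined))) \<longlonglongrightarrow> norm c" by (intro tendsto_norm) blast
  then show ?thesis by (rule LIMSEQ_le_const2) (use assms(2) in auto)
qed

text \<open>This holds because the torus and the set of limit values of \<open>v\<close> are compact.\<close>

lemma uniform_lower_bound:
  assumes v: "v \<in> SO act" and z: "z \<notin> (\<Union>w\<in>limit_potentials act v. band_union adj act N reps w)"
  shows "\<exists>\<delta>>0. \<forall>c t u. (\<lambda>_. c) \<in> limit_potentials act v \<longrightarrow> t \<in> torus \<longrightarrow> quasi t u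
    \<longrightarrow> \<delta> * sqnorm_rep u \<le> sqnorm_rep (ham (\<lambda>_. z - c) u)"
proof (rule ccontr)
  assume neg: "\<not> ?thesis"
  obtain V where V: "\<And>x. norm (v x) \<le> V" using v by (auto simp: SO_def bounded_iff)
  have "\<exists>c t u. (\<lambda>_. c) \<in> limit_potentials act v \<and> t \<in> torus \<and> quasi t u
      \<and> sqnorm_rep u = 1 \<and> sqnorm_rep (ham (\<lambda>_. z - c) u) < 1 / real (Suc m)" for m
  proof -
    have "0 < 1 / real (Suc m)" by simp
    then obtain c t u where ctu: "(\<lambda>_. c) \<in> limit_potentials act v" "t \<in> torus" "quasi t u"
      "sqnorm_rep (ham (\<lambda>_. z - c) u) < 1 / real (Suc m) * sqnorm_rep u"
      using neg by (metis not_le)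
    define s where "s = sqrt (sqnorm_rep u)"
    have "sqnorm_rep u > 0"
      using ctu(4) sqnorm_rep_nonneg[of "ham (\<lambda>_. z - c) u"] sqnorm_rep_nonneg[of u]
      by (cases "sqnorm_rep u = 0") auto
    then have s: "s > 0" "s\<^sup>2 = sqnorm_rep u" by (simp_all add: s_def)
    have scale: "sqnorm_rep (\<lambda>x. f x / of_real s) = sqnorm_rep f / s\<^sup>2" for f
      using s by (simp add: sqnorm_rep_def norm_divide power_divide sum_divide_distrib)
    let ?u = "\<lambda>x. u x / of_real s"
    have "quasi t ?u" using ctu(3) by (simp add: quasi_def)
    moreover have "sqnorm_rep ?u = 1" using s(1) by (simp add: scale flip: s(2))
    moreover have "ham (\<lambda>_. z - c) ?u = (\<lambda>x. ham (\<lambda>_. z - c) u x / of_real s)"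
      using linear_op_scale[OF band_linear[OF band_ham], of "\<lambda>_. z - c" "1 / of_real s" u] by simp
    then have "sqnorm_rep (ham (\<lambda>_. z - c) ?u) < 1 / real (Suc m)"
      using ctu(4) s(1) by (simp add: scale divide_simps mult.commute flip: s(2))
    ultimately show ?thesis using ctu by blast
  qed
  then obtain c t u where ctu: "\<And>m. (\<lambda>_. c m) \<in> limit_potentials act v" "\<And>m. t m \<in> torus"
      "\<And>m. quasi (t m) (u m)" "\<And>m. sqnorm_rep (u m) = 1"
      "\<And>m. sqnorm_rep (ham (\<lambda>_. z - c m) (u m)) < 1 / real (Suc m)"
    by metis
  \<comment> \<open>Multiplier, cell values and limit value are packed into one finite family, so
    that a single subsequence serves all of them; the index \<open>Inr N\<close> carries the limit
    value.\<close>
  define f where "f m = (\<lambda>i. case i of Inl k \<Rightarrow> t m k | Inr j \<Rightarrow> if j < N then u m (reps j) else c m)" for m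
  let ?I = "range Inl \<union> Inr ` {..N} :: ('n + nat) set"
  have "norm (c m) \<le> V" for m by (rule norm_limit_potential_le[OF ctu(1) V])
  moreover have "norm (u m x) \<le> 1" for m x
    using sqnorm_rep_ge[OF ctu(3,2), of m x] ctu(4)[of m] by (simp add: abs_square_le_1)
  moreover have "norm (t m k) = 1" for m k using ctu(2)[of m] by (simp add: torus_def)
  ultimately have fb: "norm (f m i) \<le> max 1 V" for m i
    by (auto simp: f_def max.coboundedI1 max.coboundedI2 split: sum.split)
  have "finite ?I" by simp
  from bounded_seq_finite[OF this, of f "max 1 V", OF fb] obtain r l where r: "strict_mono (r :: nat \<Rightarrow> nat)"
    and "\<forall>i\<in>?I. (\<lambda>m. f (r m) i) \<longlonglongrightarrow> l i" by blast
  then have l: "(\<lambda>m. f (r m) i) \<longlonglongrightarrow> l i" if "i \<in> ?I" for i using that by blast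
  define c0 where "c0 = l (Inr N)"
  define t0 where "t0 = (\<lambda>k. l (Inl k))"
  \<comment> \<open>The limit wave is rebuilt from its limits at the representatives and the limit
    multiplier, which makes it quasi-periodic by construction.\<close>
  define u0 where "u0 = (\<lambda>x. tpow t0 (- crd x) * l (Inr (idx x)))"
  have clim: "(\<lambda>m. c (r m)) \<longlonglongrightarrow> c0" using l[of "Inr N"] by (simp add: f_def c0_def)
  have tlim: "(\<lambda>m. t (r m) k) \<longlonglongrightarrow> t0 k" for k using l[of "Inl k"] by (simp add: f_def t0_def)
  have t0: "t0 \<in> torus"
  proof -
    have "norm (t0 k) = 1" for k
    proof -
      have "(\<lambda>m. norm (t (r m) k)) \<longlonglongrightarrow> norm (t0 k)" by (intro tendsto_norm tlim)
      moreover have "norm (t (r m) k) = 1" for m using ctu(2) by (simp add: torus_def)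
      ultimately show ?thesis by (simp add: LIMSEQ_const_iff)
    qed
    then show ?thesis by (simp add: torus_def)
  qed
  have ulim: "(\<lambda>m. u (r m) x) \<longlonglongrightarrow> u0 x" for x
  proof -
    have "t0 k \<noteq> 0" for k
      using t0 norm_zero unfolding torus_def by (metis (mono_tags, lifting) mem_Collect_eq zero_neq_one)
    then have "(\<lambda>m. tpow (t (r m)) (- crd x)) \<longlonglongrightarrow> tpow t0 (- crd x)"
      unfolding tpow_def by (intro tendsto_prod tendsto_power_int tlim)
    moreover have "(\<lambda>m. u (r m) (reps (idx x))) \<longlonglongrightarrow> l (Inr (idx x))"
      using l[of "Inr (idx x)"] idx_less[of x] by (simp add: f_def)
    ultimately show ?thesis
      unfolding u0_def by (subst quasi_rep[OF ctu(3)]) (rule tendsto_mult)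
  qed
  have u0: "quasi t0 u0" by (simp add: quasi_def u0_def tpow_add[OF t0, symmetric])
  have Qlim: "(\<lambda>m. sqnorm_rep (h m)) \<longlonglongrightarrow> sqnorm_rep h0" if "\<And>x. (\<lambda>m. h m x) \<longlonglongrightarrow> h0 x"
    for h :: "nat \<Rightarrow> 'x \<Rightarrow> complex" and h0
    unfolding sqnorm_rep_def by (intro tendsto_intros that)
  have "sqnorm_rep u0 = 1" using Qlim[of "\<lambda>m. u (r m)" u0, OF ulim] by (simp add: ctu(4) LIMSEQ_const_iff)
  then have nz: "\<exists>x. u0 x \<noteq> 0" by (rule contrapos_pp) (simp add: sqnorm_rep_def)
  have "sqnorm_rep (ham (\<lambda>_. z - c0) u0) \<le> 0"
  proof (rule LIMSEQ_le)
    show "(\<lambda>m. sqnorm_rep (ham (\<lambda>_. z - c (r m)) (u (r m)))) \<longlonglongrightarrow> sqnorm_rep (ham (\<lambda>_. z - c0) u0)"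
      by (intro Qlim tendsto_ham ulim tendsto_intros clim)
    show "(\<lambda>m. 1 / real (Suc (r m))) \<longlonglongrightarrow> 0"
      using LIMSEQ_subseq_LIMSEQ[OF LIMSEQ_inverse_real_of_nat r] by (simp add: o_def inverse_eq_divide)
    show "\<exists>M. \<forall>m\<ge>M. sqnorm_rep (ham (\<lambda>_. z - c (r m)) (u (r m))) \<le> 1 / real (Suc (r m))"
      using ctu(5) less_imp_le by blast
  qed
  then have "norm (ham (\<lambda>_. z - c0) u0 x) = 0" for x
    using sqnorm_rep_ge[OF quasi_ham[OF u0] t0, of "z - c0" x] by (metis norm_ge_zero order_trans power2_less_eq_zero_iff)
  then have "lap u0 x + c0 * u0 x = z * u0 x" for x
    by (simp add: ham_def algebra_simps)
  then have "eigenvalue (symbol adj act N reps (\<lambda>_. c0) t0) z"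
    unfolding eigenvalue_symbol_iff[OF t0] using u0 nz by blast
  moreover have "(\<lambda>_. c0) \<in> limit_potentials act v"
    by (rule limit_potentials_closed[OF v ctu(1) clim])
  ultimately show False using z t0 unfolding band_union_def by blast
qed

text \<open>Modulo translation only finitely many entries lie in the band. Along translates going to
  infinity such an entry tends, on a subsequence, to an entry of a constant-coefficient operator, so
  it exceeds \<open>\<eta>\<close> only finitely often. The strict inequality in \<open>lim\<close>
  excludes the limiting case.\<close>

lemma tail_entries_small:
  fixes f g :: "complex \<Rightarrow> complex"
  assumes v: "v \<in> SO act" and f: "continuous_on UNIV f" and g: "continuous_on UNIV g"
    and lim: "\<And>c x y. (\<lambda>_. c) \<in> limit_potentials act v
      \<Longrightarrow> norm ((damp \<epsilon> (\<lambda>_. f c) (\<lambda>_. g c) ^^ K) (delta y) x) < \<eta>"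
    and \<eta>: "0 < \<eta>"
  shows "\<exists>Y. finite Y \<and> (\<forall>x y. x \<notin> Y \<longrightarrow> norm ((damp \<epsilon> (\<lambda>x. f (v x)) (\<lambda>x. g (v x)) ^^ K) (delta y) x) \<le> \<eta>)"
proof -
  let ?T = "damp \<epsilon> (\<lambda>x. f (v x)) (\<lambda>x. g (v x)) ^^ K"
  define R where "R = K * (2 * D)"
  have T: "band R ?T" unfolding R_def using band_funpow[OF band_damp] by blast
  define bad where "bad p = {\<alpha>. \<eta> < norm (?T (delta (act \<alpha> (snd p))) (act \<alpha> (fst p)))}" for p
  have fin: "finite (bad p)" for p
  proof (rule ccontr)
    assume inf: "infinite (bad p)"
    have "\<exists>\<alpha>. \<alpha> \<in> bad p \<and> \<alpha> \<notin> nearorb m 0" for m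
    proof (rule ccontr)
      assume "\<not> ?thesis"
      then have "bad p \<subseteq> nearorb m 0" by blast
      then show False using inf finite_subset[OF _ finite_nearorb] by blast
    qed
    then obtain \<alpha> where \<alpha>: "\<And>m. \<alpha> m \<in> bad p" "\<And>m. \<alpha> m \<notin> nearorb m 0" by metis
    have "bounded (range (\<lambda>m. v (act (\<alpha> m) (fst p))))"
      using v unfolding SO_def by (auto intro: bounded_subset)
    then obtain c r where r: "strict_mono (r :: nat \<Rightarrow> nat)" "((\<lambda>m. v (act (\<alpha> m) (fst p))) \<circ> r) \<longlonglongrightarrow> c"
      using bounded_imp_convergent_subsequence by blast
    have \<alpha>r: "filterlim (\<lambda>m. \<alpha> (r m)) cofinite sequentially"
      by (rule filterlim_compose[OF filterlim_cofinite_nearorb[OF \<alpha>(2)] filterlim_subseq[OF r(1)]])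
    have vc: "(\<lambda>m. v (act (\<alpha> (r m)) y)) \<longlonglongrightarrow> c" for y
      using SO_shift_tendsto[OF v \<alpha>r] r(2) by (simp add: o_def)
    have delta_act: "(\<lambda>y. delta (act \<beta> q) (act \<beta> y)) = delta q" for \<beta> q
      by (simp add: delta_def act_eq_iff fun_eq_iff)
    let ?a = "\<lambda>m y. f (v (act (\<alpha> (r m)) y))" and ?b = "\<lambda>m y. g (v (act (\<alpha> (r m)) y))"
    have "?T (delta (act (\<alpha> (r m)) (snd p))) (act (\<alpha> (r m)) (fst p))
        = (damp \<epsilon> (?a m) (?b m) ^^ K) (delta (snd p)) (fst p)" for m
      unfolding damp_funpow_act delta_act ..
    moreover have "\<eta> < norm (?T (delta (act (\<alpha> (r m)) (snd p))) (act (\<alpha> (r m)) (fst p)))" for m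
      using \<alpha>(1)[of "r m"] by (simp add: bad_def)
    ultimately have gt: "\<eta> < norm ((damp \<epsilon> (?a m) (?b m) ^^ K) (delta (snd p)) (fst p))" for m by simp
    have "(\<lambda>m. (damp \<epsilon> (?a m) (?b m) ^^ K) (delta (snd p)) (fst p))
        \<longlonglongrightarrow> (damp \<epsilon> (\<lambda>_. f c) (\<lambda>_. g c) ^^ K) (delta (snd p)) (fst p)"
      by (intro tendsto_damp_funpow continuous_on_tendsto_compose[OF f vc] continuous_on_tendsto_compose[OF g vc]) auto
    then have "\<eta> \<le> norm ((damp \<epsilon> (\<lambda>_. f c) (\<lambda>_. g c) ^^ K) (delta (snd p)) (fst p))"
      by (intro LIMSEQ_le_const[OF tendsto_norm]) (use gt less_imp_le in blast)+
    moreover have "(\<lambda>_. c) \<in> limit_potentials act v" by (rule limit_potentialsI[OF v \<alpha>r vc])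
    ultimately show False using lim by (meson not_le)
  qed
  define W where "W = Sigma (reps ` {..<N}) (near R)"
  define Y where "Y = (\<Union>p\<in>W. (\<lambda>\<alpha>. act \<alpha> (fst p)) ` bad p)"
  have "finite Y" using fin by (auto simp: Y_def W_def)
  moreover have "norm (?T (delta y) x) \<le> \<eta>" if "x \<notin> Y" for x y
  proof (rule ccontr)
    assume n: "\<not> norm (?T (delta y) x) \<le> \<eta>"
    have near: "y \<in> near R x"
    proof (rule ccontr)
      assume "y \<notin> near R x"
      then have "?T (delta y) x = ?T (\<lambda>_. 0) x" by (intro band_cong[OF T]) (auto simp: delta_def)
      also have "\<dots> = 0" using linear_op_zero[OF band_linear[OF T]] by simp
      finally show False using n \<eta> by simp
    qed
    let ?p = "(reps (idx x), act (- crd x) y)"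
    have "act (- crd x) y \<in> near R (act (- crd x) x)" using near by (simp only: act_near_iff)
    moreover have "act (- crd x) x = reps (idx x)" by (metis act_crd act_uminus_act(1))
    ultimately have "?p \<in> W" by (simp add: W_def)
    moreover have "crd x \<in> bad ?p" using n by (simp add: bad_def)
    ultimately have "x \<in> Y" unfolding Y_def by (intro UN_I[of ?p] image_eqI[of _ _ "crd x"]) auto
    then show False using that by simp
  qed
  ultimately show ?thesis by blast
qed

end

section \<open>Fredholmness outside the bands\<close>

lemma lp_bounded_zero: "lp_bounded p (\<lambda>u x. 0)"
  unfolding lp_bounded_def using lp_finite_support[of "{}" "\<lambda>_. 0" p]
  by (intro exI[of _ 0]) (auto intro: psum_leI)

lemma lp_bounded_sum:
  assumes "0 < p" "\<And>k. lp_bounded p (A k)"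
  shows "lp_bounded p (\<lambda>u x. \<Sum>k<n. A (k :: nat) u x)"
proof (induction n)
  case 0
  then show ?case using lp_bounded_zero by simp
next
  case (Suc n)
  then show ?case using lp_bounded_add[OF Suc assms(2)[of n] assms(1)] by simp
qed

lemma linear_op_comp: "linear_op A \<Longrightarrow> linear_op B \<Longrightarrow> linear_op (\<lambda>u. A (B u))"
  by (simp add: linear_op_def)

lemma linear_op_sum_ops: "(\<And>k. linear_op (A k)) \<Longrightarrow> linear_op (\<lambda>u x. \<Sum>k<n. A k u x)"
  by (simp add: linear_op_def sum.distrib sum_distrib_left)

context periodic
begin

text \<open>Operators with constant potentials commute. Hence the entry bound for
  \<open>B* B\<close> also serves \<open>B B*\<close> at infinity, although the two may differ for
  variable \<open>v\<close>.\<close>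

lemma damp_commute: "damp \<epsilon> (\<lambda>_. \<mu>) (\<lambda>_. \<nu>) = damp \<epsilon> (\<lambda>_. \<nu>) (\<lambda>_. \<mu>)"
proof -
  have "lap (\<lambda>x. lap u x - \<mu> * u x) = (\<lambda>x. lap (lap u) x - \<mu> * lap u x)" for \<mu> u
    using linear_op_diff[OF band_linear[OF band_lap], of "lap u" "\<lambda>x. \<mu> * u x"]
      linear_op_scale[OF band_linear[OF band_lap], of \<mu> u] by simp
  then have "ham (\<lambda>_. \<mu>) (ham (\<lambda>_. \<nu>) u) = ham (\<lambda>_. \<nu>) (ham (\<lambda>_. \<mu>) u)" for u
    by (simp add: ham_def[abs_def] algebra_simps)
  then show ?thesis by (simp add: damp_def[abs_def])
qed

text \<open>The factorization of \<open>I - T ^ K\<close> as \<open>\<Sum>k<K. T ^ k\<close> applied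
  after \<open>I - T\<close>; it produces the left regularizer.\<close>

lemma damp_telescope:
  "(\<Sum>k<K. (damp \<epsilon> a b ^^ k) (\<lambda>y. of_real \<epsilon> * ham a (ham b u) y) x) = u x - (damp \<epsilon> a b ^^ K) u x"
proof -
  let ?T = "damp \<epsilon> a b"
  have "(\<lambda>y. of_real \<epsilon> * ham a (ham b u) y) = (\<lambda>y. u y - ?T u y)" by (simp add: damp_def)
  moreover have "(?T ^^ k) (\<lambda>y. u y - ?T u y) x = (?T ^^ k) u x - (?T ^^ Suc k) u x" for k
    using linear_op_diff[OF band_linear[OF band_funpow[OF band_damp]], of k \<epsilon> a b u "?T u"]
    by (simp add: funpow_swap1)
  ultimately show ?thesis using sum_lessThan_telescope'[of "\<lambda>k. (?T ^^ k) u x" K] by simp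
qed

text \<open>The same factorization with \<open>I - T\<close> applied last, for the right
  regularizer.\<close>

lemma ham_damp_sum:
  "of_real \<epsilon> * ham a (ham b (\<lambda>y. \<Sum>k<K. (damp \<epsilon> a b ^^ k) u y)) x = u x - (damp \<epsilon> a b ^^ K) u x"
proof -
  let ?T = "damp \<epsilon> a b" and ?W = "\<lambda>y. \<Sum>k<K. (damp \<epsilon> a b ^^ k) u y"
  have "of_real \<epsilon> * ham a (ham b ?W) x = ?W x - ?T ?W x" by (simp add: damp_def)
  also have "?T ?W x = (\<Sum>k<K. (?T ^^ Suc k) u x)"
    using linear_op_sum[OF band_linear[OF band_damp], of "{..<K}" \<epsilon> a b "\<lambda>_. 1" "\<lambda>k. (?T ^^ k) u"] by simp
  also have "?W x - (\<Sum>k<K. (?T ^^ Suc k) u x) = u x - (?T ^^ K) u x"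
    unfolding sum_subtractf[symmetric] using sum_lessThan_telescope'[of "\<lambda>k. (?T ^^ k) u x" K] by simp
  finally show ?thesis .
qed

lemma total_deg_ge_1: "1 \<le> total_deg"
proof -
  have "1 \<le> real (deg adj (reps 0))" using deg_pos[of "reps 0"] by linarith
  also have "\<dots> \<le> total_deg"
    unfolding total_deg_def by (rule member_le_sum[where f = "\<lambda>i. real (deg adj (reps i))"]) (use N_pos in auto)
  finally show ?thesis .
qed

lemma ex_power_beats_band:
  assumes "0 \<le> \<theta>" "\<theta> < 1"
  shows "\<exists>K. sqrt (\<theta> ^ K * total_deg) * nnear (K * (2 * D)) ^ 2 < 1 / 4"
proof -
  \<comment> \<open>The box count enters the Schur bound squared, which doubles the polynomial
    degree.\<close>
  let ?n = "2 * CARD('n)"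
  let ?c = "(real N)\<^sup>2 * sqrt total_deg"
  have "(\<lambda>K. ?c * ((real (4 * D) * real K + 1) ^ ?n * sqrt \<theta> ^ K)) \<longlonglongrightarrow> ?c * 0"
    using assms by (intro tendsto_mult tendsto_const linear_power_times_geometric_tendsto_0) auto
  moreover have "sqrt (\<theta> ^ K * total_deg) * nnear (K * (2 * D)) ^ 2
      = ?c * ((real (4 * D) * real K + 1) ^ ?n * sqrt \<theta> ^ K)" for K
  proof -
    have "nnear (K * (2 * D)) = real N * (real (4 * D) * real K + 1) ^ CARD('n)"
      by (simp add: nnear_def algebra_simps)
    moreover have "sqrt (\<theta> ^ K * total_deg) = sqrt \<theta> ^ K * sqrt total_deg"
      by (simp add: real_sqrt_mult real_sqrt_power)
    ultimately show ?thesis by (simp add: power_mult_distrib power_mult[symmetric] mult.commute)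
  qed
  ultimately have "(\<lambda>K. sqrt (\<theta> ^ K * total_deg) * nnear (K * (2 * D)) ^ 2) \<longlonglongrightarrow> 0" by simp
  then have "eventually (\<lambda>K. sqrt (\<theta> ^ K * total_deg) * nnear (K * (2 * D)) ^ 2 < 1 / 4) sequentially"
    by (rule order_tendstoD) simp
  then show ?thesis using eventually_happens by fastforce
qed

lemma fredholm_outside_bands:
  assumes v: "v \<in> SO act" and p: "1 \<le> p"
    and z: "z \<notin> (\<Union>w\<in>limit_potentials act v. band_union adj act N reps w)"
  shows "fredholm_lp p (ham (\<lambda>x. z - v x))"
proof -
  obtain \<delta> where \<delta>: "0 < \<delta>" "\<And>c t u. (\<lambda>_. c) \<in> limit_potentials act v \<Longrightarrow> t \<in> torus \<Longrightarrow> quasi t u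
      \<Longrightarrow> \<delta> * sqnorm_rep u \<le> sqnorm_rep (ham (\<lambda>_. z - c) u)"
    using uniform_lower_bound[OF v z] by blast
  obtain V where V: "\<And>x. norm (v x) \<le> V" using v by (auto simp: SO_def bounded_iff)
  have V_lim: "norm c \<le> V" if "(\<lambda>_. c) \<in> limit_potentials act v" for c
    by (rule norm_limit_potential_le[OF that V])
  define B where "B = norm z + V"
  have B: "0 \<le> B" using order_trans[OF norm_ge_zero V[of undefined]] by (simp add: B_def)
  \<comment> \<open>The largest value that \<open>sqnorm_rep_damp_le\<close> admits for potentials
    bounded by \<open>B\<close>.\<close>
  define \<epsilon> where "\<epsilon> = 1 / (total_deg * (1 + B)\<^sup>2)"
  have \<epsilon>: "0 < \<epsilon>" "\<epsilon> * (total_deg * (1 + B)\<^sup>2) \<le> 1"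
    using total_deg_ge_1 B by (simp_all add: \<epsilon>_def)
  \<comment> \<open>The powers and square roots below call for a nonnegative rate.\<close>
  define \<theta> where "\<theta> = max 0 (1 - \<epsilon> * \<delta>)"
  have \<theta>: "0 \<le> \<theta>" "\<theta> < 1" using \<epsilon>(1) \<delta>(1) by (auto simp: \<theta>_def)
  obtain K where K: "sqrt (\<theta> ^ K * total_deg) * nnear (K * (2 * D)) ^ 2 < 1 / 4"
    using ex_power_beats_band[OF \<theta>] by blast
  define R where "R = K * (2 * D)"
  \<comment> \<open>The entry size at which the Schur test for band width \<open>R\<close> yields
    the factor \<open>1 / 4\<close>.\<close>
  define \<eta> where "\<eta> = 1 / 4 / nnear R ^ 2"
  have nn: "0 < nnear R ^ 2" using nnear_ge_1[of R] by simp
  then have \<eta>: "0 < \<eta>" "sqrt (\<theta> ^ K * total_deg) < \<eta>"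
    using K by (simp_all add: \<eta>_def R_def pos_less_divide_eq)
  have const: "norm ((damp \<epsilon> (\<lambda>_. cnj (z - c)) (\<lambda>_. z - c) ^^ K) (delta y) x) < \<eta>"
    if c: "(\<lambda>_. c) \<in> limit_potentials act v" for c x y
  proof -
    let ?T = "damp \<epsilon> (\<lambda>_. cnj (z - c)) (\<lambda>_. z - c)"
    have nz: "norm (z - c) \<le> B"
      using norm_triangle_ineq4[of z c] V_lim[OF c] by (simp add: B_def)
    have step: "quasi t (?T u) \<and> sqnorm_rep (?T u) \<le> \<theta> * sqnorm_rep u"
      if t: "t \<in> torus" and u: "quasi t u" for t u
    proof
      show "quasi t (?T u)" by (rule quasi_damp[OF u])
      have "sqnorm_rep (?T u) \<le> (1 - \<epsilon> * \<delta>) * sqnorm_rep u"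
        by (rule sqnorm_rep_damp_le[OF u t nz \<delta>(2)[OF c t u] \<epsilon>])
      also have "\<dots> \<le> \<theta> * sqnorm_rep u"
        by (intro mult_right_mono sqnorm_rep_nonneg) (simp add: \<theta>_def)
      finally show "sqnorm_rep (?T u) \<le> \<theta> * sqnorm_rep u" .
    qed
    have "quasi t ((?T ^^ K) u) \<and> sqnorm_rep ((?T ^^ K) u) \<le> \<theta> ^ K * sqnorm_rep u"
      if t: "t \<in> torus" and u: "quasi t u" for t u K
    proof (induction K)
      case 0
      then show ?case using u by simp
    next
      case (Suc K)
      have "sqnorm_rep (?T ((?T ^^ K) u)) \<le> \<theta> * sqnorm_rep ((?T ^^ K) u)" using step[OF t] Suc by blast
      also have "\<dots> \<le> \<theta> * (\<theta> ^ K * sqnorm_rep u)" using Suc \<theta>(1) by (intro mult_left_mono) auto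
      finally show ?case using step[OF t] Suc by (simp add: mult.assoc)
    qed
    then have "norm ((?T ^^ K) (delta y) x) \<le> sqrt (\<theta> ^ K * total_deg)"
      using \<theta>(1) by (intro entry_bound[OF band_funpow[OF band_damp]]) auto
    then show ?thesis using \<eta>(2) by linarith
  qed
  have const': "norm ((damp \<epsilon> (\<lambda>_. z - c) (\<lambda>_. cnj (z - c)) ^^ K) (delta y) x) < \<eta>"
    if "(\<lambda>_. c) \<in> limit_potentials act v" for c x y
    using const[OF that] by (subst damp_commute)
  define a where "a = (\<lambda>x. cnj (z - v x))"
  define b where "b = (\<lambda>x. z - v x)"
  have bdd: "bounded (range a)" "bounded (range b)"
  proof -
    have "norm (z - v x) \<le> B" for x
      using norm_triangle_ineq4[of z "v x"] V[of x] by (simp add: B_def)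
    then show "bounded (range a)" "bounded (range b)"
      unfolding bounded_iff a_def b_def by (auto simp del: complex_cnj_diff intro!: exI[of _ B])
  qed
  have cont: "continuous_on UNIV (\<lambda>s. cnj (z - s))" "continuous_on UNIV (\<lambda>s. z - s)"
    by (intro continuous_intros)+
  obtain Y1 where Y1: "finite Y1" "\<And>x y. x \<notin> Y1 \<Longrightarrow> norm ((damp \<epsilon> a b ^^ K) (delta y) x) \<le> \<eta>"
    using tail_entries_small[OF v cont const \<eta>(1)] unfolding a_def b_def by blast
  obtain Y2 where Y2: "finite Y2" "\<And>x y. x \<notin> Y2 \<Longrightarrow> norm ((damp \<epsilon> b a ^^ K) (delta y) x) \<le> \<eta>"
    using tail_entries_small[OF v cont(2,1) const' \<eta>(1)] unfolding a_def b_def by blast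
  have small: "norm e * nnear R ^ 2 \<le> 1 / 4" if "norm e \<le> \<eta>" for e :: complex
    using that nn by (simp add: \<eta>_def pos_le_divide_eq)
  \<comment> \<open>Composing \<open>ham b\<close> with a left regularizer produces
    \<open>ham a\<close> after \<open>ham b\<close>, with a right one \<open>ham b\<close> after
    \<open>ham a\<close>. This is why the two use different damping operators.\<close>
  define R1 where "R1 u = (\<lambda>x. \<Sum>k<K. (damp \<epsilon> a b ^^ k) (\<lambda>y. of_real \<epsilon> * ham a u y) x)" for u
  define R2 where "R2 u = (\<lambda>x. of_real \<epsilon> * ham a (\<lambda>y. \<Sum>k<K. (damp \<epsilon> b a ^^ k) u y) x)" for u
  have scale: "linear_op (\<lambda>u x. of_real \<epsilon> * u x)" by (simp add: linear_op_def algebra_simps)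
  have p0: "0 < p" using p by simp
  have scale_lp: "lp_bounded p (\<lambda>u x. of_real \<epsilon> * u x)"
    by (rule lp_bounded_mult[OF p0, of _ "\<bar>\<epsilon>\<bar>"]) simp
  have "linear_op R1"
    unfolding R1_def
    by (intro linear_op_sum_ops linear_op_comp[OF band_linear[OF band_funpow[OF band_damp]]]
        linear_op_comp[OF scale band_linear[OF band_ham]])
  moreover have "lp_bounded p R1"
    unfolding R1_def
    by (intro lp_bounded_sum p0 lp_bounded_comp[OF lp_bounded_funpow[OF lp_bounded_damp[OF p bdd]]]
        lp_bounded_comp[OF scale_lp lp_bounded_ham[OF p bdd(1)]])
  moreover have "lp_bounded p R2"
    unfolding R2_def
    by (intro lp_bounded_comp[OF lp_bounded_comp[OF scale_lp lp_bounded_ham[OF p bdd(1)]]]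
        lp_bounded_sum p0 lp_bounded_funpow lp_bounded_damp p bdd)
  moreover have "R1 (ham b u) = (\<lambda>x. u x - (damp \<epsilon> a b ^^ K) u x)" for u
    unfolding R1_def damp_telescope ..
  moreover have "ham b (R2 u) = (\<lambda>x. u x - (damp \<epsilon> b a ^^ K) u x)" for u
    unfolding R2_def linear_op_scale[OF band_linear[OF band_ham]] ham_damp_sum ..
  moreover have "band R (\<lambda>u. (damp \<epsilon> a b ^^ K) u)" "band R (\<lambda>u. (damp \<epsilon> b a ^^ K) u)"
    unfolding R_def by (intro band_funpow band_damp)+
  ultimately have "fredholm_lp p (ham b)"
    using Y1 Y2 small
    by (intro fredholm_lpI[OF p band_ham lp_bounded_ham[OF p bdd(2)], where Y = "Y1 \<union> Y2" and ?R1.0 = R1 and ?R2.0 = R2]) auto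
  then show ?thesis by (simp add: b_def)
qed

end

section \<open>Weyl functions on the bands\<close>

lemma psum_finite_support:
  assumes "finite S" "\<And>x. x \<notin> S \<Longrightarrow> u x = 0"
  shows "psum q u = (\<Sum>x\<in>S. norm (u x) powr q)"
proof -
  have "psum q u = (\<Sum>\<^sub>\<infinity>x\<in>S. norm (u x) powr q)"
    unfolding psum_def by (rule infsum_cong_neutral) (use assms in auto)
  then show ?thesis using assms(1) by simp
qed

lemma psum_scale: "psum q (\<lambda>x. c * u x) = norm c powr q * psum q u"
  unfolding psum_def norm_mult powr_mult by (rule infsum_cmult_right')

text \<open>\<open>e\<close> bounds the \<open>q\<close>-th power of the norm of \<open>A g\<close>.
  Prescribed zeros on \<open>Y\<close> are what later yields disjoint supports.\<close>

definition weyl :: "real \<Rightarrow> (('x \<Rightarrow> complex) \<Rightarrow> 'x \<Rightarrow> complex) \<Rightarrow> 'x set \<Rightarrow> real \<Rightarrow> ('x \<Rightarrow> complex) \<Rightarrow> bool" where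
  "weyl q A Y e g \<longleftrightarrow> finite {x. g x \<noteq> 0} \<and> (\<forall>x\<in>Y. g x = 0) \<and> psum q g = 1 \<and> psum q (A g) \<le> e"

lemma weyl_normalize:
  assumes A: "linear_op A" and q: "0 < q" and e: "0 \<le> e"
    and g: "finite {x. g x \<noteq> 0}" "\<forall>x\<in>Y. g x = 0" "0 < psum q g" "psum q (A g) \<le> e * psum q g"
  shows "\<exists>c. weyl q A Y e (\<lambda>x. c * g x)"
proof
  define c :: complex where "c = of_real (psum q g powr (- 1 / q))"
  have "norm c = psum q g powr (- 1 / q)" unfolding c_def norm_of_real by simp
  then have "norm c powr q = psum q g powr (- 1)" using q by (simp add: powr_powr)
  then have "norm c powr q * psum q g = 1" using g(3) by (simp add: powr_minus)
  moreover from this have "norm c powr q * psum q (A g) \<le> e"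
    using mult_left_mono[OF g(4), of "norm c powr q"] by (simp add: mult.left_commute)
  moreover have "finite {x. c * g x \<noteq> 0}" by (rule finite_subset[OF _ g(1)]) auto
  ultimately show "weyl q A Y e (\<lambda>x. c * g x)"
    using g(2) unfolding weyl_def linear_op_scale[OF A] psum_scale by auto
qed

text \<open>Box counts for radii \<open>s + 2 * D\<close> and \<open>s\<close> are compared with
  that for \<open>s + D\<close>. With \<open>h\<close> the ratio of \<open>2 * D\<close> to the side
  of the middle box, the quotient is \<open>(1 + h) ^ n - (1 - h) ^ n\<close>.\<close>

lemma shell_ratio_tendsto_0:
  fixes D :: nat
  shows "(\<lambda>s. ((2 * real s + 4 * real D + 1) ^ n - (2 * real s + 1) ^ n) / (2 * real s + 2 * real D + 1) ^ n) \<longlonglongrightarrow> 0"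
proof -
  have "(\<lambda>s. 2 * real D / (2 * real s + 2 * real D + 1)) \<longlonglongrightarrow> 0"
  proof (rule Lim_null_comparison)
    show "(\<lambda>s. 2 * real D * inverse (real (Suc s))) \<longlonglongrightarrow> 0"
      using tendsto_mult_right_zero[OF LIMSEQ_inverse_real_of_nat] .
    have "2 * real D / (2 * real s + 2 * real D + 1) \<le> 2 * real D * inverse (real (Suc s))" for s
      unfolding divide_inverse by (intro mult_left_mono le_imp_inverse_le) auto
    then show "\<forall>\<^sub>F s in sequentially. norm (2 * real D / (2 * real s + 2 * real D + 1)) \<le> 2 * real D * inverse (real (Suc s))"
      by simp
  qed
  then have "(\<lambda>s. (1 + 2 * real D / (2 * real s + 2 * real D + 1)) ^ n
      - (1 - 2 * real D / (2 * real s + 2 * real D + 1)) ^ n) \<longlonglongrightarrow> (1 + 0) ^ n - (1 - 0) ^ n"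
    by (intro tendsto_intros)
  moreover have "(1 + 2 * real D / (2 * real s + 2 * real D + 1)) ^ n
      - (1 - 2 * real D / (2 * real s + 2 * real D + 1)) ^ n
      = ((2 * real s + 4 * real D + 1) ^ n - (2 * real s + 1) ^ n) / (2 * real s + 2 * real D + 1) ^ n" for s
  proof -
    have nz: "2 * real s + 2 * real D + 1 \<noteq> 0" by linarith
    have "1 + 2 * real D / (2 * real s + 2 * real D + 1) = (2 * real s + 4 * real D + 1) / (2 * real s + 2 * real D + 1)"
      "1 - 2 * real D / (2 * real s + 2 * real D + 1) = (2 * real s + 1) / (2 * real s + 2 * real D + 1)"
      using nz by (simp_all add: field_simps)
    then show ?thesis by (simp add: power_divide diff_divide_distrib)
  qed
  ultimately show ?thesis by simp
qed

context periodic
begin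

text \<open>Cutting a Bloch wave off sharply at a large box produces an error only on the boundary shell,
  whose size is negligible against the volume of the box.\<close>

lemma ex_weyl:
  assumes w: "(\<lambda>_. c) \<in> limit_potentials act v" and v: "\<And>x. norm (v x) \<le> V"
    and t: "t \<in> torus" and u: "quasi t u" "u x1 \<noteq> 0" "\<And>x. lap u x + c * u x = z * u x"
    and q: "0 < q" and e: "0 < e" and Y: "finite Y"
  shows "\<exists>g. weyl q (ham (\<lambda>x. z - v x)) Y e g"
proof -
  let ?A = "ham (\<lambda>x. z - v x)"
  let ?n = "CARD('n)"
  define U where "U = sqrt (sqnorm_rep u)"
  define u0 where "u0 = norm (u x1)"
  define B where "B = (1 + (norm z + V)) * U"
  have U: "norm (u x) \<le> U" for x
    unfolding U_def using sqnorm_rep_ge[OF u(1) t, of x] by (rule real_le_rsqrt)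
  have u0: "0 < u0" using u(2) by (simp add: u0_def)
  have U0: "0 < U" using less_le_trans[OF u0 U[of x1, folded u0_def]] .
  have N: "0 < real N" using N_pos by simp
  \<comment> \<open>Calibrated so that \<open>real N * (\<eta> * U) powr q\<close> is
    \<open>e / 2 * u0 powr q\<close>: the interior takes half of the allowed error, the shell the
    other half.\<close>
  define \<eta> where "\<eta> = (e / 2 * u0 powr q / real N) powr (1 / q) / U"
  have \<eta>: "0 < \<eta>" "(\<eta> * U) powr q = e / 2 * u0 powr q / real N"
    using e u0 U0 N q by (simp_all add: \<eta>_def powr_powr)
  have "(\<lambda>s. real N * B powr q * (((2 * real s + 4 * real D + 1) ^ ?n - (2 * real s + 1) ^ ?n)
      / (2 * real s + 2 * real D + 1) ^ ?n)) \<longlonglongrightarrow> 0"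
    by (rule tendsto_mult_right_zero[OF shell_ratio_tendsto_0])
  then have "eventually (\<lambda>s. real N * B powr q * (((2 * real s + 4 * real D + 1) ^ ?n - (2 * real s + 1) ^ ?n)
      / (2 * real s + 2 * real D + 1) ^ ?n) < e / 2 * u0 powr q) sequentially"
    by (rule order_tendstoD) (use e u0 in simp)
  then obtain s where s: "real N * B powr q * (((2 * real s + 4 * real D + 1) ^ ?n - (2 * real s + 1) ^ ?n)
      / (2 * real s + 2 * real D + 1) ^ ?n) < e / 2 * u0 powr q"
    using eventually_happens by fastforce
  define vol where "vol = (2 * real s + 2 * real D + 1) ^ ?n"
  have vol: "0 < vol" unfolding vol_def by (intro zero_less_power) simp
  \<comment> \<open>The radius \<open>s\<close> is fixed before the centre: for a given box there is
    a translate that avoids \<open>Y\<close> and on which \<open>v\<close> is uniformly close to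
    \<open>c\<close>.\<close>
  obtain h :: "nat \<Rightarrow> 'n \<Rightarrow> int" where h: "filterlim h cofinite sequentially"
    and hl: "\<forall>x. (\<lambda>m. v (act (h m) x)) \<longlonglongrightarrow> c"
    using w unfolding limit_potentials_def by blast
  have "eventually (\<lambda>m. \<forall>x\<in>near s (reps 0). norm (v (act (h m) x) - c) < \<eta>) sequentially"
    using tendstoD[OF hl[rule_format] \<eta>(1)] by (simp add: eventually_ball_finite dist_norm)
  moreover have "eventually (\<lambda>m. \<forall>y\<in>Y. y \<notin> near (s + D) (act (h m) (reps 0))) sequentially"
  proof (rule eventually_ball_finite[OF Y], rule ballI)
    fix y assume "y \<in> Y"
    have "finite {\<alpha>. y \<in> near (s + D) (act \<alpha> (reps 0))}"
    proof (rule finite_subset)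
      show "{\<alpha>. y \<in> near (s + D) (act \<alpha> (reps 0))} \<subseteq> crd ` near (s + D) y"
        using N_pos by (auto simp: near_sym[of y] intro!: image_eqI[of _ _ "act _ (reps 0)"])
    qed simp
    then have "eventually (\<lambda>\<alpha>. y \<notin> near (s + D) (act \<alpha> (reps 0))) cofinite"
      by (simp add: eventually_cofinite)
    then show "eventually (\<lambda>m. y \<notin> near (s + D) (act (h m) (reps 0))) sequentially"
      using h unfolding filterlim_iff by blast
  qed
  ultimately have "eventually (\<lambda>m. (\<forall>x\<in>near s (reps 0). norm (v (act (h m) x) - c) < \<eta>)
      \<and> (\<forall>y\<in>Y. y \<notin> near (s + D) (act (h m) (reps 0)))) sequentially"
    by eventually_elim simp
  then obtain m where m: "\<forall>x\<in>near s (reps 0). norm (v (act (h m) x) - c) < \<eta>"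
      "\<forall>y\<in>Y. y \<notin> near (s + D) (act (h m) (reps 0))"
    using eventually_happens by fastforce
  define b where "b = act (h m) (reps 0)"
  have small: "norm (v x - c) < \<eta>" if "x \<in> near s b" for x
    using that m(1) unfolding b_def near_act by blast
  \<comment> \<open>Cutting at \<open>s + D\<close> leaves \<open>?A g\<close> equal to
    \<open>?A u\<close> within radius \<open>s\<close> and zero beyond \<open>s + 2 * D\<close>; the
    truncation error sits in between.\<close>
  define g where "g x = (if x \<in> near (s + D) b then u x else 0)" for x
  have fin: "finite {x. g x \<noteq> 0}" by (rule finite_subset[of _ "near (s + D) b"]) (auto simp: g_def)
  have gY: "\<forall>x\<in>Y. g x = 0" using m(2) by (simp add: g_def b_def)
  \<comment> \<open>Only the orbit of \<open>x1\<close> is counted: it has one vertex per lattice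
    point of the box, and the modulus of \<open>u\<close> is \<open>u0\<close> on all of it.\<close>
  have psg: "vol * u0 powr q \<le> psum q g"
  proof -
    define orb where "orb = (\<lambda>\<gamma>. act \<gamma> (reps (idx x1))) ` nearorb (s + D) (crd b)"
    have sub: "orb \<subseteq> near (s + D) b" by (auto simp: orb_def near_def nearorb_def)
    have "card orb = card (nearorb (s + D) (crd b))"
      unfolding orb_def by (rule card_image) (auto simp: inj_on_def dest: act_left_cancel)
    then have card: "real (card orb) = vol" by (simp add: card_nearorb vol_def add_ac)
    have "norm (g x) = u0" if "x \<in> orb" for x
    proof -
      have "idx x = idx x1" using that by (auto simp: orb_def)
      then have "norm (u x) = u0"
        unfolding u0_def by (simp add: norm_quasi_rep[OF u(1) t, of x] norm_quasi_rep[OF u(1) t, of x1])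
      then show ?thesis using that sub by (auto simp: g_def)
    qed
    then have "(\<Sum>x\<in>orb. norm (g x) powr q) = vol * u0 powr q" by (simp add: card)
    moreover have "(\<Sum>x\<in>orb. norm (g x) powr q) \<le> psum q g"
    proof (rule sum_le_psum)
      show "g \<in> lp q" by (rule lp_finite_support[OF fin]) simp
      show "finite orb" using finite_subset[OF sub] by simp
    qed
    ultimately show ?thesis by simp
  qed
  then have psg0: "0 < psum q g" using vol u0 by (smt (verit) mult_pos_pos powr_gt_zero)
  have inner: "norm (?A g x) \<le> \<eta> * U" if x: "x \<in> near s b" for x
  proof -
    have "?A g x = ?A u x"
      by (rule band_cong[OF band_ham]) (use x near_trans in \<open>auto simp: g_def\<close>)
    also have "\<dots> = (v x - c) * u x" using u(3)[of x] by (simp add: ham_def algebra_simps)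
    finally show ?thesis
      using small[OF x] U \<eta>(1) by (simp add: norm_mult mult_mono less_imp_le)
  qed
  have outer: "?A g x = 0" if x: "x \<notin> near (s + 2 * D) b" for x
  proof -
    have "?A g x = ?A (\<lambda>_. 0) x"
    proof (rule band_cong[OF band_ham])
      fix y assume "y \<in> near D x"
      then have "x \<in> near D y" by (simp add: near_sym[of y])
      then have "y \<notin> near (s + D) b" using near_trans[of y "s + D" b x D] x by (auto simp: mult_2 add.assoc)
      then show "g y = 0" by (simp add: g_def)
    qed
    then show ?thesis using linear_op_zero[OF band_linear[OF band_ham]] by simp
  qed
  have shell: "norm (?A g x) \<le> B" for x
  proof -
    have g_le: "norm (g y) \<le> U" for y using U[of y] U0 by (simp add: g_def)
    have "norm (?A g x) \<le> norm (lap g x) + norm ((z - v x) * g x)"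
      unfolding ham_def by (rule norm_triangle_ineq4)
    also have "\<dots> \<le> U + (norm z + V) * U"
      unfolding norm_mult using g_le norm_triangle_ineq4[of z "v x"] v[of x] order_trans[OF norm_ge_zero v[of x]]
      by (intro add_mono norm_lap_le mult_mono) auto
    finally show ?thesis by (simp add: B_def algebra_simps)
  qed
  have sub: "near s b \<subseteq> near (s + 2 * D) b" by (rule near_mono) simp
  have "psum q (?A g) = (\<Sum>x\<in>near (s + 2 * D) b. norm (?A g x) powr q)"
    by (rule psum_finite_support) (use outer in auto)
  also have "\<dots> = (\<Sum>x\<in>near (s + 2 * D) b - near s b. norm (?A g x) powr q) + (\<Sum>x\<in>near s b. norm (?A g x) powr q)"
    by (rule sum.subset_diff[OF sub]) simp
  also have "\<dots> \<le> (\<Sum>x\<in>near (s + 2 * D) b - near s b. B powr q) + (\<Sum>x\<in>near s b. (\<eta> * U) powr q)"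
    using inner shell q by (intro add_mono sum_mono powr_mono2) auto
  also have "\<dots> = (real (card (near (s + 2 * D) b)) - real (card (near s b))) * B powr q
      + real (card (near s b)) * (\<eta> * U) powr q"
    by (simp add: card_Diff_subset[OF _ sub] of_nat_diff[OF card_mono[OF _ sub]])
  also have "\<dots> \<le> vol * (e / 2 * u0 powr q) + vol * (e / 2 * u0 powr q)"
  proof (rule add_mono)
    have "(real (card (near (s + 2 * D) b)) - real (card (near s b))) * B powr q
        = vol * (real N * B powr q * (((2 * real s + 4 * real D + 1) ^ ?n - (2 * real s + 1) ^ ?n) / vol))"
      using vol by (simp add: card_near field_simps)
    also have "\<dots> \<le> vol * (e / 2 * u0 powr q)"
      using s vol by (intro mult_left_mono) (auto simp: vol_def)
    finally show "(real (card (near (s + 2 * D) b)) - real (card (near s b))) * B powr q \<le> vol * (e / 2 * u0 powr q)" .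
    have "real (card (near s b)) * (\<eta> * U) powr q = (2 * real s + 1) ^ ?n * (e / 2 * u0 powr q)"
      unfolding \<eta>(2) using N by (simp add: card_near add.commute)
    also have "\<dots> \<le> vol * (e / 2 * u0 powr q)"
      unfolding vol_def using e by (intro mult_right_mono power_mono) auto
    finally show "real (card (near s b)) * (\<eta> * U) powr q \<le> vol * (e / 2 * u0 powr q)" .
  qed
  also have "\<dots> = e * (vol * u0 powr q)" by simp
  also have "\<dots> \<le> e * psum q g" using psg e by (intro mult_left_mono) auto
  finally have "psum q (?A g) \<le> e * psum q g" .
  then show ?thesis
    using weyl_normalize[OF band_linear[OF band_ham] q _ fin gY psg0] e by (metis less_imp_le)
qed

text \<open>Bilinear, without conjugation, so that \<open>ham a\<close> is its own transpose for
  complex \<open>a\<close> as well. For finitely supported \<open>g\<close> it is a finite sum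
  whatever \<open>f\<close> is.\<close>

definition pairing :: "('x \<Rightarrow> complex) \<Rightarrow> ('x \<Rightarrow> complex) \<Rightarrow> complex" where
  "pairing g f = (\<Sum>x\<in>{x. g x \<noteq> 0}. of_nat (deg adj x) * g x * f x)"

lemma pairing_superset:
  assumes "finite S" "{x. g x \<noteq> 0} \<subseteq> S"
  shows "pairing g f = (\<Sum>x\<in>S. of_nat (deg adj x) * g x * f x)"
  unfolding pairing_def by (rule sum.mono_neutral_left) (use assms in auto)

lemma pairing_add_right: "pairing g (\<lambda>x. f x + h x) = pairing g f + pairing g h"
  by (simp add: pairing_def sum.distrib distrib_left)

lemma pairing_lin_comb:
  assumes "finite F" "\<And>f. f \<in> F \<Longrightarrow> pairing g f = 0" "h \<in> lin_comb F"
  shows "pairing g h = 0"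
proof -
  obtain c where "h = (\<lambda>x. \<Sum>f\<in>F. c f * f x)" using assms(3) by (auto simp: lin_comb_def)
  then have "pairing g h = (\<Sum>x\<in>{x. g x \<noteq> 0}. \<Sum>f\<in>F. c f * (of_nat (deg adj x) * g x * f x))"
    by (simp add: pairing_def sum_distrib_left mult.left_commute)
  also have "\<dots> = (\<Sum>f\<in>F. c f * pairing g f)"
    unfolding pairing_def sum_distrib_left by (rule sum.swap)
  finally show ?thesis using assms(2) by simp
qed

text \<open>Two Weyl functions with disjoint supports can be combined so as to annihilate one more
  functional. Disjointness makes \<open>psum\<close> additive, so the combination does not
  degenerate and can be normalised. The second function must avoid the support of the first, hence
  \<open>Y\<close> is arbitrary in the induction.\<close>

lemma ex_weyl_annihilating:
  assumes A: "linear_op A" "lp_bounded q A" and q: "1 \<le> q"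
    and ex: "\<And>Y e. finite Y \<Longrightarrow> 0 < e \<Longrightarrow> \<exists>g. weyl q A Y e g"
    and F: "finite F" and Y: "finite Y" and e: "0 < e"
  shows "\<exists>g. weyl q A Y e g \<and> (\<forall>f\<in>F. pairing g f = 0)"
  using F Y e
proof (induction F arbitrary: Y e rule: finite_induct)
  case empty
  then show ?case using ex by simp
next
  case (insert f F)
  have q0: "0 < q" using q by simp
  \<comment> \<open>Compensates the factor \<open>2 powr q\<close> in
    \<open>psum_add\<close>.\<close>
  define e' where "e' = e / 2 powr q"
  have e': "0 < e'" using insert.prems by (simp add: e'_def)
  obtain g0 where g0: "weyl q A Y e' g0" "\<forall>f\<in>F. pairing g0 f = 0"
    using insert.IH[OF insert.prems(1) e'] by blast
  define S0 where "S0 = {x. g0 x \<noteq> 0}"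
  have S0: "finite S0" using g0 by (simp add: weyl_def S0_def)
  obtain g1 where g1: "weyl q A (Y \<union> S0) e' g1" "\<forall>f\<in>F. pairing g1 f = 0"
    using insert.IH[of "Y \<union> S0" e'] insert.prems(1) S0 e' by auto
  define S1 where "S1 = {x. g1 x \<noteq> 0}"
  have S1: "finite S1" using g1 by (simp add: weyl_def S1_def)
  have disj: "S0 \<inter> S1 = {}" using g1(1) by (auto simp: weyl_def S1_def)
  have z0: "g0 x = 0" if "x \<in> S1" for x using disj that by (auto simp: S0_def)
  have z1: "g1 x = 0" if "x \<in> S0" for x using disj that by (auto simp: S1_def)
  show ?case
  proof (cases "pairing g0 f = 0")
    case True
    have "e' \<le> e" unfolding e'_def
      using insert.prems(2) q by (simp add: divide_le_eq ge_one_powr_ge_zero)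
    then have "weyl q A Y e g0" using g0(1) unfolding weyl_def by linarith
    then show ?thesis using g0(2) True by auto
  next
    case False
    \<comment> \<open>These coefficients cancel the pairing with \<open>f\<close>; \<open>b\<close>
      is nonzero in this case, so \<open>h\<close> does not vanish.\<close>
    define a where "a = pairing g1 f"
    define b where "b = - pairing g0 f"
    define h where "h = (\<lambda>x. a * g0 x + b * g1 x)"
    have S: "finite (S0 \<union> S1)" using S0 S1 by simp
    have supp: "{x. h x \<noteq> 0} \<subseteq> S0 \<union> S1" by (auto simp: h_def S0_def S1_def)
    have psh: "psum q h = norm a powr q + norm b powr q"
    proof -
      have "psum q h = (\<Sum>x\<in>S0 \<union> S1. norm (h x) powr q)"
        by (rule psum_finite_support[OF S]) (use supp in auto)
      also have "\<dots> = (\<Sum>x\<in>S0. norm (h x) powr q) + (\<Sum>x\<in>S1. norm (h x) powr q)"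
        by (rule sum.union_disjoint[OF S0 S1 disj])
      also have "(\<Sum>x\<in>S0. norm (h x) powr q) = (\<Sum>x\<in>S0. norm a powr q * norm (g0 x) powr q)"
        using z1 by (intro sum.cong refl) (simp add: h_def norm_mult powr_mult)
      also have "\<dots> = norm a powr q * psum q g0"
        using psum_finite_support[OF S0, of g0 q] by (simp add: S0_def sum_distrib_left)
      also have "(\<Sum>x\<in>S1. norm (h x) powr q) = (\<Sum>x\<in>S1. norm b powr q * norm (g1 x) powr q)"
        using z0 by (intro sum.cong refl) (simp add: h_def norm_mult powr_mult)
      also have "\<dots> = norm b powr q * psum q g1"
        using psum_finite_support[OF S1, of g1 q] by (simp add: S1_def sum_distrib_left)
      finally show ?thesis using g0(1) g1(1) by (simp add: weyl_def)
    qed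
    have pos: "0 < psum q h" unfolding psh using False by (simp add: b_def add_nonneg_pos)
    have lp: "A g0 \<in> lp q" "A g1 \<in> lp q"
      using lp_boundedD[OF A(2)] lp_finite_support[OF S0, of g0 q] lp_finite_support[OF S1, of g1 q]
      by (simp_all add: S0_def S1_def)
    have "psum q (A h) \<le> 2 powr q * (psum q (\<lambda>x. a * A g0 x) + psum q (\<lambda>x. b * A g1 x))"
      unfolding h_def linear_opD[OF A(1)] by (intro psum_add lp_scale lp q0)
    also have "\<dots> \<le> 2 powr q * (norm a powr q * e' + norm b powr q * e')"
      unfolding psum_scale using g0(1) g1(1) by (intro mult_left_mono add_mono) (auto simp: weyl_def)
    also have "\<dots> = e * psum q h" by (simp add: psh e'_def algebra_simps add_divide_distrib)
    finally have "psum q (A h) \<le> e * psum q h" .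
    moreover have "\<forall>x\<in>Y. h x = 0" using g0(1) g1(1) by (simp add: h_def weyl_def)
    ultimately obtain k where k: "weyl q A Y e (\<lambda>x. k * h x)"
      using weyl_normalize[OF A(1) q0 _ finite_subset[OF supp S] _ pos] insert.prems(2) by (meson less_imp_le)
    have "pairing (\<lambda>x. k * h x) f' = k * (a * pairing g0 f' + b * pairing g1 f')" for f'
    proof -
      have "pairing (\<lambda>x. k * h x) f' = (\<Sum>x\<in>S0 \<union> S1. of_nat (deg adj x) * (k * h x) * f' x)"
        by (rule pairing_superset[OF S]) (use supp in auto)
      moreover have "pairing g0 f' = (\<Sum>x\<in>S0 \<union> S1. of_nat (deg adj x) * g0 x * f' x)"
        by (rule pairing_superset[OF S]) (auto simp: S0_def)
      moreover have "pairing g1 f' = (\<Sum>x\<in>S0 \<union> S1. of_nat (deg adj x) * g1 x * f' x)"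
        by (rule pairing_superset[OF S]) (auto simp: S1_def)
      ultimately show ?thesis
        by (simp only: h_def sum_distrib_left sum.distrib[symmetric]) (simp add: algebra_simps)
    qed
    then have "\<forall>f'\<in>insert f F. pairing (\<lambda>x. k * h x) f' = 0"
      using g0(2) g1(2) by (simp add: a_def b_def)
    then show ?thesis using k by blast
  qed
qed

text \<open>With the weight, the Laplacian becomes a sum over edges that is symmetric in the end
  points. \<open>S\<close> contains the support of \<open>g\<close> and all its neighbours, so
  interchanging the sums over \<open>S\<close> loses no term.\<close>

lemma pairing_ham:
  assumes fin: "finite {x. g x \<noteq> 0}"
  defines "S \<equiv> \<Union>x\<in>{x. g x \<noteq> 0}. near D x"
  shows "pairing g (ham a y) = (\<Sum>x\<in>S. of_nat (deg adj x) * ham a g x * y x)"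
proof -
  have S: "finite S" using fin by (simp add: S_def)
  have sub: "{x. g x \<noteq> 0} \<subseteq> S" by (auto simp: S_def intro: near_self)
  have deg_lap: "of_nat (deg adj x) * lap f x = (\<Sum>y\<in>nbrs adj x. f y)" for f x
    using deg_pos[of x] by (simp add: lap_def)
  have "(\<Sum>x\<in>S. g x * (\<Sum>y'\<in>nbrs adj x. y y')) = (\<Sum>x\<in>S. \<Sum>y'\<in>{y'\<in>S. adj x y'}. g x * y y')"
  proof (rule sum.cong[OF refl])
    fix x
    show "g x * (\<Sum>y'\<in>nbrs adj x. y y') = (\<Sum>y'\<in>{y'\<in>S. adj x y'}. g x * y y')"
    proof (cases "g x = 0")
      case False
      then have "nbrs adj x = {y'\<in>S. adj x y'}" using nbrs_near by (auto simp: S_def nbrs_def)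
      then show ?thesis by (simp add: sum_distrib_left)
    qed simp
  qed
  also have "\<dots> = (\<Sum>y'\<in>S. \<Sum>x\<in>{x\<in>S. adj x y'}. g x * y y')" by (rule sum.swap_restrict[OF S S])
  also have "\<dots> = (\<Sum>y'\<in>S. (\<Sum>x\<in>nbrs adj y'. g x) * y y')"
  proof (rule sum.cong[OF refl])
    fix y'
    have "(\<Sum>x\<in>{x\<in>S. adj x y'}. g x) = (\<Sum>x\<in>nbrs adj y'. g x)"
      using sub adj_sym by (intro sum.mono_neutral_left) (auto simp: nbrs_def[symmetric], auto simp: nbrs_def)
    then show "(\<Sum>x\<in>{x\<in>S. adj x y'}. g x * y y') = (\<Sum>x\<in>nbrs adj y'. g x) * y y'"
      by (simp only: sum_distrib_right[symmetric])
  qed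
  finally have lap_sym: "(\<Sum>x\<in>S. g x * (\<Sum>y'\<in>nbrs adj x. y y')) = (\<Sum>x\<in>S. (\<Sum>x'\<in>nbrs adj x. g x') * y x)" .
  have "pairing g (ham a y) = (\<Sum>x\<in>S. g x * (of_nat (deg adj x) * lap y x) - of_nat (deg adj x) * (a x * g x * y x))"
    unfolding pairing_superset[OF S sub] ham_def by (intro sum.cong refl) (simp add: algebra_simps)
  also have "\<dots> = (\<Sum>x\<in>S. (of_nat (deg adj x) * lap g x) * y x - of_nat (deg adj x) * (a x * g x * y x))"
    unfolding sum_subtractf deg_lap lap_sym ..
  also have "\<dots> = (\<Sum>x\<in>S. of_nat (deg adj x) * ham a g x * y x)"
    unfolding ham_def by (intro sum.cong refl) (simp add: algebra_simps)
  finally show ?thesis .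
qed

lemma deg_le_total: "real (deg adj x) \<le> total_deg"
proof -
  have "real (deg adj (reps (idx x))) \<le> total_deg"
    unfolding total_deg_def by (rule member_le_sum[where f = "\<lambda>i. real (deg adj (reps i))"]) auto
  then show ?thesis by (simp add: deg_reps_idx)
qed

text \<open>Gliding hump: if the range had finite codimension, normalised Weyl functions annihilating a complement
  would pair with any \<open>f\<close> in \<open>lp p\<close> as \<open>O(8 ^ - m)\<close>, but a suitable \<open>f\<close> pairs as \<open>2 ^ - m\<close>.\<close>

lemma not_fredholm_lpI:
  fixes a :: "'x \<Rightarrow> complex"
  assumes p: "1 < p" and q: "q = p / (p - 1)" and bdd: "bounded (range a)"
    and ex: "\<And>Y e. finite Y \<Longrightarrow> 0 < e \<Longrightarrow> \<exists>g. weyl q (ham a) Y e g"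
  shows "\<not> fredholm_lp p (ham a)"
proof
  assume "fredholm_lp p (ham a)"
  then obtain F where F: "finite F"
    "lp p \<subseteq> {(\<lambda>x. r x + c x) | r c. r \<in> ham a ` lp p \<and> c \<in> lin_comb F}"
    unfolding fredholm_lp_def by blast
  have q1: "1 < q" using p by (simp add: q pos_less_divide_eq)
  have conj: "1 / p + 1 / q = 1" using p by (simp add: q field_simps)
  have qp: "(q - 1) * p = q" using p by (simp add: q field_simps)
  \<comment> \<open>The base 8 has to exceed the base 2 that weights \<open>f\<close> below; their
    quotient 4 gives the contradictory growth.\<close>
  have "\<exists>g. weyl q (ham a) Y ((1 / 8 ^ m) powr q) g \<and> (\<forall>f\<in>F. pairing g f = 0)" if "finite Y" for Y and m :: nat
    by (rule ex_weyl_annihilating[OF band_linear[OF band_ham] lp_bounded_ham[OF _ bdd] _ ex F(1) that]) (use q1 in auto)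
  then have "\<forall>Y m. \<exists>g. finite Y \<longrightarrow> weyl q (ham a) Y ((1 / 8 ^ m) powr q) g \<and> (\<forall>f\<in>F. pairing g f = 0)" by blast
  then obtain G where G: "\<And>Y m. finite Y \<Longrightarrow> weyl q (ham a) Y ((1 / 8 ^ m) powr q) (G Y m) \<and> (\<forall>f\<in>F. pairing (G Y m) f = 0)"
    by metis
  \<comment> \<open>\<open>Ys m\<close> collects the supports of the functions chosen so far, where
    the next one has to vanish.\<close>
  define Ys where "Ys = rec_nat {} (\<lambda>m Y. Y \<union> {x. G Y m x \<noteq> 0})"
  have Ys: "Ys 0 = {}" "\<And>m. Ys (Suc m) = Ys m \<union> {x. G (Ys m) m x \<noteq> 0}" by (simp_all add: Ys_def)
  have finY: "finite (Ys m)" for m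
    by (induction m) (use G in \<open>auto simp: Ys weyl_def\<close>)
  define g where "g m = G (Ys m) m" for m
  have W: "weyl q (ham a) (Ys m) ((1 / 8 ^ m) powr q) (g m)" "\<And>f. f \<in> F \<Longrightarrow> pairing (g m) f = 0" for m
    using G[OF finY, of m m] by (auto simp: g_def)
  have g_fin: "finite {x. g m x \<noteq> 0}" and g_psum: "psum q (g m) = 1" for m
    using W(1)[of m] by (simp_all add: weyl_def)
  have g_lp: "g m \<in> lp q" for m by (rule lp_finite_support[OF g_fin]) simp
  have mono: "Ys m \<subseteq> Ys m'" if "m \<le> m'" for m m'
    using that by (rule lift_Suc_mono_le[rotated]) (auto simp: Ys)
  have disj: "m = m'" if "g m x \<noteq> 0" "g m' x \<noteq> 0" for m m' x
  proof -
    have False if "k < k'" "g k x \<noteq> 0" "g k' x \<noteq> 0" for k k'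
    proof -
      have "x \<in> Ys (Suc k)" using that(2) by (simp add: Ys g_def)
      then have "x \<in> Ys k'" using mono[of "Suc k" k'] that(1) by auto
      then show False using W(1)[of k'] that(3) by (simp add: weyl_def)
    qed
    then show ?thesis using that by (metis linorder_neqE_nat)
  qed
  \<comment> \<open>The usual duality map, with the degree divided out so that \<open>g m\<close>
    and \<open>h m\<close> pair to \<open>norm (g m x) powr q\<close> at each vertex. The exponent
    \<open>q - 2\<close> may be negative; at zeros of \<open>g m\<close> the factor
    \<open>cnj (g m x)\<close> makes the product 0.\<close>
  define h where "h m x = cnj (g m x) * of_real (norm (g m x) powr (q - 2)) / of_nat (deg adj x)" for m x
  \<comment> \<open>By disjointness of the supports at most one summand is present at each
    \<open>x\<close>.\<close>
  define f where "f x = (\<Sum>m | g m x \<noteq> 0. of_real ((1 / 2) ^ m) * h m x)" for x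
  have f_eq: "f x = of_real ((1 / 2) ^ m) * h m x" if "g m x \<noteq> 0" for m x
  proof -
    have "{m. g m x \<noteq> 0} = {m}" using disj that by blast
    then show ?thesis by (simp add: f_def)
  qed
  have g_h: "of_nat (deg adj x) * g m x * h m x = of_real (norm (g m x) powr q)" for m x
  proof (cases "g m x = 0")
    case False
    have "of_nat (deg adj x) * g m x * h m x = (g m x * cnj (g m x)) * of_real (norm (g m x) powr (q - 2))"
      by (simp add: h_def less_imp_neq[OF deg_pos, symmetric])
    also have "\<dots> = of_real (norm (g m x) powr 2 * norm (g m x) powr (q - 2))"
      using False by (simp add: complex_norm_square[symmetric])
    also have "norm (g m x) powr 2 * norm (g m x) powr (q - 2) = norm (g m x) powr q"
      unfolding powr_add[symmetric] by simp
    finally show ?thesis .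
  qed simp
  have norm_h: "norm (h m x) powr p \<le> norm (g m x) powr q" if "g m x \<noteq> 0" for m x
  proof -
    have d: "1 \<le> real (deg adj x)" using deg_pos[of x] by linarith
    have "norm (h m x) = norm (g m x) powr 1 * norm (g m x) powr (q - 2) / real (deg adj x)"
      using that by (simp add: h_def norm_mult norm_divide)
    also have "\<dots> = norm (g m x) powr (q - 1) / real (deg adj x)"
      unfolding powr_add[symmetric] by simp
    also have "\<dots> \<le> norm (g m x) powr (q - 1)"
      using d by (simp add: divide_le_eq mult_le_cancel_left1)
    finally have "norm (h m x) powr p \<le> (norm (g m x) powr (q - 1)) powr p"
      using p by (intro powr_mono2) auto
    then show ?thesis by (simp add: powr_powr qp)
  qed
  have "f \<in> lp p"
  proof (rule lpI)
    fix X :: "'x set" assume X: "finite X"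
    have "finite {m. g m x \<noteq> 0}" for x
    proof (cases "\<exists>m. g m x \<noteq> 0")
      case True
      then obtain m where "{m. g m x \<noteq> 0} \<subseteq> {m}" using disj by blast
      then show ?thesis by (rule finite_subset) simp
    qed simp
    then have "finite (\<Union>x\<in>X. {m. g m x \<noteq> 0})" using X by blast
    then obtain M where M: "\<And>x m. x \<in> X \<Longrightarrow> g m x \<noteq> 0 \<Longrightarrow> m < M"
      unfolding finite_nat_set_iff_bounded by blast
    have "norm (f x) powr p \<le> (\<Sum>m<M. (1 / 2) ^ m * norm (g m x) powr q)" if x: "x \<in> X" for x
    proof (cases "\<exists>m. g m x \<noteq> 0")
      case True
      then obtain m where m: "g m x \<noteq> 0" by blast
      have "norm (f x) powr p = ((1 / 2) ^ m) powr p * norm (h m x) powr p"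
        by (simp add: f_eq[OF m] norm_mult norm_power powr_mult)
      also have "\<dots> \<le> (1 / 2) ^ m * norm (g m x) powr q"
      proof (intro mult_mono norm_h m)
        have "((1 / 2) ^ m) powr p \<le> ((1 / 2 :: real) ^ m) powr 1"
          using p by (intro powr_mono') (auto simp: power_le_one)
        then show "((1 / 2) ^ m) powr p \<le> (1 / 2 :: real) ^ m" by simp
      qed auto
      also have "\<dots> \<le> (\<Sum>m<M. (1 / 2) ^ m * norm (g m x) powr q)"
        by (rule member_le_sum[where f = "\<lambda>m. (1 / 2) ^ m * norm (g m x) powr q"]) (use M[OF x m] in auto)
      finally show ?thesis .
    next
      case False
      then show ?thesis by (simp add: f_def)
    qed
    then have "(\<Sum>x\<in>X. norm (f x) powr p) \<le> (\<Sum>x\<in>X. \<Sum>m<M. (1 / 2) ^ m * norm (g m x) powr q)"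
      by (rule sum_mono)
    also have "\<dots> = (\<Sum>m<M. (1 / 2) ^ m * (\<Sum>x\<in>X. norm (g m x) powr q))"
      unfolding sum_distrib_left by (rule sum.swap)
    also have "\<dots> \<le> (\<Sum>m<M. (1 / 2) ^ m * 1)"
    proof (rule sum_mono)
      fix m
      show "(1 / 2) ^ m * (\<Sum>x\<in>X. norm (g m x) powr q) \<le> (1 / 2) ^ m * 1"
        using sum_le_psum[OF g_lp X, of m] by (intro mult_left_mono) (simp_all add: g_psum)
    qed
    also have "\<dots> \<le> 2" by (simp add: sum_gp_strict)
    finally show "(\<Sum>x\<in>X. norm (f x) powr p) \<le> 2" .
  qed
  then obtain y c where y: "y \<in> lp p" "c \<in> lin_comb F" "f = (\<lambda>x. ham a y x + c x)" using F(2) by blast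
  define C where "C = total_deg * (1 + psum p y)"
  have bound: "4 ^ m \<le> C" for m :: nat
  proof -
    define S where "S = (\<Union>x\<in>{x. g m x \<noteq> 0}. near D x)"
    have S: "finite S" using g_fin by (simp add: S_def)
    have "pairing (g m) f = (\<Sum>x\<in>{x. g m x \<noteq> 0}. of_real ((1 / 2) ^ m) * (of_nat (deg adj x) * g m x * h m x))"
      unfolding pairing_def by (intro sum.cong refl) (simp add: f_eq)
    also have "\<dots> = of_real ((1 / 2) ^ m * (\<Sum>x\<in>{x. g m x \<noteq> 0}. norm (g m x) powr q))"
      unfolding g_h by (simp add: sum_distrib_left)
    also have "(\<Sum>x\<in>{x. g m x \<noteq> 0}. norm (g m x) powr q) = psum q (g m)"
      by (rule psum_finite_support[symmetric, OF g_fin]) simp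
    also have "psum q (g m) = 1" by (rule g_psum)
    finally have "pairing (g m) f = of_real ((1 / 2) ^ m)" by simp
    moreover have "pairing (g m) f = pairing (g m) (ham a y)"
      unfolding y(3) pairing_add_right using pairing_lin_comb[OF F(1) W(2) y(2)] by simp
    ultimately have "(1 / 2) ^ m = norm (pairing (g m) (ham a y))" by (metis norm_of_real abs_of_nonneg zero_le_power zero_le_divide_1_iff zero_le_numeral)
    also have "\<dots> \<le> (\<Sum>x\<in>S. norm (of_nat (deg adj x) * ham a (g m) x * y x))"
      unfolding pairing_ham[OF g_fin] S_def[symmetric] by (rule norm_sum)
    also have "\<dots> \<le> (\<Sum>x\<in>S. total_deg * ((1 / 8) ^ m * ((8 ^ m) powr q * norm (ham a (g m) x) powr q + norm (y x) powr p)))"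
    proof (rule sum_mono)
      fix x
      \<comment> \<open>Scaling by \<open>8 ^ m\<close> before Young's inequality brings
        \<open>ham a (g m)\<close> to norm at most 1, so the sums stay bounded while
        \<open>(1 / 8) ^ m\<close> remains in front.\<close>
      let ?s = "8 ^ m * norm (ham a (g m) x)"
      have "norm (y x) * ?s \<le> norm (y x) powr p / p + ?s powr q / q"
        by (rule Youngs_inequality) (use p q1 conj in auto)
      also have "\<dots> \<le> norm (y x) powr p / 1 + ?s powr q / 1"
        using p q1 by (intro add_mono divide_left_mono) auto
      finally have Y: "norm (y x) * ?s \<le> (8 ^ m) powr q * norm (ham a (g m) x) powr q + norm (y x) powr p"
        by (simp add: powr_mult)
      have "norm (of_nat (deg adj x) * ham a (g m) x * y x) = real (deg adj x) * ((1 / 8) ^ m * (norm (y x) * ?s))"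
        by (simp add: norm_mult power_divide)
      also have "\<dots> \<le> total_deg * ((1 / 8) ^ m * (norm (y x) * ?s))"
        by (intro mult_right_mono deg_le_total) auto
      also have "\<dots> \<le> total_deg * ((1 / 8) ^ m * ((8 ^ m) powr q * norm (ham a (g m) x) powr q + norm (y x) powr p))"
        by (intro mult_left_mono Y) (auto simp: total_deg_def sum_nonneg)
      finally show "norm (of_nat (deg adj x) * ham a (g m) x * y x)
          \<le> total_deg * ((1 / 8) ^ m * ((8 ^ m) powr q * norm (ham a (g m) x) powr q + norm (y x) powr p))" .
    qed
    also have "\<dots> = total_deg * ((1 / 8) ^ m * ((8 ^ m) powr q * (\<Sum>x\<in>S. norm (ham a (g m) x) powr q) + (\<Sum>x\<in>S. norm (y x) powr p)))"
      by (simp only: sum_distrib_left[symmetric] sum.distrib)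
    also have "\<dots> \<le> total_deg * ((1 / 8) ^ m * ((8 ^ m) powr q * (1 / 8 ^ m) powr q + psum p y))"
    proof (intro mult_left_mono add_mono)
      have "ham a (g m) \<in> lp q" using lp_boundedD[OF lp_bounded_ham[OF _ bdd] g_lp] q1 by simp
      then show "(\<Sum>x\<in>S. norm (ham a (g m) x) powr q) \<le> (1 / 8 ^ m) powr q"
        using sum_le_psum[OF _ S, of "ham a (g m)" q] W(1)[of m] by (simp add: weyl_def)
      show "(\<Sum>x\<in>S. norm (y x) powr p) \<le> psum p y" by (rule sum_le_psum[OF y(1) S])
    qed (auto simp: total_deg_def sum_nonneg)
    also have "(8 ^ m) powr q * (1 / 8 ^ m) powr q = (1 :: real)"
      by (subst powr_mult[symmetric]) simp
    finally have "(1 / 2) ^ m \<le> C * (1 / 8) ^ m" by (simp add: C_def mult.commute mult.left_commute)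
    then have "(1 / 2) ^ m * 8 ^ m \<le> C * (1 / 8) ^ m * 8 ^ m" by (intro mult_right_mono) auto
    then show ?thesis by (simp add: power_mult_distrib[symmetric] mult.assoc)
  qed
  obtain m where "C < 4 ^ m" using real_arch_pow[of 4 C] by auto
  then show False using bound[of m] by simp
qed

end

theorem theorem6p2:
  fixes adj :: "'x::countable \<Rightarrow> 'x \<Rightarrow> bool"
    and act :: "('n::finite \<Rightarrow> int) \<Rightarrow> 'x \<Rightarrow> 'x"
    and N :: nat and reps :: "nat \<Rightarrow> 'x"
    and v :: "'x \<Rightarrow> complex" and p :: real
  assumes "periodic_graph adj act N reps"
    and "v \<in> SO act"
    and "1 < p"
  shows "ess_spectrum_lp p (schroedinger adj v) =
         (\<Union>w\<in>limit_potentials act v. band_union adj act N reps w)"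
proof -
  interpret periodic adj act N reps by unfold_locales (rule assms(1))
  have ham_eq: "(\<lambda>u x. schroedinger adj v u x - z * u x) = ham (\<lambda>x. z - v x)" for z
    by (simp add: schroedinger_def ham_def lap_def fun_eq_iff algebra_simps)
  obtain V where V: "\<And>x. norm (v x) \<le> V" using assms(2) by (auto simp: SO_def bounded_iff)
  show ?thesis
  proof (intro equalityI subsetI)
    fix z assume "z \<in> ess_spectrum_lp p (schroedinger adj v)"
    then show "z \<in> (\<Union>w\<in>limit_potentials act v. band_union adj act N reps w)"
      using fredholm_outside_bands[OF assms(2), of p z] assms(3)
      by (auto simp: ess_spectrum_lp_def ham_eq)
  next
    fix z assume "z \<in> (\<Union>w\<in>limit_potentials act v. band_union adj act N reps w)"
    then obtain w t where w: "w \<in> limit_potentials act v" and t: "t \<in> torus"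
      and ev: "eigenvalue (symbol adj act N reps w t) z" by (auto simp: band_union_def)
    define c where "c = w (reps 0)"
    have wc: "w = (\<lambda>_. c)" unfolding c_def by (rule limit_potentialsD[OF assms(2) w])
    obtain u x where u: "quasi t u" "u x \<noteq> 0" "\<And>x. lap u x + c * u x = z * u x"
      using ev unfolding wc eigenvalue_symbol_iff[OF t] by blast
    have "norm (z - v x) \<le> norm z + V" for x
      using norm_triangle_ineq4[of z "v x"] V[of x] by linarith
    then have bdd: "bounded (range (\<lambda>x. z - v x))" unfolding bounded_iff by blast
    have "0 < p / (p - 1)" using assms(3) by simp
    then have "\<not> fredholm_lp p (ham (\<lambda>x. z - v x))"
      using ex_weyl[OF w[unfolded wc] V t u]
      by (intro not_fredholm_lpI[OF assms(3) refl bdd]) blast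
    then show "z \<in> ess_spectrum_lp p (schroedinger adj v)" by (simp add: ess_spectrum_lp_def ham_eq)
  qed
qed

end
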